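(* Fix $d\in\mathbb{N}$ and $n\ge d$. Let $\xi_1,\dots,\xi_n$ be (possibly dependent) random vectors in $\mathbb{R}^d$, let $S_0=0$ and $S_i=\xi_1+\dots+\xi_i$ for $1\le i\le n$, and let $\mathcal{Q}_{n,d}=\mathrm{conv}(S_0,S_1,\dots,S_n)$. Assume: (Ex) for every permutation $\pi$ of $\{1,\dots,n\}$, $(\xi_{\pi(1)},\dots,\xi_{\pi(n)})$ has the same distribution as $(\xi_1,\dots,\xi_n)$; (GP) for all $1\le i_1<\dots<i_d\le n$, the probability that $S_{i_1},\dots,S_{i_d}$ are linearly dependent is $0$. Then for every $j\in\{0,\dots,d-1\}$ and $k\in\{0,\dots,d\}$, $$\mathbb{E}\sum_{F\in\mathcal{F}_j(\mathcal{Q}_{n,d})}\gamma_k\big(T_F(\mathcal{Q}_{n,d})\big)=\frac{2\cdot j!}{n!}\sum_{l=0}^{\infty}\genfrac{[}{]}{0pt}{}{n+1}{d-2l}\genfrac{\{}{\}}{0pt}{}{d-2l}{j+1}-\frac{2\cdot j!}{n!}\sum_{l=0}^{\infty}\genfrac{[}{]}{0pt}{}{n+1}{k-2l}\genfrac{\{}{\}}{0pt}{}{k-2l}{j+1}.$$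
   Context: $\mathbb{N}=\{1,2,\dots\}$. For a polyhedral cone $C\subset\mathbb{R}^d$ (the set of nonnegative linear combinations of finitely many vectors) and $k\in\{0,\dots,d\}$, the $k$-th Grassmann angle is $\gamma_k(C)=\mathbb{P}[W_{d-k}\cap C\neq\{0\}]$, where $W_{d-k}$ is a random $(d-k)$-dimensional linear subspace of $\mathbb{R}^d$ with the uniform (rotation invariant) distribution on the Grassmannian. For a polytope $P$, $\mathcal{F}_j(P)$ is the set of its $j$-dimensional faces ($P$ itself being a face). The tangent cone of $P\subset\mathbb{R}^d$ at a face $F$ is $T_F(P)=\{v\in\mathbb{R}^d: f_0+\varepsilon v\in P\text{ for some }\varepsilon>0\}$, where $f_0$ is any point of the relative interior of $F$. For a random polytope, angles are computed for each realization. $\genfrac{[}{]}{0pt}{}{n}{m}$ is the (signless) Stirling number of the first kind (number of permutations of an $n$-element set with exactly $m$ cycles) and $\genfrac{\{}{\}}{0pt}{}{n}{m}$ the Stirling number of the second kind (number of partitions of an $n$-element set into $m$ non-empty subsets), for $n\in\mathbb{N}$, $m\in\{1,\dots,n\}$; both are $0$ for $n\in\mathbb{N}$ and $m\notin\{1,\dots,n\}$. A product $\genfrac{[}{]}{0pt}{}{n+1}{m}\genfrac{\{}{\}}{0pt}{}{m}{i}$ with $m\le 0$ is $0$, so all sums are finite. *)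

theory Defs
  imports "HOL-Probability.Probability" "HOL-Combinatorics.Stirling"
begin

definition grassmannian :: "nat \<Rightarrow> (real^'d) set set" where
  "grassmannian m = {W. subspace W \<and> dim W = m}"

(* For a subspace W, "closest_point W" is the orthogonal projection onto W. The Grassmannian
   carries the topology induced by sending W to its projection matrix; its Borel
   sigma-algebra is the pullback of the Borel sigma-algebra on matrices. *)
definition borel_grassmannian :: "nat \<Rightarrow> (real^'d) set measure" where
  "borel_grassmannian m =
     vimage_algebra (grassmannian m) (\<lambda>W. matrix (closest_point W) :: real^'d^'d) borel"

definition is_uniform_grassmannian :: "nat \<Rightarrow> (real^'d) set measure \<Rightarrow> bool" where
  "is_uniform_grassmannian m \<mu> \<longleftrightarrow>
     prob_space \<mu> \<and> sets \<mu> = sets (borel_grassmannian m) \<and>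
     (\<forall>g. orthogonal_transformation g \<longrightarrow> distr \<mu> \<mu> (\<lambda>W. g ` W) = \<mu>)"

(* For m \<le> CARD('d) there is exactly one rotation invariant Borel probability measure on the
   Grassmannian, so the choice is immaterial. *)
definition uniform_grassmannian :: "nat \<Rightarrow> (real^'d) set measure" where
  "uniform_grassmannian m = (SOME \<mu>. is_uniform_grassmannian m \<mu>)"

definition grassmann_angle :: "nat \<Rightarrow> (real^'d) set \<Rightarrow> real" where
  "grassmann_angle k C =
     measure (uniform_grassmannian (CARD('d) - k))
       {W \<in> grassmannian (CARD('d) - k). W \<inter> C \<noteq> {0}}"

definition faces :: "nat \<Rightarrow> (real^'d) set \<Rightarrow> (real^'d) set set" where
  "faces j P = {F. F face_of P \<and> aff_dim F = int j}"

(* For convex P and a non-empty face F the result does not depend on the chosen point of the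
   relative interior. *)
definition tangent_cone :: "(real^'d) set \<Rightarrow> (real^'d) set \<Rightarrow> (real^'d) set" where
  "tangent_cone F P =
     (let f0 = (SOME x. x \<in> rel_interior F) in {v. \<exists>\<epsilon>>0. f0 + \<epsilon> *\<^sub>R v \<in> P})"

definition walk :: "(nat \<Rightarrow> 'w \<Rightarrow> real^'d) \<Rightarrow> nat \<Rightarrow> 'w \<Rightarrow> real^'d" where
  "walk \<xi> i \<omega> = (\<Sum>r\<in>{1..i}. \<xi> r \<omega>)"

definition walk_hull :: "(nat \<Rightarrow> 'w \<Rightarrow> real^'d) \<Rightarrow> nat \<Rightarrow> 'w \<Rightarrow> (real^'d) set" where
  "walk_hull \<xi> n \<omega> = convex hull ((\<lambda>i. walk \<xi> i \<omega>) ` {0..n})"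

(* Dependence of an indexed family: unlike "dependent (v ` I)", a repeated vector
   already makes the family dependent. *)
definition dependent_family :: "'i set \<Rightarrow> ('i \<Rightarrow> real^'d) \<Rightarrow> bool" where
  "dependent_family I v \<longleftrightarrow>
     (\<exists>c. (\<exists>i\<in>I. c i \<noteq> 0) \<and> (\<Sum>i\<in>I. c i *\<^sub>R v i) = 0)"

definition exchangeable :: "'w measure \<Rightarrow> nat \<Rightarrow> (nat \<Rightarrow> 'w \<Rightarrow> real^'d) \<Rightarrow> bool" where
  "exchangeable M n \<xi> \<longleftrightarrow>
     (\<forall>\<pi>. \<pi> permutes {1..n} \<longrightarrow>
        distr M (PiM {1..n} (\<lambda>_. borel)) (\<lambda>\<omega>. \<lambda>i\<in>{1..n}. \<xi> (\<pi> i) \<omega>) =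
        distr M (PiM {1..n} (\<lambda>_. borel)) (\<lambda>\<omega>. \<lambda>i\<in>{1..n}. \<xi> i \<omega>))"

(* The index tuples i_1 < ... < i_d in {1..n} are the d-element subsets I of {1..n}. *)
definition general_position :: "'w measure \<Rightarrow> nat \<Rightarrow> (nat \<Rightarrow> 'w \<Rightarrow> real^'d) \<Rightarrow> bool" where
  "general_position M n \<xi> \<longleftrightarrow>
     (\<forall>I. I \<subseteq> {1..n} \<and> card I = CARD('d) \<longrightarrow>
        measure M {\<omega> \<in> space M. dependent_family I (\<lambda>i. walk \<xi> i \<omega>)} = 0)"

(* The summand at l is [n+1, m-2l] {m-2l, i}, signless Stirling numbers of the first and of
   the second kind. For 2 * l \<ge> m truncated subtraction makes the lower index of the first
   factor 0, and stirling (n + 1) 0 = 0, so these summands vanish, as do those with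
   m - 2 * l \<le> 0 by the usual convention. The series is therefore a finite sum. *)
definition stirling_sum :: "nat \<Rightarrow> nat \<Rightarrow> nat \<Rightarrow> real" where
  "stirling_sum n m i =
     (\<Sum>l. real (stirling (n + 1) (m - 2 * l) * Stirling (m - 2 * l) i))"

end

theory Submission
  imports Defs
begin

text \<open>
  A generic subspace W meets the tangent cone of the hull Q at a face F non-trivially exactly when F
  stops being a face once Q is projected along W. The sum of the Grassmann angles over the j-faces is
  therefore the number of j-faces of Q minus the mean number of j-faces of Q projected along a
  uniform (d - k)-dimensional W, and the two terms of the formula are these two numbers. They are
  treated at once: a set I of j + 1 times is \<^emph>\<open>absorbed\<close> by W if some non-zero weights with sum zero,
  non-negative off I, combine the positions S_0, ..., S_n to a vector of W. In general position, faces
  of Q are the sets that {0} does not absorb, and faces of the projection those that W does not absorb.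

  Summation by parts replaces weights on the positions by weights c on the increments, with c_0 = 0.
  The sign condition becomes that c is weakly decreasing along the cyclic order 0, 1, ..., n except
  at the cuts after the times of I. Permuting the increments permutes this cyclic order, so that
  summing over all permutations and all I means counting, over all cyclic orders of {0..n} with
  j + 1 cuts, the cones that the kernel of c \<mapsto> \<Sum> c_r \<xi>_r mod W meets only in 0. For fixed
  blocks between the cuts these cones are the chambers of a product of braid arrangements, and the
  number of chambers missed by a generic subspace depends only on its codimension k
  (unmet_cones_eq). The count is an induction over the number of elements: when a new element is
  inserted into the blocks of a chamber that is met, the positions whose cone is missed correspond to
  the walls that are missed (unmet_slots_eq_unmet_walls), which is deletion and restriction for
  arrangements, and the resulting recursion is that of the Stirling numbers. Both W = {0} and almost every random W are
  generic for almost every realization, the latter because a uniform subspace almost surely avoids a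
  fixed subspace of complementary dimension (measure_meets_subspace_eq_0).

  Hence the angle sum, summed over all orders of the increments, is almost surely constant.
  Exchangeability gives all n! summands the same mean, which yields the expectation. Since the probability space need not be complete, the angle sum also has to be
  a measurable function of the increments on the null event where the walk is degenerate; it is a
  finite sum of terms that are described by closed conditions on weights
  (borel_measurable_angle_sum).
\<close>

section \<open>Cyclic permutations\<close>

definition rotate_up :: "nat \<Rightarrow> nat \<Rightarrow> nat" where
  "rotate_up n i = (if i < n then Suc i else if i = n then 0 else i)"

text \<open>
  Permutations that form a single cycle, expressed by the absence of proper invariant sets: in this
  form the property passes easily to the permutation with one element inserted or removed.
\<close>

definition cyclic_perms :: "nat \<Rightarrow> (nat \<Rightarrow> nat) set" where
  "cyclic_perms n = {\<sigma>. \<sigma> permutes {..n} \<and>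
     (\<forall>S. S \<subseteq> {..n} \<longrightarrow> S \<noteq> {} \<longrightarrow> \<sigma> ` S \<subseteq> S \<longrightarrow> S = {..n})}"

lemma cyclic_perms_permutes: "\<sigma> \<in> cyclic_perms n \<Longrightarrow> \<sigma> permutes {..n}"
  by (simp add: cyclic_perms_def)

lemma cyclic_permsD:
  "\<lbrakk>\<sigma> \<in> cyclic_perms n; S \<subseteq> {..n}; S \<noteq> {}; \<And>x. x \<in> S \<Longrightarrow> \<sigma> x \<in> S\<rbrakk> \<Longrightarrow> S = {..n}"
  unfolding cyclic_perms_def by blast

lemma finite_cyclic_perms: "finite (cyclic_perms n)"
  by (rule finite_subset[OF _ finite_permutations[of "{..n}"]]) (auto simp: cyclic_perms_def)

lemma cyclic_perms_0: "cyclic_perms 0 = {id}"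
  by (auto simp: cyclic_perms_def)

lemma cyclic_perms_le: "\<sigma> \<in> cyclic_perms n \<Longrightarrow> a \<le> n \<Longrightarrow> \<sigma> a \<le> n"
  using permutes_in_image[OF cyclic_perms_permutes, of \<sigma> n a] by simp

lemma cyclic_perms_fix: "\<sigma> \<in> cyclic_perms n \<Longrightarrow> n < a \<Longrightarrow> \<sigma> a = a"
  using permutes_not_in[OF cyclic_perms_permutes, of \<sigma> n a] by simp

lemma cyclic_perms_inj: "\<sigma> \<in> cyclic_perms n \<Longrightarrow> inj \<sigma>"
  using permutes_inj[OF cyclic_perms_permutes] by blast

lemma cyclic_perms_no_fixpoint:
  assumes "\<sigma> \<in> cyclic_perms n" "0 < n" "a \<le> n"
  shows "\<sigma> a \<noteq> a"
proof
  assume "\<sigma> a = a"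
  then have "{a} = {..n}"
    using \<open>\<sigma> a = a\<close> assms by (intro cyclic_permsD[OF assms(1)]) auto
  then have "card {a} = card {..n}" by (rule arg_cong)
  with \<open>0 < n\<close> show False by simp
qed

definition insert_after :: "(nat \<Rightarrow> nat) \<Rightarrow> nat \<Rightarrow> nat \<Rightarrow> nat \<Rightarrow> nat" where
  "insert_after \<sigma> v a = \<sigma>(a := v, v := \<sigma> a)"

lemma insert_after_cyclic:
  assumes \<sigma>: "\<sigma> \<in> cyclic_perms n" and a: "a \<le> n"
  shows "insert_after \<sigma> (Suc n) a \<in> cyclic_perms (Suc n)"
proof -
  have "insert_after \<sigma> (Suc n) a = \<sigma> \<circ> Transposition.transpose a (Suc n)"
    using a cyclic_perms_fix[OF \<sigma>] by (auto simp: insert_after_def fun_eq_iff Transposition.transpose_def)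
  moreover have "\<sigma> permutes {..Suc n}"
    using cyclic_perms_permutes[OF \<sigma>] by (rule permutes_subset) auto
  moreover have "Transposition.transpose a (Suc n) permutes {..Suc n}"
    using a by (intro permutes_swap_id) auto
  ultimately have perm: "insert_after \<sigma> (Suc n) a permutes {..Suc n}"
    by (simp add: permutes_compose)
  have "S = {..Suc n}"
    if S: "S \<subseteq> {..Suc n}" "S \<noteq> {}" and inv: "\<And>x. x \<in> S \<Longrightarrow> insert_after \<sigma> (Suc n) a x \<in> S" for S
  proof -
    define T where "T = S - {Suc n}"
    have step: "\<sigma> b \<in> T" if "b \<in> T" for b
    proof -
      have b: "b \<le> n" "b \<in> S" using that S by (auto simp: T_def le_Suc_eq)
      have "\<sigma> b \<in> S"
      proof (cases "b = a")
        case True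
        then have "Suc n \<in> S" using inv[OF b(2)] a by (simp add: insert_after_def)
        from inv[OF this] True show ?thesis by (simp add: insert_after_def)
      next
        case False
        then show ?thesis using inv[OF b(2)] b by (simp add: insert_after_def)
      qed
      then show ?thesis using cyclic_perms_le[OF \<sigma> b(1)] by (simp add: T_def)
    qed
    have "T \<noteq> {}"
    proof
      assume "T = {}"
      then have "S = {Suc n}" using S by (auto simp: T_def)
      then have "\<sigma> a = Suc n" using inv[of "Suc n"] by (simp add: insert_after_def)
      with cyclic_perms_le[OF \<sigma> a] show False by simp
    qed
    moreover have "T \<subseteq> {..n}" using S by (auto simp: T_def le_Suc_eq)
    ultimately have T: "T = {..n}" using step by (intro cyclic_permsD[OF \<sigma>])
    then have "a \<in> S" using a by (auto simp: T_def)
    from inv[OF this] a have "Suc n \<in> S" by (simp add: insert_after_def)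
    moreover have "{..n} \<subseteq> S" using T by (auto simp: T_def)
    ultimately have "{..Suc n} \<subseteq> S" by (simp add: atMost_Suc)
    with S show ?thesis by blast
  qed
  with perm show ?thesis unfolding cyclic_perms_def by blast
qed

lemma insert_after_surj:
  assumes \<sigma>: "\<sigma> \<in> cyclic_perms (Suc n)"
  shows "\<exists>\<rho>\<in>cyclic_perms n. \<exists>a\<le>n. \<sigma> = insert_after \<rho> (Suc n) a"
proof -
  define v where "v = Suc n"
  have perm: "\<sigma> permutes {..v}" using cyclic_perms_permutes[OF \<sigma>] by (simp add: v_def)
  define a where "a = inv \<sigma> v"
  have av: "\<sigma> a = v" by (simp add: a_def permutes_inverses[OF perm])
  have "a \<in> {..v}" using permutes_in_image[OF perm, of a] av by simp
  moreover have "a \<noteq> v" using cyclic_perms_no_fixpoint[OF \<sigma>, of v] av by (auto simp: v_def)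
  ultimately have a: "a \<le> n" by (simp add: v_def)
  define \<rho> where "\<rho> = \<sigma>(a := \<sigma> v, v := v)"
  have \<rho>eq: "\<rho> = \<sigma> \<circ> Transposition.transpose a v"
    using av by (auto simp: \<rho>_def fun_eq_iff Transposition.transpose_def)
  have "\<rho> permutes {..v}"
    unfolding \<rho>eq using a by (intro permutes_compose[OF permutes_swap_id perm]) (auto simp: v_def)
  then have "\<rho> permutes {..n}"
    by (rule permutes_superset) (auto simp: v_def le_Suc_eq \<rho>_def)
  moreover have "S = {..n}" if S: "S \<subseteq> {..n}" "S \<noteq> {}" and inv: "\<rho> ` S \<subseteq> S" for S
  proof (cases "a \<in> S")
    case True
    have "insert v S = {..Suc n}"
    proof (rule cyclic_permsD[OF \<sigma>])
      fix x assume x: "x \<in> insert v S"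
      show "\<sigma> x \<in> insert v S"
      proof (cases "x = a \<or> x = v")
        case True
        have "\<rho> a \<in> S" using \<open>a \<in> S\<close> inv by auto
        with True av a show ?thesis by (auto simp: \<rho>_def v_def)
      next
        case False
        with x inv have "\<rho> x \<in> S" by auto
        with False show ?thesis by (simp add: \<rho>_def)
      qed
    qed (use S in \<open>auto simp: v_def\<close>)
    then have "insert v S = insert v {..n}" by (simp add: v_def atMost_Suc)
    moreover have "v \<notin> S" "v \<notin> {..n}" using S by (auto simp: v_def)
    ultimately show ?thesis by (simp add: insert_ident)
  next
    case False
    have "S = {..Suc n}"
    proof (rule cyclic_permsD[OF \<sigma>])
      fix x assume x: "x \<in> S"
      then have "x \<noteq> a" "x \<noteq> v" using False S by (auto simp: v_def)
      moreover have "\<rho> x \<in> S" using inv x by auto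
      ultimately show "\<sigma> x \<in> S" by (simp add: \<rho>_def)
    qed (use S in auto)
    with S show ?thesis by auto
  qed
  ultimately have "\<rho> \<in> cyclic_perms n" unfolding cyclic_perms_def by blast
  moreover have "\<sigma> = insert_after \<rho> v a"
    using av a by (auto simp: insert_after_def \<rho>_def fun_eq_iff v_def)
  ultimately show ?thesis using a by (auto simp: v_def)
qed

text \<open>
  Removing the largest element from a cycle leaves a cycle, and the predecessor of that element
  records where it was. All inductions over cyclic orders below use this bijection.
\<close>

lemma bij_betw_insert_after:
  "bij_betw (\<lambda>(\<sigma>, a). insert_after \<sigma> (Suc n) a) (cyclic_perms n \<times> {..n}) (cyclic_perms (Suc n))"
proof (rule bij_betw_imageI)
  show "inj_on (\<lambda>(\<sigma>, a). insert_after \<sigma> (Suc n) a) (cyclic_perms n \<times> {..n})"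
  proof (rule inj_onI, clarify)
    fix \<sigma> a \<rho> b
    assume \<sigma>: "\<sigma> \<in> cyclic_perms n" and \<rho>: "\<rho> \<in> cyclic_perms n" and ab: "a \<le> n" "b \<le> n"
      and eq: "insert_after \<sigma> (Suc n) a = insert_after \<rho> (Suc n) b"
    from cyclic_perms_inj[OF insert_after_cyclic[OF \<rho> ab(2)]]
    have inj: "inj (insert_after \<rho> (Suc n) b)" .
    have "insert_after \<rho> (Suc n) b a = Suc n"
      using ab unfolding eq[symmetric] by (simp add: insert_after_def)
    also have "\<dots> = insert_after \<rho> (Suc n) b b"
      using ab by (simp add: insert_after_def)
    finally have "insert_after \<rho> (Suc n) b a = insert_after \<rho> (Suc n) b b" .
    then have "a = b" using inj by (simp add: inj_eq)
    moreover have "\<sigma> x = \<rho> x" for x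
    proof (cases "x = a")
      case True
      then show ?thesis using fun_cong[OF eq, of "Suc n"] \<open>a = b\<close> by (simp add: insert_after_def)
    next
      case False
      then show ?thesis
        using fun_cong[OF eq, of x] \<open>a = b\<close> cyclic_perms_fix[OF \<sigma>, of x] cyclic_perms_fix[OF \<rho>, of x]
        by (cases "x = Suc n") (auto simp: insert_after_def)
    qed
    ultimately show "\<sigma> = \<rho> \<and> a = b" by auto
  qed
  show "(\<lambda>(\<sigma>, a). insert_after \<sigma> (Suc n) a) ` (cyclic_perms n \<times> {..n}) = cyclic_perms (Suc n)"
  proof
    show "(\<lambda>(\<sigma>, a). insert_after \<sigma> (Suc n) a) ` (cyclic_perms n \<times> {..n}) \<subseteq> cyclic_perms (Suc n)"
      using insert_after_cyclic by auto
    show "cyclic_perms (Suc n) \<subseteq> (\<lambda>(\<sigma>, a). insert_after \<sigma> (Suc n) a) ` (cyclic_perms n \<times> {..n})"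
    proof
      fix \<sigma> assume "\<sigma> \<in> cyclic_perms (Suc n)"
      from insert_after_surj[OF this] obtain \<rho> a
        where "\<rho> \<in> cyclic_perms n" "a \<le> n" "\<sigma> = insert_after \<rho> (Suc n) a" by blast
      then show "\<sigma> \<in> (\<lambda>(\<sigma>, a). insert_after \<sigma> (Suc n) a) ` (cyclic_perms n \<times> {..n})"
        by (intro image_eqI[of _ _ "(\<rho>, a)"]) auto
    qed
  qed
qed

lemma card_cyclic_perms: "card (cyclic_perms n) = fact n"
proof (induction n)
  case 0
  show ?case by (simp add: cyclic_perms_0)
next
  case (Suc n)
  have "card (cyclic_perms (Suc n)) = card (cyclic_perms n \<times> {..n})"
    using bij_betw_same_card[OF bij_betw_insert_after] by simp
  with Suc show ?case by (simp add: card_cartesian_product)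
qed

lemma rotate_up_permutes: "rotate_up n permutes {..n}"
proof (rule bij_imp_permutes)
  have "inj_on (rotate_up n) {..n}"
    by (intro inj_onI) (simp add: rotate_up_def split: if_splits)
  moreover have "rotate_up n ` {..n} \<subseteq> {..n}"
    by (auto simp: rotate_up_def)
  ultimately show "bij_betw (rotate_up n) {..n} {..n}"
    by (intro bij_betw_imageI endo_inj_surj) auto
qed (auto simp: rotate_up_def)

lemma rotate_up_cyclic: "rotate_up n \<in> cyclic_perms n"
proof -
  have "S = {..n}" if S: "S \<subseteq> {..n}" "S \<noteq> {}" and inv: "rotate_up n ` S \<subseteq> S" for S
  proof -
    have up: "x + m \<in> S" if "x \<in> S" "x + m \<le> n" for x m
      using that
    proof (induction m)
      case (Suc m)
      then have "rotate_up n (x + m) \<in> S" using inv by auto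
      with Suc.prems show ?case by (simp add: rotate_up_def)
    qed simp
    obtain x where "x \<in> S" using S by blast
    with S have "n \<in> S" using up[of x "n - x"] by auto
    then have "rotate_up n n \<in> S" using inv by auto
    then have "0 \<in> S" by (simp add: rotate_up_def)
    then have "{..n} \<subseteq> S" using up[of 0] by auto
    with S show ?thesis by blast
  qed
  then show ?thesis using rotate_up_permutes by (auto simp: cyclic_perms_def)
qed

lemma permutes_1_zero: "\<pi> permutes {1..n} \<Longrightarrow> \<pi> 0 = (0::nat)"
  by (erule permutes_not_in) simp

lemma permutes_1_atMost: "\<pi> permutes {1..n} \<Longrightarrow> \<pi> permutes {..n::nat}"
  by (rule permutes_subset) auto

lemma conj_rotate_cyclic:
  assumes \<pi>: "\<pi> permutes {..n}"
  shows "\<pi> \<circ> rotate_up n \<circ> inv \<pi> \<in> cyclic_perms n"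
proof -
  have "S = {..n}" if S: "S \<subseteq> {..n}" "S \<noteq> {}" and inv: "(\<pi> \<circ> rotate_up n \<circ> inv \<pi>) ` S \<subseteq> S" for S
  proof -
    have "inv \<pi> ` S = {..n}"
    proof (rule cyclic_permsD[OF rotate_up_cyclic])
      show "inv \<pi> ` S \<subseteq> {..n}"
        using S permutes_image[OF permutes_inv[OF \<pi>]] by blast
      show "rotate_up n x \<in> inv \<pi> ` S" if x: "x \<in> inv \<pi> ` S" for x
      proof -
        obtain y where y: "y \<in> S" "x = inv \<pi> y" using x by blast
        then have "\<pi> (rotate_up n x) \<in> S" using inv by auto
        then show ?thesis by (intro image_eqI[of _ _ "\<pi> (rotate_up n x)"]) (simp_all add: permutes_inverses(2)[OF \<pi>])
      qed
    qed (use S in auto)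
    then have "\<pi> ` inv \<pi> ` S = {..n}" using permutes_image[OF \<pi>] by simp
    then show ?thesis by (simp only: image_image permutes_inverses(1)[OF \<pi>] image_ident)
  qed
  moreover have "\<pi> \<circ> rotate_up n \<circ> inv \<pi> permutes {..n}"
    by (rule permutes_compose[OF permutes_inv[OF \<pi>] permutes_compose[OF rotate_up_permutes \<pi>]])
  ultimately show ?thesis by (auto simp: cyclic_perms_def)
qed

text \<open>
  The cyclic order of the times 0, ..., n becomes, after the increments are permuted, an arbitrary
  cyclic order of {0..n}. Since 0 is fixed, a cyclic order determines the permutation: follow
  the cycle from 0. Surjectivity follows by counting.
\<close>

lemma bij_betw_conj_rotate:
  "bij_betw (\<lambda>\<pi>. \<pi> \<circ> rotate_up n \<circ> inv \<pi>) {\<pi>. \<pi> permutes {1..n}} (cyclic_perms n)"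
proof -
  have inj: "inj_on (\<lambda>\<pi>. \<pi> \<circ> rotate_up n \<circ> inv \<pi>) {\<pi>. \<pi> permutes {1..n}}"
  proof (rule inj_onI, clarify)
    fix \<pi> \<rho> assume \<pi>: "\<pi> permutes {1..n}" and \<rho>: "\<rho> permutes {1..n}"
      and eq: "\<pi> \<circ> rotate_up n \<circ> inv \<pi> = \<rho> \<circ> rotate_up n \<circ> inv \<rho>"
    have suc: "\<tau> (Suc i) = (\<tau> \<circ> rotate_up n \<circ> inv \<tau>) (\<tau> i)" if "\<tau> permutes {1..n}" "i < n" for \<tau> i
      using that by (simp add: permutes_inverses(2)[OF that(1)] rotate_up_def)
    have le: "\<pi> i = \<rho> i" if "i \<le> n" for i
      using that
    proof (induction i)
      case 0
      show ?case by (simp only: permutes_1_zero[OF \<pi>] permutes_1_zero[OF \<rho>])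
    next
      case (Suc i)
      then show ?case using suc[OF \<pi>, of i] suc[OF \<rho>, of i] eq by simp
    qed
    show "\<pi> = \<rho>"
    proof
      fix i show "\<pi> i = \<rho> i"
        using le[of i] permutes_not_in[OF \<pi>, of i] permutes_not_in[OF \<rho>, of i] by (cases "i \<le> n") auto
    qed
  qed
  have sub: "(\<lambda>\<pi>. \<pi> \<circ> rotate_up n \<circ> inv \<pi>) ` {\<pi>. \<pi> permutes {1..n}} \<subseteq> cyclic_perms n"
    by (auto intro!: conj_rotate_cyclic permutes_1_atMost)
  have "card ((\<lambda>\<pi>. \<pi> \<circ> rotate_up n \<circ> inv \<pi>) ` {\<pi>. \<pi> permutes {1..n}}) = card {\<pi>. \<pi> permutes {1..n}}"
    by (rule card_image[OF inj])
  also have "\<dots> = card (cyclic_perms n)"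
    by (simp add: card_cyclic_perms card_permutations)
  finally have "(\<lambda>\<pi>. \<pi> \<circ> rotate_up n \<circ> inv \<pi>) ` {\<pi>. \<pi> permutes {1..n}} = cyclic_perms n"
    by (rule card_subset_eq[OF finite_cyclic_perms sub])
  with inj show ?thesis by (rule bij_betw_imageI)
qed

section \<open>General position modulo a subspace\<close>

text \<open>
  The family y is independent in the quotient by W. Working with W directly avoids the quotient space.
\<close>

lemma independent_modulo_subspace:
  fixes y :: "'i \<Rightarrow> 'a::euclidean_space"
  assumes W: "subspace W" and A: "finite A"
    and indep: "\<And>c. (\<Sum>r\<in>A. c r *\<^sub>R y r) \<in> W \<Longrightarrow> \<forall>r\<in>A. c r = 0"
  shows "inj_on y A" and "dim (span (y ` A)) = card A" and "W \<inter> span (y ` A) = {0}"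
    and "u \<in> span (y ` A) \<Longrightarrow> \<exists>c. u = (\<Sum>r\<in>A. c r *\<^sub>R y r)"
proof -
  show inj: "inj_on y A"
  proof (rule inj_onI, rule ccontr)
    fix p q assume pq: "p \<in> A" "q \<in> A" "y p = y q" "p \<noteq> q"
    define c where "c r = (if r = p then 1 else if r = q then -1 else 0 :: real)" for r
    have "(\<Sum>r\<in>A. c r *\<^sub>R y r) = (\<Sum>r\<in>{p, q}. c r *\<^sub>R y r)"
      using pq A by (intro sum.mono_neutral_right) (auto simp: c_def)
    also have "\<dots> = 0" using pq by (simp add: c_def)
    finally have "(\<Sum>r\<in>A. c r *\<^sub>R y r) \<in> W" using subspace_0[OF W] by simp
    from indep[OF this] pq show False by (auto simp: c_def)
  qed
  have rep: "\<exists>c. u = (\<Sum>r\<in>A. c r *\<^sub>R y r)" if u: "u \<in> span (y ` A)" for u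
  proof -
    obtain a where "u = (\<Sum>v\<in>y ` A. a v *\<^sub>R v)"
      using u span_finite[of "y ` A"] A by auto
    then have "u = (\<Sum>r\<in>A. a (y r) *\<^sub>R y r)"
      using inj by (simp add: sum.reindex)
    then show ?thesis by (intro exI[of _ "\<lambda>r. a (y r)"])
  qed
  show "u \<in> span (y ` A) \<Longrightarrow> \<exists>c. u = (\<Sum>r\<in>A. c r *\<^sub>R y r)" by (rule rep)
  have "independent (y ` A)"
  proof (rule independent_if_scalars_zero)
    fix f x assume f: "(\<Sum>x\<in>y ` A. f x *\<^sub>R x) = 0" and x: "x \<in> y ` A"
    have "(\<Sum>r\<in>A. f (y r) *\<^sub>R y r) = 0"
      using f inj by (simp add: sum.reindex)
    then have "(\<Sum>r\<in>A. f (y r) *\<^sub>R y r) \<in> W" using subspace_0[OF W] by simp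
    from indep[OF this] x show "f x = 0" by auto
  qed (use A in simp)
  then show "dim (span (y ` A)) = card A"
    using inj by (simp add: dim_eq_card_independent card_image)
  show "W \<inter> span (y ` A) = {0}"
  proof
    show "W \<inter> span (y ` A) \<subseteq> {0}"
    proof
      fix u assume u: "u \<in> W \<inter> span (y ` A)"
      then obtain c where c: "u = (\<Sum>r\<in>A. c r *\<^sub>R y r)" using rep by blast
      with u have "(\<Sum>r\<in>A. c r *\<^sub>R y r) \<in> W" by simp
      from indep[OF this] c show "u \<in> {0}" by simp
    qed
    show "{0} \<subseteq> W \<inter> span (y ` A)" using subspace_0[OF W] by (simp add: span_zero)
  qed
qed

lemma card_le_if_independent_modulo:
  fixes y :: "'i \<Rightarrow> 'a::euclidean_space"
  assumes W: "subspace W" "dim W + k = DIM('a)" and A: "finite A"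
    and indep: "\<And>c. (\<Sum>r\<in>A. c r *\<^sub>R y r) \<in> W \<Longrightarrow> \<forall>r\<in>A. c r = 0"
  shows "card A \<le> k"
proof -
  note i = independent_modulo_subspace[OF W(1) A, of y, OF indep]
  have "dim {x + z |x z. x \<in> W \<and> z \<in> span (y ` A)} + dim (W \<inter> span (y ` A)) = dim W + dim (span (y ` A))"
    by (intro dim_sums_Int W(1) subspace_span)
  moreover have "dim {x + z |x z. x \<in> W \<and> z \<in> span (y ` A)} \<le> DIM('a)"
    by (rule dim_subset_UNIV)
  ultimately show ?thesis using i(2,3) W(2) by simp
qed

text \<open>
  As many vectors as the codimension of W, independent modulo W, span a complement of W.
\<close>

lemma sum_complement_UNIV:
  fixes y :: "'i \<Rightarrow> 'a::euclidean_space"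
  assumes W: "subspace W" "dim W + k = DIM('a)" and A: "finite A" "card A = k"
    and indep: "\<And>c. (\<Sum>r\<in>A. c r *\<^sub>R y r) \<in> W \<Longrightarrow> \<forall>r\<in>A. c r = 0"
  shows "\<exists>c. u - (\<Sum>r\<in>A. c r *\<^sub>R y r) \<in> W"
proof -
  note i = independent_modulo_subspace[OF W(1) A(1), of y, OF indep]
  let ?S = "{x + z |x z. x \<in> W \<and> z \<in> span (y ` A)}"
  have "dim ?S + dim (W \<inter> span (y ` A)) = dim W + dim (span (y ` A))"
    by (intro dim_sums_Int W(1) subspace_span)
  then have d: "dim ?S = DIM('a)" using i(2,3) W(2) A(2) by simp
  have s: "subspace ?S" by (intro subspace_sums W(1) subspace_span)
  have "span ?S = UNIV" using d by (simp only: dim_eq_full)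
  moreover have "span ?S = ?S" using s by (simp only: span_eq_iff)
  ultimately have "?S = UNIV" by (simp only:)
  then have "u \<in> ?S" by simp
  then obtain x z where xz: "u = x + z" "x \<in> W" "z \<in> span (y ` A)" by blast
  obtain c where "z = (\<Sum>r\<in>A. c r *\<^sub>R y r)" using i(4)[OF _ xz(3)] by blast
  with xz show ?thesis by (intro exI[of _ c]) simp
qed

text \<open>
  The coefficients live on the arrangement of hyperplanes c_p = c_q in the space with c_0 = 0. A flat
  of dimension at most k of this arrangement consists of the c with at most k + 1 distinct values, 0
  included, so the condition says that the kernel of c \<mapsto> \<Sum> c_r y_r mod W meets these
  flats only in 0, as a generic subspace of codimension k does.
\<close>

definition in_general_position :: "nat \<Rightarrow> 'a::real_vector set \<Rightarrow> nat set \<Rightarrow> (nat \<Rightarrow> 'a) \<Rightarrow> bool" where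
  "in_general_position k W G y \<longleftrightarrow>
     (\<forall>c :: nat \<Rightarrow> real. c 0 = 0 \<longrightarrow> card (c ` G) \<le> Suc k \<longrightarrow> (\<Sum>r\<in>G. c r *\<^sub>R y r) \<in> W \<longrightarrow>
        (\<forall>r\<in>G. c r = 0))"

lemma in_general_positionD:
  "\<lbrakk>in_general_position k W G y; c 0 = 0; card (c ` G) \<le> Suc k; (\<Sum>r\<in>G. c r *\<^sub>R y r) \<in> W; r \<in> G\<rbrakk>
    \<Longrightarrow> c r = 0"
  unfolding in_general_position_def by blast

text \<open>
  On the hyperplane c_v = c_w the coefficient c_w stands for both elements, and v leaves the
  index set.
\<close>

definition merge_vertex :: "nat \<Rightarrow> nat \<Rightarrow> (nat \<Rightarrow> 'a::plus) \<Rightarrow> nat \<Rightarrow> 'a" where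
  "merge_vertex v w y = y(w := y w + y v)"

lemma sum_merge_vertex:
  fixes y :: "nat \<Rightarrow> 'a::real_vector"
  assumes "finite G" "v \<in> G" "w \<in> G" "v \<noteq> w" "c v = c w"
  shows "(\<Sum>r\<in>G - {v}. c r *\<^sub>R merge_vertex v w y r) = (\<Sum>r\<in>G. c r *\<^sub>R y r)"
proof -
  have "(\<Sum>r\<in>G - {v}. c r *\<^sub>R merge_vertex v w y r)
      = c w *\<^sub>R (y w + y v) + (\<Sum>r\<in>G - {v} - {w}. c r *\<^sub>R y r)"
    using assms by (subst sum.remove[of _ w]) (auto simp: merge_vertex_def intro!: sum.cong)
  also have "\<dots> = (\<Sum>r\<in>G. c r *\<^sub>R y r)"
    using assms by (subst sum.remove[of G v], simp, simp, subst sum.remove[of "G - {v}" w])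
      (auto simp: algebra_simps)
  finally show ?thesis .
qed

text \<open>
  A coefficient family on the merged index set has the same values as its extension to v, so flats of
  the restricted arrangement are flats of the original one.
\<close>

lemma in_general_position_merge:
  assumes gp: "in_general_position k W G y" and G: "finite G" "v \<in> G" "w \<in> G" "v \<noteq> w" "v \<noteq> 0"
  shows "in_general_position k W (G - {v}) (merge_vertex v w y)"
  unfolding in_general_position_def
proof (intro allI impI ballI)
  fix c :: "nat \<Rightarrow> real" and r
  assume c: "c 0 = 0" "card (c ` (G - {v})) \<le> Suc k"
    "(\<Sum>r\<in>G - {v}. c r *\<^sub>R merge_vertex v w y r) \<in> W" and r: "r \<in> G - {v}"
  define b where "b = c(v := c w)"
  have "(\<Sum>r\<in>G - {v}. c r *\<^sub>R merge_vertex v w y r) = (\<Sum>r\<in>G - {v}. b r *\<^sub>R merge_vertex v w y r)"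
    by (intro sum.cong) (auto simp: b_def)
  also have "\<dots> = (\<Sum>r\<in>G. b r *\<^sub>R y r)"
    using G by (intro sum_merge_vertex) (auto simp: b_def)
  finally have "(\<Sum>r\<in>G. b r *\<^sub>R y r) \<in> W" using c(3) by simp
  moreover have "b ` G = c ` (G - {v})"
  proof -
    have "b ` (G - {v}) = c ` (G - {v})" by (intro image_cong) (auto simp: b_def)
    moreover have "b v = b w" "w \<in> G - {v}" using G by (auto simp: b_def)
    then have "b ` insert v (G - {v}) = b ` (G - {v})" by auto
    ultimately show ?thesis using G by (simp add: insert_absorb)
  qed
  moreover have "b 0 = 0" using c(1) G by (simp add: b_def)
  ultimately have "b r = 0" using c(2) r
    by - (rule in_general_positionD[OF gp, where c = b], auto)
  with r show "c r = 0" by (auto simp: b_def)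
qed

text \<open>
  The directions of the flat spanned by the level sets of c lie transversally to the kernel: the
  sums of y over k of the level sets with non-zero value are independent modulo W and hence span a
  complement of W. So every z can be moved into the kernel by subtracting a function of the values
  of c. Such a correction is constant on level sets, so that it leaves the ties of c to z.
\<close>

lemma general_position_shift:
  fixes y :: "nat \<Rightarrow> 'a::euclidean_space"
  assumes W: "subspace W" "dim W + k = DIM('a)" and G: "finite G" "0 \<in> G"
    and gp: "in_general_position k W G y"
    and c: "c 0 = 0" "(\<Sum>r\<in>G. c r *\<^sub>R y r) \<in> W" "\<exists>r\<in>G. c r \<noteq> 0"
  shows "\<exists>g :: real \<Rightarrow> real. g 0 = 0 \<and> (\<Sum>r\<in>G. (z r - g (c r)) *\<^sub>R y r) \<in> W"
proof -
  have "\<not> card (c ` G) \<le> Suc k" using in_general_positionD[OF gp c(1) _ c(2)] c(3) by blast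
  moreover have "card (c ` G) \<le> Suc (card (c ` G - {0}))"
    using G card_Suc_Diff1[of "c ` G" 0] by (cases "0 \<in> c ` G") auto
  ultimately have "k \<le> card (c ` G - {0})" by simp
  then obtain T where T: "T \<subseteq> c ` G - {0}" "card T = k" "finite T"
    by (meson obtain_subset_with_card_n)
  \<comment> \<open>Y t is the image of the indicator of the level set with value t.\<close>
  define Y where "Y t = (\<Sum>r | r \<in> G \<and> c r = t. y r)" for t
  have sumY: "(\<Sum>t\<in>T. g t *\<^sub>R Y t) = (\<Sum>r\<in>G. (if c r \<in> T then g (c r) else 0) *\<^sub>R y r)" for g :: "real \<Rightarrow> real"
  proof -
    have "(\<Sum>t\<in>T. g t *\<^sub>R Y t) = (\<Sum>t\<in>T. \<Sum>r | r \<in> G \<and> c r = t. g (c r) *\<^sub>R y r)"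
      unfolding Y_def scaleR_sum_right by (intro sum.cong) auto
    also have "\<dots> = (\<Sum>t\<in>T. \<Sum>r | r \<in> {r \<in> G. c r \<in> T} \<and> c r = t. g (c r) *\<^sub>R y r)"
      by (intro sum.cong) auto
    also have "\<dots> = (\<Sum>r\<in>{r \<in> G. c r \<in> T}. g (c r) *\<^sub>R y r)"
      using G T(3) by (intro sum.group) auto
    also have "\<dots> = (\<Sum>r\<in>G. (if c r \<in> T then g (c r) else 0) *\<^sub>R y r)"
      using G by (intro sum.mono_neutral_cong_left) auto
    finally show ?thesis .
  qed
  have indep: "\<forall>t\<in>T. g t = 0" if "(\<Sum>t\<in>T. g t *\<^sub>R Y t) \<in> W" for g
  proof
    fix t assume t: "t \<in> T"
    then obtain r where r: "r \<in> G" "c r = t" using T by blast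
    let ?b = "\<lambda>r. if c r \<in> T then g (c r) else 0"
    have "?b ` G \<subseteq> insert 0 (g ` T)" by auto
    then have "card (?b ` G) \<le> card (insert 0 (g ` T))" using T(3) by (intro card_mono) auto
    also have "\<dots> \<le> Suc (card (g ` T))" by (rule card_insert_le_m1) auto
    also have "\<dots> \<le> Suc k" using card_image_le[OF T(3), of g] T(2) by simp
    finally have "card (?b ` G) \<le> Suc k" .
    moreover have "?b 0 = 0" using c(1) T(1) by auto
    ultimately have "?b r = 0" using that r(1) sumY[of g]
      by - (rule in_general_positionD[OF gp, where c = ?b], auto)
    then show "g t = 0" using r t by simp
  qed
  obtain g where g: "(\<Sum>r\<in>G. z r *\<^sub>R y r) - (\<Sum>t\<in>T. g t *\<^sub>R Y t) \<in> W"
    using sum_complement_UNIV[OF W T(3,2), of Y, OF indep] by blast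
  define h where "h t = (if t \<in> T then g t else 0)" for t
  have "h 0 = 0" using T(1) by (auto simp: h_def)
  moreover have "(\<Sum>r\<in>G. (z r - h (c r)) *\<^sub>R y r) \<in> W"
    using g by (simp add: sumY h_def scaleR_left_diff_distrib sum_subtractf)
  ultimately show ?thesis by blast
qed

text \<open>
  A cycle cut at one place is a linear order, and a linear order admits a strictly decreasing labelling.
\<close>

lemma cyclic_perms_height:
  assumes "\<sigma> \<in> cyclic_perms n" "\<kappa> \<le> n"
  shows "\<exists>z :: nat \<Rightarrow> real. \<forall>a\<le>n. a \<noteq> \<kappa> \<longrightarrow> z (\<sigma> a) < z a"
  using assms
proof (induction n arbitrary: \<sigma> \<kappa>)
  case 0
  then show ?case by auto
next
  case (Suc n)
  obtain \<rho> a where \<rho>: "\<rho> \<in> cyclic_perms n" and a: "a \<le> n" and \<sigma>: "\<sigma> = insert_after \<rho> (Suc n) a"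
    using insert_after_surj[OF Suc.prems(1)] by blast
  define \<kappa>' where "\<kappa>' = (if \<kappa> = Suc n then a else \<kappa>)"
  have "\<kappa>' \<le> n" using Suc.prems(2) a by (auto simp: \<kappa>'_def)
  from Suc.IH[OF \<rho> this] obtain z :: "nat \<Rightarrow> real"
    where z: "\<And>b. b \<le> n \<Longrightarrow> b \<noteq> \<kappa>' \<Longrightarrow> z (\<rho> b) < z b" by blast
  \<comment> \<open>The cut decides whether the new element is lowest, highest, or lies between its neighbours.\<close>
  define zv where "zv = (if \<kappa> = Suc n then z a - 1 else if \<kappa> = a then z (\<rho> a) + 1
                         else (z a + z (\<rho> a)) / 2)"
  let ?z = "z(Suc n := zv)"
  have "?z (\<sigma> b) < ?z b" if b: "b \<le> Suc n" "b \<noteq> \<kappa>" for b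
  proof -
    consider "b = Suc n" | "b = a" "b \<le> n" | "b \<le> n" "b \<noteq> a" using b a by linarith
    then show ?thesis
    proof cases
      case 1
      then show ?thesis using a b z[OF a] cyclic_perms_le[OF \<rho> a]
        by (auto simp: \<sigma> insert_after_def zv_def \<kappa>'_def)
    next
      case 2
      then show ?thesis using a b z[OF a] cyclic_perms_le[OF \<rho> a]
        by (auto simp: \<sigma> insert_after_def zv_def \<kappa>'_def)
    next
      case 3
      then show ?thesis using a b z[of b] cyclic_perms_le[OF \<rho>, of b]
        by (auto simp: \<sigma> insert_after_def zv_def \<kappa>'_def split: if_splits)
    qed
  qed
  then show ?case by blast
qed

section \<open>Chambers met by a generic subspace\<close>

text \<open>
  Coefficients in the kernel that decrease weakly along those steps of \<sigma> that start in E. The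
  complement of E is the set of places where the cyclic order is cut into blocks.
\<close>

abbreviation cone_weight :: "'a::real_vector set \<Rightarrow> nat set \<Rightarrow> (nat \<Rightarrow> 'a) \<Rightarrow> (nat \<Rightarrow> nat) \<Rightarrow> nat set \<Rightarrow> (nat \<Rightarrow> real) \<Rightarrow> bool" where
  "cone_weight W G y \<sigma> E c \<equiv> c 0 = 0 \<and> (\<Sum>r\<in>G. c r *\<^sub>R y r) \<in> W \<and> (\<forall>a\<in>E. c (\<sigma> a) \<le> c a) \<and> (\<exists>r\<in>G. c r \<noteq> 0)"

definition meets_cone :: "'a::real_vector set \<Rightarrow> nat set \<Rightarrow> (nat \<Rightarrow> 'a) \<Rightarrow> (nat \<Rightarrow> nat) \<Rightarrow> nat set \<Rightarrow> bool" where
  "meets_cone W G y \<sigma> E \<longleftrightarrow>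
     (\<exists>c. cone_weight W G y \<sigma> E c)"

lemma eventually_perturbed_less:
  fixes p q s t :: real
  assumes "p < q \<or> p = q \<and> s < t"
  shows "\<forall>\<^sub>F \<epsilon> in at_right 0. p + \<epsilon> * s < q + \<epsilon> * t"
  using assms
proof
  assume "p < q"
  have "((\<lambda>\<epsilon>. (q + \<epsilon> * t) - (p + \<epsilon> * s)) \<longlongrightarrow> (q + 0 * t) - (p + 0 * s)) (at_right 0)"
    by (intro tendsto_intros)
  then have "\<forall>\<^sub>F \<epsilon> in at_right 0. 0 < (q + \<epsilon> * t) - (p + \<epsilon> * s)"
    by (rule order_tendstoD) (use \<open>p < q\<close> in simp)
  then show ?thesis by eventually_elim simp
next
  assume "p = q \<and> s < t"
  have "\<forall>\<^sub>F \<epsilon> in at_right (0::real). 0 < \<epsilon>" by (simp add: eventually_at_right_less)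
  then show ?thesis by eventually_elim (use \<open>p = q \<and> s < t\<close> in simp)
qed

text \<open>
  A non-zero point of the kernel in a closed chamber can be moved into the open chamber: add a small
  multiple of a kernel element that breaks all ties in the wanted direction, supplied by
  general_position_shift. The coordinate of the extra element Suc n is also separated from those of 0, ..., n.
\<close>

lemma strict_cone_point:
  fixes y :: "nat \<Rightarrow> 'a::euclidean_space"
  assumes W: "subspace W" "dim W + k = DIM('a)" and G: "finite G" "{..Suc n} \<subseteq> G"
    and gp: "in_general_position k W G y"
    and \<sigma>: "\<sigma> \<in> cyclic_perms n" and \<kappa>: "\<kappa> \<le> n" "\<kappa> \<notin> E" and E: "E \<subseteq> {..n}" "e \<in> E"
    and meets: "meets_cone W G y \<sigma> E"
  obtains d where "d 0 = 0" "(\<Sum>r\<in>G. d r *\<^sub>R y r) \<in> W" "\<And>a. a \<in> E \<Longrightarrow> d (\<sigma> a) < d a"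
    "\<And>w. w \<le> n \<Longrightarrow> d (Suc n) \<noteq> d w"
proof -
  obtain c :: "nat \<Rightarrow> real" where c: "c 0 = 0" "(\<Sum>r\<in>G. c r *\<^sub>R y r) \<in> W"
    "\<And>a. a \<in> E \<Longrightarrow> c (\<sigma> a) \<le> c a" "\<exists>r\<in>G. c r \<noteq> 0"
    using meets unfolding meets_cone_def by blast
  obtain x :: "nat \<Rightarrow> real" where x: "\<And>a. a \<le> n \<Longrightarrow> a \<noteq> \<kappa> \<Longrightarrow> x (\<sigma> a) < x a"
    using cyclic_perms_height[OF \<sigma> \<kappa>(1)] by blast
  \<comment> \<open>Subtracting the value at 0 restores c_0 = 0; the maximum puts the new element above all others.\<close>
  define z where "z = (\<lambda>r. (x(Suc n := Max (x ` {..n}) + 1)) r - x 0)"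
  have z0: "z 0 = 0" by (simp add: z_def)
  have zE: "z (\<sigma> a) < z a" if "a \<in> E" for a
  proof -
    have "a \<le> n" "a \<noteq> \<kappa>" using that E \<kappa> by auto
    then show ?thesis using x[of a] cyclic_perms_le[OF \<sigma>, of a] by (simp add: z_def)
  qed
  have zv: "z w < z (Suc n)" if "w \<le> n" for w
  proof -
    have "x w \<le> Max (x ` {..n})" using that by (intro Max_ge) auto
    then have "x w < Max (x ` {..n}) + 1" by linarith
    then show ?thesis using that by (simp add: z_def)
  qed
  have "0 \<in> G" using G(2) by auto
  from general_position_shift[OF W G(1) this gp c(1,2,4), of z]
  obtain g :: "real \<Rightarrow> real" where g: "g 0 = 0" "(\<Sum>r\<in>G. (z r - g (c r)) *\<^sub>R y r) \<in> W" by blast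
  define h where "h r = z r - g (c r)" for r
  have ev1: "\<forall>\<^sub>F \<epsilon> in at_right 0. \<forall>a\<in>E. c (\<sigma> a) + \<epsilon> * h (\<sigma> a) < c a + \<epsilon> * h a"
  proof (intro eventually_ball_finite ballI eventually_perturbed_less)
    show "finite E" using E(1) finite_subset by blast
    fix a assume a: "a \<in> E"
    show "c (\<sigma> a) < c a \<or> c (\<sigma> a) = c a \<and> h (\<sigma> a) < h a"
      using c(3)[OF a] zE[OF a] by (auto simp: h_def)
  qed
  have ev2: "\<forall>\<^sub>F \<epsilon> in at_right 0. \<forall>w\<in>{..n}. c (Suc n) + \<epsilon> * h (Suc n) \<noteq> c w + \<epsilon> * h w"
  proof (intro eventually_ball_finite ballI)
    fix w assume w: "w \<in> {..n}"
    consider "c w < c (Suc n) \<or> c w = c (Suc n) \<and> h w < h (Suc n)" | "c (Suc n) < c w"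
      using zv[of w] w by (force simp: h_def)
    then show "\<forall>\<^sub>F \<epsilon> in at_right 0. c (Suc n) + \<epsilon> * h (Suc n) \<noteq> c w + \<epsilon> * h w"
    proof cases
      case 1
      from eventually_perturbed_less[OF this] show ?thesis by eventually_elim simp
    next
      case 2
      then have "c (Suc n) < c w \<or> c (Suc n) = c w \<and> h (Suc n) < h w" by simp
      from eventually_perturbed_less[OF this] show ?thesis by eventually_elim simp
    qed
  qed simp
  from ev1 ev2 have "\<forall>\<^sub>F \<epsilon> in at_right 0. (\<forall>a\<in>E. c (\<sigma> a) + \<epsilon> * h (\<sigma> a) < c a + \<epsilon> * h a) \<and>
      (\<forall>w\<in>{..n}. c (Suc n) + \<epsilon> * h (Suc n) \<noteq> c w + \<epsilon> * h w)"
    by eventually_elim simp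
  from eventually_happens'[OF trivial_limit_at_right_real this]
  obtain \<epsilon> :: real where \<epsilon>: "\<And>a. a \<in> E \<Longrightarrow> c (\<sigma> a) + \<epsilon> * h (\<sigma> a) < c a + \<epsilon> * h a"
    "\<And>w. w \<le> n \<Longrightarrow> c (Suc n) + \<epsilon> * h (Suc n) \<noteq> c w + \<epsilon> * h w"
    by auto
  show thesis
  proof (rule that[of "\<lambda>r. c r + \<epsilon> * h r"])
    show "c 0 + \<epsilon> * h 0 = 0" using c(1) z0 g(1) by (simp add: h_def)
    have "(\<Sum>r\<in>G. (c r + \<epsilon> * h r) *\<^sub>R y r) = (\<Sum>r\<in>G. c r *\<^sub>R y r) + \<epsilon> *\<^sub>R (\<Sum>r\<in>G. h r *\<^sub>R y r)"
      by (simp add: scaleR_add_left sum.distrib scaleR_sum_right)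
    also have "\<dots> \<in> W"
      using c(2) g(2) by (auto simp: h_def intro!: subspace_add subspace_scale W(1))
    finally show "(\<Sum>r\<in>G. (c r + \<epsilon> * h r) *\<^sub>R y r) \<in> W" .
  qed (use \<epsilon> in auto)
qed

text \<open>
  With the cut set unchanged, the new element lands just above the successor of a; it also lies
  below a unless there is a cut after a.
\<close>

lemma meets_cone_insert_above:
  assumes \<sigma>: "\<sigma> \<in> cyclic_perms n" and a: "a \<le> n" and K: "K \<subseteq> {..n}"
  shows "meets_cone W G y (insert_after \<sigma> (Suc n) a) ({..Suc n} - K) \<longleftrightarrow>
     (\<exists>c :: nat \<Rightarrow> real. cone_weight W G y \<sigma> ({..n} - K) c \<and> (a \<notin> K \<longrightarrow> c (Suc n) \<le> c a) \<and> c (\<sigma> a) \<le> c (Suc n))"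
proof -
  have "(\<forall>b\<in>{..Suc n} - K. c (insert_after \<sigma> (Suc n) a b) \<le> c b) \<longleftrightarrow>
     (\<forall>a\<in>{..n} - K. c (\<sigma> a) \<le> c a) \<and> (a \<notin> K \<longrightarrow> c (Suc n) \<le> c a) \<and> c (\<sigma> a) \<le> c (Suc n)"
    (is "?L \<longleftrightarrow> ?R") for c :: "nat \<Rightarrow> real"
  proof
    assume L: ?L
    have "c (insert_after \<sigma> (Suc n) a (Suc n)) \<le> c (Suc n)" using L K by (intro bspec[OF L]) auto
    then have 1: "c (\<sigma> a) \<le> c (Suc n)" by (simp add: insert_after_def)
    have 2: "c (Suc n) \<le> c a" if "a \<notin> K"
      using bspec[OF L, of a] that a by (simp add: insert_after_def)
    have "c (\<sigma> b) \<le> c b" if b: "b \<in> {..n} - K" for b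
    proof (cases "b = a")
      case True
      then show ?thesis using 1 2 b by simp
    next
      case False
      then show ?thesis using bspec[OF L, of b] b by (simp add: insert_after_def)
    qed
    with 1 2 show ?R by blast
  next
    assume R: ?R
    then show ?L using a by (auto simp: insert_after_def le_Suc_eq)
  qed
  then show ?thesis unfolding meets_cone_def by (intro ex_cong1) blast
qed

text \<open>
  A cut after a is moved behind the new element, which thereby becomes the last element of the block of a.
\<close>

lemma meets_cone_insert_below:
  assumes \<sigma>: "\<sigma> \<in> cyclic_perms n" and a: "a \<in> K" and K: "K \<subseteq> {..n}"
  shows "meets_cone W G y (insert_after \<sigma> (Suc n) a) ({..Suc n} - insert (Suc n) (K - {a})) \<longleftrightarrow>
     (\<exists>c :: nat \<Rightarrow> real. cone_weight W G y \<sigma> ({..n} - K) c \<and> c (Suc n) \<le> c a)"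
proof -
  have "{..Suc n} - insert (Suc n) (K - {a}) = insert a ({..n} - K)"
    using a K by (auto simp: le_Suc_eq)
  moreover have "(\<forall>b\<in>insert a ({..n} - K). c (insert_after \<sigma> (Suc n) a b) \<le> c b) \<longleftrightarrow>
     (\<forall>a\<in>{..n} - K. c (\<sigma> a) \<le> c a) \<and> c (Suc n) \<le> c a" for c :: "nat \<Rightarrow> real"
    using a K by (auto simp: insert_after_def)
  ultimately show ?thesis unfolding meets_cone_def by (simp only:) (intro ex_cong1, blast)
qed

text \<open>
  Cuts on both sides make the new element a block of its own, and its coefficient unconstrained.
\<close>

lemma meets_cone_insert_isolated:
  assumes \<sigma>: "\<sigma> \<in> cyclic_perms n" and a: "a \<in> K" and K: "K \<subseteq> {..n}"
  shows "meets_cone W G y (insert_after \<sigma> (Suc n) a) ({..Suc n} - insert (Suc n) K) \<longleftrightarrow>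
     meets_cone W G y \<sigma> ({..n} - K)"
proof -
  have "{..Suc n} - insert (Suc n) K = {..n} - K"
    using K by (auto simp: le_Suc_eq)
  moreover have "(\<forall>b\<in>{..n} - K. c (insert_after \<sigma> (Suc n) a b) \<le> c b) \<longleftrightarrow>
     (\<forall>a\<in>{..n} - K. c (\<sigma> a) \<le> c a)" for c :: "nat \<Rightarrow> real"
    using a by (intro ball_cong) (auto simp: insert_after_def)
  ultimately show ?thesis unfolding meets_cone_def by (simp only:)
qed

lemma meets_cone_merge:
  fixes y :: "nat \<Rightarrow> 'a::real_vector"
  assumes \<sigma>: "\<sigma> \<in> cyclic_perms n" and E: "E \<subseteq> {..n}" and w: "w \<le> n" and G: "finite G" "{..Suc n} \<subseteq> G"
  shows "meets_cone W (G - {Suc n}) (merge_vertex (Suc n) w y) \<sigma> E \<longleftrightarrow>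
     (\<exists>c :: nat \<Rightarrow> real. cone_weight W G y \<sigma> E c \<and> c (Suc n) = c w)" (is "?L \<longleftrightarrow> ?R")
proof
  have vw: "Suc n \<in> G" "w \<in> G" "Suc n \<noteq> w" using w G(2) by auto
  {
    assume ?L
    then obtain c :: "nat \<Rightarrow> real" where c: "c 0 = 0"
      "(\<Sum>r\<in>G - {Suc n}. c r *\<^sub>R merge_vertex (Suc n) w y r) \<in> W"
      "\<forall>a\<in>E. c (\<sigma> a) \<le> c a" "\<exists>r\<in>G - {Suc n}. c r \<noteq> 0"
      unfolding meets_cone_def by blast
    define b where "b = c(Suc n := c w)"
    have "(\<Sum>r\<in>G. b r *\<^sub>R y r) = (\<Sum>r\<in>G - {Suc n}. b r *\<^sub>R merge_vertex (Suc n) w y r)"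
      using vw by (intro sum_merge_vertex[symmetric] G(1)) (auto simp: b_def)
    also have "\<dots> = (\<Sum>r\<in>G - {Suc n}. c r *\<^sub>R merge_vertex (Suc n) w y r)"
      by (intro sum.cong) (auto simp: b_def)
    finally have 1: "(\<Sum>r\<in>G. b r *\<^sub>R y r) \<in> W" using c(2) by simp
    have 2: "b (\<sigma> a) \<le> b a" if "a \<in> E" for a
    proof -
      have "a \<le> n" using that E by auto
      then show ?thesis using c(3) that cyclic_perms_le[OF \<sigma>, of a] by (simp add: b_def)
    qed
    have 3: "\<exists>r\<in>G. b r \<noteq> 0" using c(4) by (auto simp: b_def)
    have 4: "b 0 = 0" "b (Suc n) = b w" using c(1) w by (simp_all add: b_def)
    from 1 2 3 4 show ?R by (intro exI[of _ b]) blast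
  next
    assume ?R
    then obtain c :: "nat \<Rightarrow> real" where c: "c 0 = 0" "(\<Sum>r\<in>G. c r *\<^sub>R y r) \<in> W"
      "\<forall>a\<in>E. c (\<sigma> a) \<le> c a" "\<exists>r\<in>G. c r \<noteq> 0" "c (Suc n) = c w" by blast
    have "(\<Sum>r\<in>G - {Suc n}. c r *\<^sub>R merge_vertex (Suc n) w y r) \<in> W"
      using sum_merge_vertex[OF G(1) vw c(5), of y] c(2) by simp
    moreover have "\<exists>r\<in>G - {Suc n}. c r \<noteq> 0"
      using c(4,5) vw by (metis Diff_iff singletonD)
    ultimately show ?L unfolding meets_cone_def using c(1,3) by blast
  }
qed

text \<open>
  The chamber of a cyclic order with cuts is divided by the walls c_v = c_w, for the new element v
  and the old elements w, into slots: above w for every w, and below the last element of every block.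
  If the kernel meets the chamber, fix one of its points d strictly inside a slot of every block. For
  every w take the slot adjacent to the wall of w on the side away from d. By convexity the kernel
  meets this slot if and only if it meets the wall: move from a point of the slot towards d until
  the wall is reached. All slots not assigned to a wall contain d, so unmet slots and unmet walls are
  equinumerous. If the kernel misses the chamber, everything is unmet and there is one more slot
  than walls for every block.
\<close>

lemma unmet_slots_eq_unmet_walls:
  fixes y :: "nat \<Rightarrow> 'a::euclidean_space"
  assumes W: "subspace W" "dim W + k = DIM('a)" and G: "finite G" "{..Suc n} \<subseteq> G"
    and gp: "in_general_position k W G y"
    and \<sigma>: "\<sigma> \<in> cyclic_perms n" and K: "K \<subseteq> {..n}" "K \<noteq> {}" "K \<noteq> {..n}"
  shows "(\<Sum>a\<le>n. of_bool (\<not> meets_cone W G y (insert_after \<sigma> (Suc n) a) ({..Suc n} - K)))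
       + (\<Sum>a\<in>K. of_bool (\<not> meets_cone W G y (insert_after \<sigma> (Suc n) a) ({..Suc n} - insert (Suc n) (K - {a}))))
     = (\<Sum>w\<le>n. of_bool (\<not> meets_cone W (G - {Suc n}) (merge_vertex (Suc n) w y) \<sigma> ({..n} - K)))
       + card K * (of_bool (\<not> meets_cone W G y \<sigma> ({..n} - K)) :: nat)"
proof -
  define v where "v = Suc n"
  define adm where "adm c \<longleftrightarrow> cone_weight W G y \<sigma> ({..n} - K) c"
    for c :: "nat \<Rightarrow> real"
  define above where "above a \<longleftrightarrow> (\<exists>c. adm c \<and> (a \<notin> K \<longrightarrow> c v \<le> c a) \<and> c (\<sigma> a) \<le> c v)" for a
  define below where "below a \<longleftrightarrow> (\<exists>c. adm c \<and> c v \<le> c a)" for a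
  define wall where "wall w \<longleftrightarrow> (\<exists>c. adm c \<and> c v = c w)" for w
  have above: "meets_cone W G y (insert_after \<sigma> (Suc n) a) ({..Suc n} - K) \<longleftrightarrow> above a" if "a \<le> n" for a
    unfolding meets_cone_insert_above[OF \<sigma> that K(1)] above_def adm_def v_def by (simp only: conj_assoc)
  have below: "meets_cone W G y (insert_after \<sigma> (Suc n) a) ({..Suc n} - insert (Suc n) (K - {a})) \<longleftrightarrow> below a" if "a \<in> K" for a
    unfolding meets_cone_insert_below[OF \<sigma> that K(1)] below_def adm_def v_def by (simp only: conj_assoc)
  have wall: "meets_cone W (G - {Suc n}) (merge_vertex (Suc n) w y) \<sigma> ({..n} - K) \<longleftrightarrow> wall w" if "w \<le> n" for w
    unfolding meets_cone_merge[OF \<sigma> Diff_subset that G] wall_def adm_def v_def by (simp only: conj_assoc)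
  have free: "meets_cone W G y \<sigma> ({..n} - K) \<longleftrightarrow> (\<exists>c. adm c)"
    unfolding meets_cone_def adm_def by simp
  have finK: "finite K" using K(1) finite_subset by blast
  have "(\<Sum>a\<le>n. of_bool (\<not> above a)) + (\<Sum>a\<in>K. of_bool (\<not> below a))
     = (\<Sum>w\<le>n. of_bool (\<not> wall w)) + card K * (of_bool (\<not> (\<exists>c. adm c)) :: nat)"
  proof (cases "\<exists>c. adm c")
    case False
    then have "\<not> above a" "\<not> below a" "\<not> wall a" for a
      by (auto simp: above_def below_def wall_def)
    with False show ?thesis by simp
  next
    case True
    obtain \<kappa> where \<kappa>: "\<kappa> \<in> K" using K by blast
    obtain e where e: "e \<in> {..n} - K" using K by blast
    have "\<kappa> \<le> n" "\<kappa> \<notin> {..n} - K" using \<kappa> K(1) by auto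
    from strict_cone_point[OF W G gp \<sigma> this Diff_subset e] True free
    obtain d where d: "d 0 = 0" "(\<Sum>r\<in>G. d r *\<^sub>R y r) \<in> W" "\<And>a. a \<in> {..n} - K \<Longrightarrow> d (\<sigma> a) < d a"
      "\<And>w. w \<le> n \<Longrightarrow> d v \<noteq> d w" unfolding v_def by blast
    have en: "e \<in> G" "\<sigma> e \<in> G" using e G(2) cyclic_perms_le[OF \<sigma>, of e] by auto
    have "\<exists>r\<in>G. d r \<noteq> 0" using d(3)[OF e] en by (metis less_irrefl)
    then have dadm: "adm d" using d unfolding adm_def by (auto intro: less_imp_le)
    have \<sigma>inv: "\<sigma> (inv \<sigma> w) = w" "inv \<sigma> (\<sigma> w) = w" for w
      using permutes_inverses[OF cyclic_perms_permutes[OF \<sigma>]] by auto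
    have inv_le: "inv \<sigma> w \<le> n" if "w \<le> n" for w
      using permutes_in_image[OF permutes_inv[OF cyclic_perms_permutes[OF \<sigma>]], of w] that by simp
    define met where "met s = (case s of Inl a \<Rightarrow> above a | Inr a \<Rightarrow> below a)" for s
    \<comment> \<open>Inl a is the slot just above the successor of a, and Inr a the slot below the last element a of a block.\<close>
    define slot where "slot w = (if d w < d v then (if w \<in> K then Inr w else Inl w) else Inl (inv \<sigma> w))" for w
    \<comment> \<open>The positive combination z of c and d lies on the wall, and it is non-zero because d is strict at e.\<close>
    have cross: "wall w" if c: "adm c" and w: "w \<le> n" and side: "d w < d v \<and> c v \<le> c w \<or> d v < d w \<and> c w \<le> c v" for c w
    proof -
      define \<alpha> where "\<alpha> = \<bar>d v - d w\<bar>"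
      define \<beta> where "\<beta> = \<bar>c v - c w\<bar>"
      define z where "z r = \<alpha> * c r + \<beta> * d r" for r
      have \<alpha>: "0 < \<alpha>" using side by (auto simp: \<alpha>_def)
      have \<beta>: "0 \<le> \<beta>" by (simp add: \<beta>_def)
      have "z v = z w" using side unfolding z_def \<alpha>_def \<beta>_def by (auto simp: abs_if algebra_simps)
      moreover have "adm z" unfolding adm_def
      proof (intro conjI ballI)
        show "z 0 = 0" using c d(1) by (simp add: z_def adm_def)
        have "(\<Sum>r\<in>G. z r *\<^sub>R y r) = \<alpha> *\<^sub>R (\<Sum>r\<in>G. c r *\<^sub>R y r) + \<beta> *\<^sub>R (\<Sum>r\<in>G. d r *\<^sub>R y r)"
          by (simp add: z_def scaleR_add_left sum.distrib scaleR_sum_right)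
        also have "\<dots> \<in> W"
          using c d(2) by (auto simp: adm_def intro!: subspace_add subspace_scale W(1))
        finally show "(\<Sum>r\<in>G. z r *\<^sub>R y r) \<in> W" .
        show "z (\<sigma> a) \<le> z a" if "a \<in> {..n} - K" for a
          using that c d(3)[OF that] \<alpha> \<beta> unfolding z_def adm_def
          by (intro add_mono mult_left_mono) auto
        show "\<exists>r\<in>G. z r \<noteq> 0"
        proof (cases "\<beta> = 0")
          case True
          then show ?thesis using c \<alpha> by (auto simp: z_def adm_def)
        next
          case False
          have "\<alpha> * c (\<sigma> e) \<le> \<alpha> * c e" using c e \<alpha> by (auto simp: adm_def)
          moreover have "\<beta> * d (\<sigma> e) < \<beta> * d e" using d(3)[OF e] \<beta> False by simp
          ultimately have "z (\<sigma> e) < z e" unfolding z_def by (rule add_le_less_mono)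
          then show ?thesis using en by (metis less_irrefl)
        qed
      qed
      ultimately show ?thesis unfolding wall_def by blast
    qed
    have met_slot: "met (slot w) \<longleftrightarrow> wall w" if w: "w \<le> n" for w
    proof
      assume met: "met (slot w)"
      show "wall w"
      proof (cases "d w < d v")
        case True
        with met obtain c where "adm c" "c v \<le> c w"
          by (auto simp: met_def slot_def above_def below_def split: if_splits)
        with True show ?thesis by (intro cross w) auto
      next
        case False
        with met obtain c where "adm c" "c w \<le> c v"
          by (auto simp: met_def slot_def above_def \<sigma>inv)
        moreover have "d v < d w" using False d(4)[OF w] by simp
        ultimately show ?thesis by (intro cross w) auto
      qed
    next
      assume "wall w"
      then obtain c where c: "adm c" "c v = c w" unfolding wall_def by blast
      have desc: "c (\<sigma> a) \<le> c a" if "a \<le> n" "a \<notin> K" for a using c that by (auto simp: adm_def)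
      show "met (slot w)"
      proof (cases "d w < d v")
        case True
        then show ?thesis using c desc[OF w]
          by (auto simp: met_def slot_def above_def below_def intro!: exI[of _ c])
      next
        case False
        then show ?thesis using c desc[OF inv_le[OF w]]
          by (auto simp: met_def slot_def above_def \<sigma>inv intro!: exI[of _ c])
      qed
    qed
    have inj: "inj_on slot {..n}"
    proof (rule inj_onI)
      \<comment> \<open>A slot between p and its successor could only be assigned twice if d increased from p to its successor.\<close>
      have clash: False if "Inl p = (Inl (inv \<sigma> q) :: nat + nat)" "p \<le> n" "p \<notin> K" "d p < d v" "\<not> d q < d v" for p q
      proof -
        have "\<sigma> p = q" using that(1) by (simp add: \<sigma>inv)
        with d(3)[of p] that show False by simp
      qed
      fix p q assume pq: "p \<in> {..n}" "q \<in> {..n}" "slot p = slot q"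
      show "p = q"
      proof (cases "d p < d v"; cases "d q < d v")
        assume "d p < d v" "d q < d v"
        then show ?thesis using pq(3) by (auto simp: slot_def split: if_splits)
      next
        assume "d p < d v" "\<not> d q < d v"
        then show ?thesis using pq clash[of p q] by (auto simp: slot_def split: if_splits)
      next
        assume "\<not> d p < d v" "d q < d v"
        then show ?thesis using pq clash[of q p] by (auto simp: slot_def split: if_splits)
      next
        assume "\<not> d p < d v" "\<not> d q < d v"
        then have "inv \<sigma> p = inv \<sigma> q" using pq(3) by (simp add: slot_def)
        then show ?thesis by (metis \<sigma>inv(1))
      qed
    qed
    have sub: "slot ` {..n} \<subseteq> {..n} <+> K"
      using inv_le by (auto simp: slot_def)
    have rest: "met s" if s: "s \<in> ({..n} <+> K) - slot ` {..n}" for s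
    proof (cases s)
      case (Inl a)
      then have a: "a \<le> n" using s by auto
      have "\<sigma> a \<le> n" using cyclic_perms_le[OF \<sigma> a] .
      then have "slot (\<sigma> a) \<noteq> s" using s by auto
      then have 1: "d (\<sigma> a) < d v" using Inl by (auto simp: slot_def \<sigma>inv split: if_splits)
      have "slot a \<noteq> s" using s a by auto
      then have "a \<notin> K \<Longrightarrow> \<not> d a < d v" using Inl by (auto simp: slot_def)
      with 1 show ?thesis using dadm Inl by (auto simp: met_def above_def intro!: exI[of _ d])
    next
      case (Inr a)
      then have a: "a \<in> K" using s by auto
      then have "slot a \<noteq> s" using s K(1) by auto
      then have "\<not> d a < d v" using Inr a by (auto simp: slot_def)
      then show ?thesis using dadm Inr by (auto simp: met_def below_def intro!: exI[of _ d])
    qed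
    have "(\<Sum>a\<le>n. of_bool (\<not> above a)) + (\<Sum>a\<in>K. of_bool (\<not> below a))
        = (\<Sum>s\<in>{..n} <+> K. of_bool (\<not> met s) :: nat)"
      unfolding sum.Plus[OF finite_atMost finK] by (simp only: met_def o_def sum.case)
    also have "\<dots> = (\<Sum>s\<in>slot ` {..n}. of_bool (\<not> met s))"
      using finK sub rest by (intro sum.mono_neutral_right) auto
    also have "\<dots> = (\<Sum>w\<le>n. of_bool (\<not> wall w))"
      unfolding sum.reindex[OF inj] o_def by (intro sum.cong refl) (simp add: met_slot)
    finally show ?thesis using True by simp
  qed
  then show ?thesis using above below wall free by simp
qed

text \<open>
  Cyclic orders of {0..n} with J cuts whose chamber is missed by the kernel. The index set G may
  contain further elements; these are unconstrained.
\<close>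

definition unmet_cones :: "'a::real_vector set \<Rightarrow> nat set \<Rightarrow> (nat \<Rightarrow> 'a) \<Rightarrow> nat \<Rightarrow> nat \<Rightarrow> nat" where
  "unmet_cones W G y n J =
     (\<Sum>\<sigma>\<in>cyclic_perms n. \<Sum>K | K \<subseteq> {..n} \<and> card K = J. of_bool (\<not> meets_cone W G y \<sigma> ({..n} - K)))"

lemma sum_subsets_Suc:
  fixes f :: "nat set \<Rightarrow> nat"
  shows "(\<Sum>K | K \<subseteq> {..Suc n} \<and> card K = Suc j. f K)
     = (\<Sum>K | K \<subseteq> {..n} \<and> card K = Suc j. f K) + (\<Sum>L | L \<subseteq> {..n} \<and> card L = j. f (insert (Suc n) L))"
proof -
  let ?A = "{K. K \<subseteq> {..n} \<and> card K = Suc j}" and ?B = "{L. L \<subseteq> {..n} \<and> card L = j}"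
  have fin: "finite ?A" "finite ?B" by (rule finite_subset[of _ "Pow {..n}"], auto)+
  have inj: "inj_on (insert (Suc n)) ?B"
    by (intro inj_onI) (metis (no_types, lifting) Suc_n_not_le_n atMost_iff insert_ident mem_Collect_eq subsetD)
  have eq: "{K. K \<subseteq> {..Suc n} \<and> card K = Suc j} = ?A \<union> insert (Suc n) ` ?B"
  proof (intro equalityI subsetI)
    fix K assume K: "K \<in> {K. K \<subseteq> {..Suc n} \<and> card K = Suc j}"
    have finK: "finite K" using K finite_subset by blast
    show "K \<in> ?A \<union> insert (Suc n) ` ?B"
    proof (cases "Suc n \<in> K")
      case True
      then have "K = insert (Suc n) (K - {Suc n})" by blast
      moreover have "K - {Suc n} \<in> ?B" using True K finK by (auto simp: atMost_Suc)
      ultimately show ?thesis by blast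
    next
      case False
      then show ?thesis using K by (auto simp: atMost_Suc)
    qed
  next
    fix K assume "K \<in> ?A \<union> insert (Suc n) ` ?B"
    then show "K \<in> {K. K \<subseteq> {..Suc n} \<and> card K = Suc j}"
    proof
      assume "K \<in> insert (Suc n) ` ?B"
      then obtain L where L: "K = insert (Suc n) L" "L \<subseteq> {..n}" "card L = j" by blast
      moreover have "finite L" "Suc n \<notin> L" using L(2) finite_subset by auto
      ultimately show ?thesis by (auto simp: atMost_Suc)
    qed (auto simp: atMost_Suc)
  qed
  have disj: "?A \<inter> insert (Suc n) ` ?B = {}" by auto
  have "(\<Sum>K\<in>?A \<union> insert (Suc n) ` ?B. f K) = sum f ?A + sum f (insert (Suc n) ` ?B)"
    using fin disj by (intro sum.union_disjoint) auto
  then show ?thesis unfolding eq using inj by (simp add: sum.reindex)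
qed

lemma sum_subsets_move_element:
  fixes f :: "nat \<Rightarrow> nat set \<Rightarrow> nat"
  shows "(\<Sum>L | L \<subseteq> {..n} \<and> card L = j. \<Sum>a\<in>{..n} - L. f a L)
       = (\<Sum>K | K \<subseteq> {..n} \<and> card K = Suc j. \<Sum>a\<in>K. f a (K - {a}))"
proof -
  let ?A = "{K. K \<subseteq> {..n} \<and> card K = Suc j}" and ?B = "{L. L \<subseteq> {..n} \<and> card L = j}"
  have fin: "finite ?A" "finite ?B" by (rule finite_subset[of _ "Pow {..n}"], auto)+
  have finA: "\<forall>K\<in>?A. finite K"
    using finite_subset[OF _ finite_atMost[of n]] by auto
  have "(\<Sum>L\<in>?B. \<Sum>a\<in>{..n} - L. f a L) = (\<Sum>(L, a)\<in>Sigma ?B (\<lambda>L. {..n} - L). f a L)"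
    using fin by (subst sum.Sigma) auto
  also have "\<dots> = (\<Sum>(K, a)\<in>Sigma ?A (\<lambda>K. K). f a (K - {a}))"
  proof (rule sum.reindex_bij_witness[where i = "\<lambda>(K, a). (K - {a}, a)" and j = "\<lambda>(L, a). (insert a L, a)"])
    fix p assume "p \<in> Sigma ?B (\<lambda>L. {..n} - L)"
    then obtain L a where p: "p = (L, a)" "L \<subseteq> {..n}" "card L = j" "a \<le> n" "a \<notin> L" by auto
    have "finite L" using p(2) finite_subset by blast
    moreover have "insert a L - {a} = L" using p(5) by simp
    ultimately show "(case case p of (L, a) \<Rightarrow> (insert a L, a) of (K, a) \<Rightarrow> (K - {a}, a)) = p"
      "(case p of (L, a) \<Rightarrow> (insert a L, a)) \<in> Sigma ?A (\<lambda>K. K)"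
      "(case case p of (L, a) \<Rightarrow> (insert a L, a) of (K, a) \<Rightarrow> f a (K - {a})) = (case p of (L, a) \<Rightarrow> f a L)"
      unfolding p(1) using p(2-5) by auto
  next
    fix p assume "p \<in> Sigma ?A (\<lambda>K. K)"
    then obtain K a where p: "p = (K, a)" "K \<subseteq> {..n}" "card K = Suc j" "a \<in> K" by auto
    have "finite K" using p(2) finite_subset by blast
    moreover have "a \<le> n" "K - {a} \<subseteq> {..n}" using p by auto
    ultimately show "(case case p of (K, a) \<Rightarrow> (K - {a}, a) of (L, a) \<Rightarrow> (insert a L, a)) = p"
      "(case p of (K, a) \<Rightarrow> (K - {a}, a)) \<in> Sigma ?B (\<lambda>L. {..n} - L)"
      unfolding p(1) using p(2-4) by (auto simp: insert_absorb)
  qed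
  also have "\<dots> = (\<Sum>K\<in>?A. \<Sum>a\<in>K. f a (K - {a}))"
    by (rule sum.Sigma[OF fin(1) finA, symmetric])
  finally show ?thesis .
qed

text \<open>
  A cyclic order of {0..n+1} with j + 1 cuts arises from one of {0..n} by inserting n + 1. If the
  new element is not a block of its own, the old order has j + 1 cuts and the slots of this order
  are traded for its walls and for one free chamber per block. If it is a block of its own, it splits
  one of the j cuts of the old order in two and remains unconstrained.
\<close>

lemma unmet_cones_Suc:
  fixes y :: "nat \<Rightarrow> 'a::euclidean_space"
  assumes W: "subspace W" "dim W + k = DIM('a)" and G: "finite G" "{..Suc n} \<subseteq> G"
    and gp: "in_general_position k W G y" and j: "j < n"
  shows "unmet_cones W G y (Suc n) (Suc j)
       = (\<Sum>w\<le>n. unmet_cones W (G - {Suc n}) (merge_vertex (Suc n) w y) n (Suc j))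
         + Suc j * unmet_cones W G y n (Suc j) + j * unmet_cones W G y n j"
proof -
  \<comment> \<open>Cut sets without Suc n are the old cut sets in A; those with Suc n come from B, and the old cut set is that in B or contains a in addition.\<close>
  let ?A = "{K. K \<subseteq> {..n} \<and> card K = Suc j}" and ?B = "{L. L \<subseteq> {..n} \<and> card L = j}"
  have fin: "finite ?A" "finite ?B" by (rule finite_subset[of _ "Pow {..n}"], auto)+
  define f where "f \<sigma> K = (of_bool (\<not> meets_cone W G y \<sigma> ({..Suc n} - K)) :: nat)" for \<sigma> K
  define g where "g \<sigma> K = (of_bool (\<not> meets_cone W G y \<sigma> ({..n} - K)) :: nat)" for \<sigma> K
  define h where "h w \<sigma> K = (of_bool (\<not> meets_cone W (G - {Suc n}) (merge_vertex (Suc n) w y) \<sigma> ({..n} - K)) :: nat)" for w \<sigma> K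
  let ?ins = "\<lambda>\<sigma> a. insert_after \<sigma> (Suc n) a"
  have per: "(\<Sum>a\<le>n. \<Sum>K | K \<subseteq> {..Suc n} \<and> card K = Suc j. f (?ins \<sigma> a) K)
      = (\<Sum>w\<le>n. \<Sum>K\<in>?A. h w \<sigma> K) + Suc j * (\<Sum>K\<in>?A. g \<sigma> K) + j * (\<Sum>L\<in>?B. g \<sigma> L)"
    if \<sigma>: "\<sigma> \<in> cyclic_perms n" for \<sigma>
  proof -
    have "(\<Sum>a\<le>n. \<Sum>K | K \<subseteq> {..Suc n} \<and> card K = Suc j. f (?ins \<sigma> a) K)
        = (\<Sum>K\<in>?A. \<Sum>a\<le>n. f (?ins \<sigma> a) K) + (\<Sum>L\<in>?B. \<Sum>a\<le>n. f (?ins \<sigma> a) (insert (Suc n) L))"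
      unfolding sum_subsets_Suc sum.distrib by (intro arg_cong2[where f = "(+)"] sum.swap)
    also have "(\<Sum>L\<in>?B. \<Sum>a\<le>n. f (?ins \<sigma> a) (insert (Suc n) L))
        = (\<Sum>L\<in>?B. (\<Sum>a\<in>{..n} - L. f (?ins \<sigma> a) (insert (Suc n) L)) + (\<Sum>a\<in>L. f (?ins \<sigma> a) (insert (Suc n) L)))"
      by (intro sum.cong refl sum.subset_diff) auto
    also have "\<dots> = (\<Sum>L\<in>?B. \<Sum>a\<in>{..n} - L. f (?ins \<sigma> a) (insert (Suc n) L))
        + (\<Sum>L\<in>?B. \<Sum>a\<in>L. f (?ins \<sigma> a) (insert (Suc n) L))"
      by (rule sum.distrib)
    also have "(\<Sum>L\<in>?B. \<Sum>a\<in>{..n} - L. f (?ins \<sigma> a) (insert (Suc n) L))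
        = (\<Sum>K\<in>?A. \<Sum>a\<in>K. f (?ins \<sigma> a) (insert (Suc n) (K - {a})))"
      by (rule sum_subsets_move_element)
    also have "(\<Sum>L\<in>?B. \<Sum>a\<in>L. f (?ins \<sigma> a) (insert (Suc n) L)) = (\<Sum>L\<in>?B. \<Sum>a\<in>L. g \<sigma> L)"
      by (intro sum.cong refl) (auto simp: f_def g_def meets_cone_insert_isolated[OF \<sigma>])
    also have "\<dots> = j * (\<Sum>L\<in>?B. g \<sigma> L)"
      by (simp add: sum_distrib_left)
    also have "(\<Sum>K\<in>?A. \<Sum>a\<le>n. f (?ins \<sigma> a) K) + ((\<Sum>K\<in>?A. \<Sum>a\<in>K. f (?ins \<sigma> a) (insert (Suc n) (K - {a}))) + j * (\<Sum>L\<in>?B. g \<sigma> L))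
        = (\<Sum>K\<in>?A. (\<Sum>a\<le>n. f (?ins \<sigma> a) K) + (\<Sum>a\<in>K. f (?ins \<sigma> a) (insert (Suc n) (K - {a})))) + j * (\<Sum>L\<in>?B. g \<sigma> L)"
      by (simp add: sum.distrib)
    also have "(\<Sum>K\<in>?A. (\<Sum>a\<le>n. f (?ins \<sigma> a) K) + (\<Sum>a\<in>K. f (?ins \<sigma> a) (insert (Suc n) (K - {a}))))
        = (\<Sum>K\<in>?A. (\<Sum>w\<le>n. h w \<sigma> K) + Suc j * g \<sigma> K)"
    proof (intro sum.cong refl)
      fix K assume K: "K \<in> ?A"
      then have "K \<noteq> {}" "K \<noteq> {..n}" using j by auto
      with K show "(\<Sum>a\<le>n. f (?ins \<sigma> a) K) + (\<Sum>a\<in>K. f (?ins \<sigma> a) (insert (Suc n) (K - {a})))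
          = (\<Sum>w\<le>n. h w \<sigma> K) + Suc j * g \<sigma> K"
        unfolding f_def g_def h_def
        using unmet_slots_eq_unmet_walls[OF W G gp \<sigma>, of K] by simp
    qed
    also have "\<dots> = (\<Sum>w\<le>n. \<Sum>K\<in>?A. h w \<sigma> K) + Suc j * (\<Sum>K\<in>?A. g \<sigma> K)"
      unfolding sum.distrib sum_distrib_left by (intro arg_cong2[where f = "(+)"] sum.swap refl)
    finally show ?thesis .
  qed
  have "unmet_cones W G y (Suc n) (Suc j)
      = (\<Sum>(\<sigma>, a)\<in>cyclic_perms n \<times> {..n}. \<Sum>K | K \<subseteq> {..Suc n} \<and> card K = Suc j. f (?ins \<sigma> a) K)"
    unfolding unmet_cones_def f_def[symmetric]
    using sum.reindex_bij_betw[OF bij_betw_insert_after, of "\<lambda>\<sigma>. \<Sum>K | K \<subseteq> {..Suc n} \<and> card K = Suc j. f \<sigma> K" n]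
    by (simp add: case_prod_unfold)
  also have "\<dots> = (\<Sum>\<sigma>\<in>cyclic_perms n. \<Sum>a\<le>n. \<Sum>K | K \<subseteq> {..Suc n} \<and> card K = Suc j. f (?ins \<sigma> a) K)"
    by (rule sum.cartesian_product[symmetric])
  also have "\<dots> = (\<Sum>\<sigma>\<in>cyclic_perms n. (\<Sum>w\<le>n. \<Sum>K\<in>?A. h w \<sigma> K) + Suc j * (\<Sum>K\<in>?A. g \<sigma> K) + j * (\<Sum>L\<in>?B. g \<sigma> L))"
    by (intro sum.cong refl per)
  also have "\<dots> = (\<Sum>w\<le>n. \<Sum>\<sigma>\<in>cyclic_perms n. \<Sum>K\<in>?A. h w \<sigma> K) + Suc j * (\<Sum>\<sigma>\<in>cyclic_perms n. \<Sum>K\<in>?A. g \<sigma> K)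
      + j * (\<Sum>\<sigma>\<in>cyclic_perms n. \<Sum>L\<in>?B. g \<sigma> L)"
    unfolding sum.distrib sum_distrib_left by (intro arg_cong2[where f = "(+)"] sum.swap refl)
  finally show ?thesis unfolding unmet_cones_def g_def h_def .
qed

text \<open>
  Stirling sums as they occur in the induction, where f of the elements are unconstrained: every free
  element lowers the effective codimension k by one. With f = 0 this is the sum in the final formula.
\<close>

definition stirling_tail :: "nat \<Rightarrow> nat \<Rightarrow> nat \<Rightarrow> nat \<Rightarrow> nat" where
  "stirling_tail n k f J =
     (\<Sum>m\<le>k. if m + f \<le> k \<and> even (k + f + m) then stirling (Suc n) m * Stirling m J else 0)"

text \<open>
  The product of the two Stirling recursions has exactly the three terms of unmet_cones_Suc.
\<close>

lemma stirling_tail_Suc: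
  "stirling_tail (Suc n) k f (Suc j)
     = Suc n * stirling_tail n k f (Suc j) + Suc j * stirling_tail n k (Suc f) (Suc j) + stirling_tail n k (Suc f) j"
proof (cases k)
  case 0
  have "stirling_tail N 0 f i = 0" for N f i
    unfolding stirling_tail_def by (intro sum.neutral) (auto simp del: stirling.simps(4))
  with 0 show ?thesis by simp
next
  case (Suc k')
  define P where "P m \<longleftrightarrow> Suc m + f \<le> k \<and> even (k + f + Suc m)" for m
  have shift: "stirling_tail N k f (Suc j) = (\<Sum>m\<le>k'. if P m then stirling (Suc N) (Suc m) * Stirling (Suc m) (Suc j) else 0)" for N
    unfolding stirling_tail_def Suc sum.atMost_Suc_shift by (simp add: P_def Suc del: stirling.simps Stirling.simps)
  have drop: "stirling_tail n k (Suc f) i = (\<Sum>m\<le>k'. if P m then stirling (Suc n) m * Stirling m i else 0)" for i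
  proof -
    have "stirling_tail n k (Suc f) i = (\<Sum>m\<le>Suc k'. if P m then stirling (Suc n) m * Stirling m i else 0)"
      unfolding stirling_tail_def Suc P_def by (intro sum.cong refl if_cong) auto
    also have "\<dots> = (\<Sum>m\<le>k'. if P m then stirling (Suc n) m * Stirling m i else 0)"
      by (simp add: P_def Suc del: stirling.simps Stirling.simps)
    finally show ?thesis .
  qed
  have "stirling (Suc (Suc n)) (Suc m) * Stirling (Suc m) (Suc j)
      = Suc n * (stirling (Suc n) (Suc m) * Stirling (Suc m) (Suc j)) + Suc j * (stirling (Suc n) m * Stirling m (Suc j))
        + stirling (Suc n) m * Stirling m j" for m
    unfolding stirling.simps(4)[of "Suc n" m] by (simp add: algebra_simps del: stirling.simps)
  then have "(if P m then stirling (Suc (Suc n)) (Suc m) * Stirling (Suc m) (Suc j) else 0)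
      = Suc n * (if P m then stirling (Suc n) (Suc m) * Stirling (Suc m) (Suc j) else 0)
        + Suc j * (if P m then stirling (Suc n) m * Stirling m (Suc j) else 0)
        + (if P m then stirling (Suc n) m * Stirling m j else 0)" for m
    by (simp del: stirling.simps Stirling.simps)
  then show ?thesis
    unfolding shift drop by (simp add: sum.distrib sum_distrib_left del: stirling.simps Stirling.simps)
qed

lemma Stirling_Suc_n_n: "Stirling (Suc n) n = Suc n choose 2"
  by (induct n) (auto simp add: numerals(2))

lemma stirling_tail_top:
  "stirling_tail n k f n = (if n + f \<le> k then Suc n choose 2 else 0)"
proof -
  let ?t = "\<lambda>m. if m + f \<le> k \<and> even (k + f + m) then stirling (Suc n) m * Stirling m n else 0"
  have zero: "?t m = 0" if "m \<notin> {n, Suc n}" for m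
  proof -
    have "m < n \<or> Suc n < m" using that by auto
    then show ?thesis by (auto simp del: stirling.simps Stirling.simps)
  qed
  have "stirling_tail n k f n = (\<Sum>m\<in>{..k} \<inter> {n, Suc n}. ?t m)"
    unfolding stirling_tail_def using zero by (intro sum.mono_neutral_right) auto
  also have "\<dots> = (\<Sum>m\<in>{n, Suc n}. ?t m)"
    by (intro sum.mono_neutral_left) auto
  also have "\<dots> = ?t n + ?t (Suc n)" by (simp del: stirling.simps Stirling.simps)
  also have "\<dots> = (if n + f \<le> k then Suc n choose 2 else 0)"
  proof (cases "n + f \<le> k")
    case True
    show ?thesis
    proof (cases "even (k + f + n)")
      case True
      with \<open>n + f \<le> k\<close> show ?thesis by (simp add: stirling_Suc_n_n del: stirling.simps)
    next
      case False
      then have "n + f \<noteq> k" by auto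
      with \<open>n + f \<le> k\<close> False show ?thesis by (simp add: Stirling_Suc_n_n del: Stirling.simps)
    qed
  qed simp
  finally show ?thesis .
qed

text \<open>
  With n cuts among n + 1 elements, a single inequality remains and every chamber is a half-space.
  It is missed only if the kernel is trivial, which is a matter of counting dimensions.
\<close>

lemma unmet_cones_top:
  fixes y :: "nat \<Rightarrow> 'a::euclidean_space"
  assumes W: "subspace W" "dim W + k = DIM('a)" and G: "finite G" "{..n} \<subseteq> G"
    and gp: "in_general_position k W G y" and n: "0 < n"
  shows "unmet_cones W G y n n = (if card G \<le> Suc k then fact (Suc n) else 0)"
proof -
  have "0 \<in> G" using G(2) by auto
  have met: "meets_cone W G y \<sigma> ({..n} - K) \<longleftrightarrow> \<not> card G \<le> Suc k"
    if \<sigma>: "\<sigma> \<in> cyclic_perms n" and K: "K \<subseteq> {..n}" "card K = n" for \<sigma> K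
  proof
    assume "meets_cone W G y \<sigma> ({..n} - K)"
    then obtain c :: "nat \<Rightarrow> real" where c: "c 0 = 0" "(\<Sum>r\<in>G. c r *\<^sub>R y r) \<in> W" "\<exists>r\<in>G. c r \<noteq> 0"
      unfolding meets_cone_def by blast
    then have "\<not> card (c ` G) \<le> Suc k" using in_general_positionD[OF gp] by blast
    with card_image_le[OF G(1), of c] show "\<not> card G \<le> Suc k" by simp
  next
    assume "\<not> card G \<le> Suc k"
    then have "\<not> card (G - {0}) \<le> k" using \<open>0 \<in> G\<close> G(1) by simp
    moreover have "finite (G - {0})" using G(1) by simp
    ultimately obtain c :: "nat \<Rightarrow> real" where c: "(\<Sum>r\<in>G - {0}. c r *\<^sub>R y r) \<in> W" "\<exists>r\<in>G - {0}. c r \<noteq> 0"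
      using card_le_if_independent_modulo[OF W, of "G - {0}" y] by blast
    define b where "b = c(0 := 0)"
    have "(\<Sum>r\<in>G. b r *\<^sub>R y r) = (\<Sum>r\<in>G - {0}. c r *\<^sub>R y r)"
      using G(1) \<open>0 \<in> G\<close> by (subst sum.remove[of G 0]) (auto simp: b_def intro!: sum.cong)
    then have bW: "(\<Sum>r\<in>G. b r *\<^sub>R y r) \<in> W" using c(1) by (simp only:)
    have b0: "b 0 = 0" by (simp add: b_def)
    obtain r where r: "r \<in> G" "r \<noteq> 0" "c r \<noteq> 0" using c(2) by blast
    then have "b r \<noteq> 0" by (simp add: b_def)
    with r(1) have bne: "\<exists>r\<in>G. b r \<noteq> 0" by (rule bexI[rotated])
    have "card ({..n} - K) = 1" using card_Diff_subset[OF finite_subset[OF K(1) finite_atMost] K(1)] K(2) by simp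
    then obtain a where a: "{..n} - K = {a}" by (auto simp: card_1_singleton_iff)
    show "meets_cone W G y \<sigma> ({..n} - K)"
    proof (cases "b (\<sigma> a) \<le> b a")
      case True
      then show ?thesis unfolding meets_cone_def a using b0 bW bne by blast
    next
      case False
      have "(\<Sum>r\<in>G. (- b r) *\<^sub>R y r) \<in> W"
        using subspace_neg[OF W(1) bW] by (simp add: sum_negf)
      then show ?thesis unfolding meets_cone_def a using b0 bne False
        by (intro exI[of _ "\<lambda>r. - b r"]) auto
    qed
  qed
  have "unmet_cones W G y n n = (\<Sum>\<sigma>\<in>cyclic_perms n. \<Sum>K | K \<subseteq> {..n} \<and> card K = n. of_bool (card G \<le> Suc k))"
    unfolding unmet_cones_def by (intro sum.cong refl) (auto simp: met)
  also have "\<dots> = fact n * (Suc n choose n) * of_bool (card G \<le> Suc k)"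
    by (simp add: card_cyclic_perms n_subsets)
  finally show ?thesis by simp
qed

text \<open>
  The number of chambers missed by a generic kernel depends only on the codimension. The factor
  fact j counts the cyclic arrangements of the j + 1 blocks, and the factor 2 comes from the
  half-spaces in which the induction starts.
\<close>

theorem unmet_cones_eq:
  fixes y :: "nat \<Rightarrow> 'a::euclidean_space"
  assumes W: "subspace W" "dim W + k = DIM('a)" and G: "finite G" "{..n} \<subseteq> G"
    and gp: "in_general_position k W G y" and j: "j < n"
  shows "unmet_cones W G y n (Suc j) = 2 * fact j * stirling_tail n k (card (G - {..n})) (Suc j)"
  using G gp j
proof (induction n arbitrary: G y j)
  case 0
  then show ?case by simp
next
  case (Suc n)
  let ?f = "card (G - {..Suc n})"
  show ?case
  proof (cases "j = n")
    case True
    have "card G = card {..Suc n} + ?f"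
      using card_mono[OF Suc.prems(1,2)] by (simp add: card_Diff_subset[OF finite_atMost Suc.prems(2)])
    then have "card G \<le> Suc k \<longleftrightarrow> Suc n + ?f \<le> k" by simp
    moreover have "2 * fact n * (Suc (Suc n) choose 2) = (fact (Suc (Suc n)) :: nat)"
    proof -
      have "2 * (Suc (Suc n) choose 2) = Suc (Suc n) * Suc n"
        by (simp add: choose_two)
      then have "fact n * (2 * (Suc (Suc n) choose 2)) = fact n * (Suc (Suc n) * Suc n)" by simp
      then show ?thesis by (simp add: algebra_simps)
    qed
    ultimately show ?thesis
      unfolding True unmet_cones_top[OF W Suc.prems(1-3) zero_less_Suc] stirling_tail_top by simp
  next
    case False
    then have j: "j < n" using Suc.prems(4) by simp
    have v: "Suc n \<in> G" "Suc n \<notin> {..n}" using Suc.prems(2) by auto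
    have G': "finite (G - {Suc n})" "{..n} \<subseteq> G - {Suc n}" "{..n} \<subseteq> G" using Suc.prems(1,2) by auto
    have "(G - {Suc n}) - {..n} = G - {..Suc n}" by (auto simp: atMost_Suc)
    then have cardf: "card ((G - {Suc n}) - {..n}) = ?f" by simp
    have merged: "unmet_cones W (G - {Suc n}) (merge_vertex (Suc n) w y) n (Suc j)
        = 2 * fact j * stirling_tail n k ?f (Suc j)" if w: "w \<le> n" for w
    proof -
      have "w \<in> G" "Suc n \<noteq> w" using w Suc.prems(2) by auto
      from in_general_position_merge[OF Suc.prems(3,1) v(1) this]
      have "in_general_position k W (G - {Suc n}) (merge_vertex (Suc n) w y)" by simp
      from Suc.IH[OF G'(1,2) this j] show ?thesis unfolding cardf .
    qed
    have "G - {..n} = insert (Suc n) (G - {..Suc n})" using v by (auto simp: atMost_Suc)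
    then have card: "card (G - {..n}) = Suc ?f" using Suc.prems(1) by simp
    have same: "unmet_cones W G y n (Suc j) = 2 * fact j * stirling_tail n k (Suc ?f) (Suc j)"
      using Suc.IH[OF Suc.prems(1) G'(3) Suc.prems(3) j] card by simp
    have less: "j * unmet_cones W G y n j = 2 * fact j * stirling_tail n k (Suc ?f) j"
    proof (cases j)
      case 0
      have "stirling_tail n k (Suc ?f) 0 = 0"
        unfolding stirling_tail_def
      proof (intro sum.neutral ballI)
        fix m show "(if m + Suc ?f \<le> k \<and> even (k + Suc ?f + m) then stirling (Suc n) m * Stirling m 0 else 0) = 0"
          by (cases m) (auto simp del: stirling.simps(4))
      qed
      with 0 show ?thesis by simp
    next
      case (Suc i)
      then have "unmet_cones W G y n (Suc i) = 2 * fact i * stirling_tail n k (Suc ?f) (Suc i)"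
        using Suc.IH[OF Suc.prems(1) G'(3) Suc.prems(3), of i] card j by simp
      then show ?thesis unfolding Suc by (simp add: algebra_simps)
    qed
    show ?thesis
      unfolding unmet_cones_Suc[OF W Suc.prems(1-3) j] stirling_tail_Suc less same
      using merged by (simp add: algebra_simps)
  qed
qed

section \<open>Summation by parts along a walk\<close>

definition partial_sum :: "(nat \<Rightarrow> 'a::comm_monoid_add) \<Rightarrow> nat \<Rightarrow> 'a" where
  "partial_sum x i = (\<Sum>r\<in>{1..i}. x r)"

abbreviation walk_comb :: "nat \<Rightarrow> (nat \<Rightarrow> 'a::real_vector) \<Rightarrow> (nat \<Rightarrow> real) \<Rightarrow> 'a" where
  "walk_comb n x l \<equiv> \<Sum>i\<le>n. l i *\<^sub>R partial_sum x i"

text \<open>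
  By convex duality, a non-empty I is not absorbed if and only if the positions at the times of I are
  affinely independent modulo W and some linear functional vanishing on W is maximal over the walk
  exactly at these times. So they span a simplex that is a face of the projection of the hull along W.
  The dual side expresses this by weights, which summation by parts can transform.
\<close>

definition absorbed :: "'a::real_vector set \<Rightarrow> (nat \<Rightarrow> 'a) \<Rightarrow> nat \<Rightarrow> nat set \<Rightarrow> bool" where
  "absorbed W x n I \<longleftrightarrow>
     (\<exists>l :: nat \<Rightarrow> real. (\<exists>i\<le>n. l i \<noteq> 0) \<and> (\<Sum>i\<le>n. l i) = 0 \<and> (\<forall>i\<in>{..n} - I. 0 \<le> l i) \<and>
        walk_comb n x l \<in> W)"

lemma partial_sum_0 [simp]: "partial_sum x 0 = 0"
  by (simp add: partial_sum_def)

lemma partial_sum_Suc: "partial_sum x (Suc i) = partial_sum x i + x (Suc i)"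
  by (simp add: partial_sum_def add.commute)

lemma abel_summation:
  fixes x :: "nat \<Rightarrow> 'a::real_vector" and b :: "nat \<Rightarrow> real"
  shows "(\<Sum>i\<le>n. (b i - b (Suc i)) *\<^sub>R partial_sum x i)
       = (\<Sum>r\<in>{1..n}. b r *\<^sub>R x r) - b (Suc n) *\<^sub>R partial_sum x n"
  by (induction n) (simp_all add: partial_sum_Suc algebra_simps)

lemma abel_summation_cyclic:
  fixes x :: "nat \<Rightarrow> 'a::real_vector" and c :: "nat \<Rightarrow> real"
  assumes "c 0 = 0"
  shows "(\<Sum>i\<le>n. (c i - c (rotate_up n i)) *\<^sub>R partial_sum x i) = (\<Sum>r\<in>{1..n}. c r *\<^sub>R x r)"
proof -
  define b where "b = c(Suc n := 0)"
  have "(\<Sum>i\<le>n. (c i - c (rotate_up n i)) *\<^sub>R partial_sum x i) = (\<Sum>i\<le>n. (b i - b (Suc i)) *\<^sub>R partial_sum x i)"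
    using assms by (intro sum.cong) (auto simp: b_def rotate_up_def)
  also have "\<dots> = (\<Sum>r\<in>{1..n}. b r *\<^sub>R x r)"
    unfolding abel_summation by (simp add: b_def)
  also have "\<dots> = (\<Sum>r\<in>{1..n}. c r *\<^sub>R x r)"
    by (intro sum.cong) (auto simp: b_def)
  finally show ?thesis .
qed

lemma tail_sum_diff:
  fixes l :: "nat \<Rightarrow> real"
  assumes "(\<Sum>i\<le>n. l i) = 0" "i \<le> n"
  shows "(\<Sum>p\<in>{i..n}. l p) - (\<Sum>p\<in>{rotate_up n i..n}. l p) = l i"
proof (cases "i = n")
  case True
  then show ?thesis using assms(1) by (simp add: rotate_up_def atLeast0AtMost)
next
  case False
  then have "rotate_up n i = Suc i" using assms(2) by (simp add: rotate_up_def)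
  then show ?thesis using assms(2) by (simp add: sum.atLeast_Suc_atMost[of i n])
qed

lemma sum_cyclic_differences:
  fixes c :: "nat \<Rightarrow> real"
  assumes "c 0 = 0" "r \<le> n"
  shows "(\<Sum>i\<in>{r..n}. c i - c (rotate_up n i)) = c r"
proof -
  have "(\<Sum>i\<in>{r..n}. c i - c (rotate_up n i)) = (\<Sum>i\<in>{r..n}. (c(Suc n := 0)) i - (c(Suc n := 0)) (Suc i))"
    using assms(1) by (intro sum.cong) (auto simp: rotate_up_def)
  also have "\<dots> = - (\<Sum>i\<in>{r..n}. (c(Suc n := 0)) (Suc i) - (c(Suc n := 0)) i)"
    by (simp add: sum_negf[symmetric])
  also have "\<dots> = c r" using assms(2) by (subst sum_Suc_diff) auto
  finally show ?thesis .
qed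

text \<open>
  The weights l and the coefficients c determine each other: l is the cyclic difference of c, and c is
  the tail sum of l. As the weights sum to zero, c vanishes at 0, which closes the cycle.
\<close>

lemma absorbed_iff_cone:
  "absorbed W x n I \<longleftrightarrow>
     (\<exists>c :: nat \<Rightarrow> real. c 0 = 0 \<and> (\<Sum>r\<in>{1..n}. c r *\<^sub>R x r) \<in> W \<and>
        (\<forall>i\<in>{..n} - I. c (rotate_up n i) \<le> c i) \<and> (\<exists>r\<le>n. c r \<noteq> 0))" (is "?L \<longleftrightarrow> ?R")
proof
  assume ?L
  then obtain l :: "nat \<Rightarrow> real" where l: "\<exists>i\<le>n. l i \<noteq> 0" "(\<Sum>i\<le>n. l i) = 0" "\<forall>i\<in>{..n} - I. 0 \<le> l i"
    "walk_comb n x l \<in> W" unfolding absorbed_def by blast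
  define c where "c r = (\<Sum>p\<in>{r..n}. l p)" for r
  have diff: "c i - c (rotate_up n i) = l i" if "i \<le> n" for i
    unfolding c_def by (rule tail_sum_diff[OF l(2) that])
  have c0: "c 0 = 0" using l(2) by (simp add: c_def atLeast0AtMost)
  have "(\<Sum>r\<in>{1..n}. c r *\<^sub>R x r) = walk_comb n x l"
    unfolding abel_summation_cyclic[of c, OF c0, symmetric] using diff by (intro sum.cong) auto
  moreover have "c (rotate_up n i) \<le> c i" if "i \<in> {..n} - I" for i
    using diff[of i] that l(3) by force
  moreover have "\<exists>r\<le>n. c r \<noteq> 0"
  proof (rule ccontr)
    assume "\<not> (\<exists>r\<le>n. c r \<noteq> 0)"
    then have z: "c r = 0" if "r \<le> n" for r using that by blast
    have "l i = 0" if "i \<le> n" for i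
      using diff[OF that] z[OF that] z[of "rotate_up n i"] that by (auto simp: rotate_up_def split: if_splits)
    with l(1) show False by blast
  qed
  ultimately show ?R using c0 l(4) by (intro exI[of _ c]) auto
next
  assume ?R
  then obtain c :: "nat \<Rightarrow> real" where c: "c 0 = 0" "(\<Sum>r\<in>{1..n}. c r *\<^sub>R x r) \<in> W"
    "\<forall>i\<in>{..n} - I. c (rotate_up n i) \<le> c i" "\<exists>r\<le>n. c r \<noteq> 0" by blast
  define l where "l i = c i - c (rotate_up n i)" for i
  have sum: "(\<Sum>i\<in>{r..n}. l i) = c r" if "r \<le> n" for r
    unfolding l_def by (rule sum_cyclic_differences[of c, OF c(1) that])
  have "\<exists>i\<le>n. l i \<noteq> 0"
  proof (rule ccontr)
    assume "\<not> (\<exists>i\<le>n. l i \<noteq> 0)"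
    then have "(\<Sum>i\<in>{r..n}. l i) = 0" for r by (intro sum.neutral) auto
    with sum c(4) show False by auto
  qed
  moreover have "(\<Sum>i\<le>n. l i) = 0" using sum[of 0] c(1) by (simp add: atLeast0AtMost)
  moreover have "walk_comb n x l \<in> W"
    unfolding l_def abel_summation_cyclic[of c, OF c(1)] by (rule c(2))
  moreover have "\<forall>i\<in>{..n} - I. 0 \<le> l i" using c(3) by (simp add: l_def)
  ultimately show ?L unfolding absorbed_def by blast
qed

lemma absorbed_permuted_iff:
  fixes x :: "nat \<Rightarrow> 'a::real_vector"
  assumes \<pi>: "\<pi> permutes {1..n}" and I: "I \<subseteq> {..n}"
  shows "absorbed W (x \<circ> \<pi>) n I \<longleftrightarrow> meets_cone W {..n} x (\<pi> \<circ> rotate_up n \<circ> inv \<pi>) ({..n} - \<pi> ` I)"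
proof -
  note \<pi>' = permutes_1_atMost[OF \<pi>]
  have inv1: "inv \<pi> (\<pi> a) = a" and inv2: "\<pi> (inv \<pi> a) = a" for a
    by (simp_all add: permutes_inverses[OF \<pi>])
  have z: "\<pi> 0 = 0" "inv \<pi> 0 = 0"
    using permutes_1_zero[OF \<pi>] permutes_1_zero[OF permutes_inv[OF \<pi>]] by auto
  have im: "{..n} - \<pi> ` I = \<pi> ` ({..n} - I)"
    using permutes_image[OF \<pi>'] permutes_inj[OF \<pi>] by (simp add: image_set_diff)
  have sum0: "(\<Sum>r\<le>n. b r *\<^sub>R x r) = (\<Sum>r\<in>{1..n}. b r *\<^sub>R x r)" if "b 0 = 0" for b :: "nat \<Rightarrow> real"
    using that by (intro sum.mono_neutral_right) (auto simp: Suc_le_eq)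
  have sumperm: "(\<Sum>r\<in>{1..n}. b (\<pi> r) *\<^sub>R x (\<pi> r)) = (\<Sum>r\<in>{1..n}. b r *\<^sub>R x r)" for b :: "nat \<Rightarrow> real"
    using sum.permute[OF \<pi>, of "\<lambda>r. b r *\<^sub>R x r"] by (simp add: o_def)
  show ?thesis
  proof
    assume "absorbed W (x \<circ> \<pi>) n I"
    then obtain c :: "nat \<Rightarrow> real" where c: "c 0 = 0" "(\<Sum>r\<in>{1..n}. c r *\<^sub>R x (\<pi> r)) \<in> W"
      "\<forall>i\<in>{..n} - I. c (rotate_up n i) \<le> c i" "\<exists>r\<le>n. c r \<noteq> 0"
      unfolding absorbed_iff_cone o_def by blast
    define b where "b r = c (inv \<pi> r)" for r
    have b0: "b 0 = 0" using c(1) z by (simp add: b_def)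
    have "(\<Sum>r\<le>n. b r *\<^sub>R x r) = (\<Sum>r\<in>{1..n}. c r *\<^sub>R x (\<pi> r))"
      unfolding sum0[of b, OF b0] sumperm[of b, symmetric] by (simp add: b_def inv1)
    with c(2) have bW: "(\<Sum>r\<le>n. b r *\<^sub>R x r) \<in> W" by simp
    have bdesc: "\<forall>a\<in>{..n} - \<pi> ` I. b ((\<pi> \<circ> rotate_up n \<circ> inv \<pi>) a) \<le> b a"
      unfolding im using c(3) by (auto simp: b_def inv1)
    obtain r where r: "r \<le> n" "c r \<noteq> 0" using c(4) by blast
    have "\<pi> r \<in> {..n}" using permutes_in_image[OF \<pi>', of r] r by simp
    moreover have "b (\<pi> r) \<noteq> 0" using r by (simp add: b_def inv1)
    ultimately show "meets_cone W {..n} x (\<pi> \<circ> rotate_up n \<circ> inv \<pi>) ({..n} - \<pi> ` I)"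
      unfolding meets_cone_def using b0 bW bdesc by blast
  next
    assume "meets_cone W {..n} x (\<pi> \<circ> rotate_up n \<circ> inv \<pi>) ({..n} - \<pi> ` I)"
    then obtain b :: "nat \<Rightarrow> real" where b: "b 0 = 0" "(\<Sum>r\<le>n. b r *\<^sub>R x r) \<in> W"
      "\<forall>a\<in>\<pi> ` ({..n} - I). b ((\<pi> \<circ> rotate_up n \<circ> inv \<pi>) a) \<le> b a" "\<exists>r\<in>{..n}. b r \<noteq> 0"
      unfolding meets_cone_def im by blast
    define c where "c r = b (\<pi> r)" for r
    have "c 0 = 0" using b(1) z by (simp add: c_def)
    moreover have "(\<Sum>r\<in>{1..n}. c r *\<^sub>R (x \<circ> \<pi>) r) \<in> W"
      using b(2) by (simp only: sum0[of b, OF b(1)] c_def o_def sumperm)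
    moreover have "\<forall>i\<in>{..n} - I. c (rotate_up n i) \<le> c i"
      using b(3) by (simp add: c_def inv1)
    moreover have "\<exists>r\<le>n. c r \<noteq> 0"
    proof -
      obtain r where r: "r \<le> n" "b r \<noteq> 0" using b(4) by blast
      have "inv \<pi> r \<in> {..n}" using permutes_in_image[OF permutes_inv[OF \<pi>'], of r] r by simp
      then show ?thesis using r by (intro exI[of _ "inv \<pi> r"]) (simp add: c_def inv2)
    qed
    ultimately show "absorbed W (x \<circ> \<pi>) n I" unfolding absorbed_iff_cone by blast
  qed
qed

text \<open>
  The expected number of faces in deterministic form: for increments in general position modulo W, the
  number of unabsorbed sets, summed over all orders of the increments, depends on W only through its
  codimension.
\<close>

theorem sum_not_absorbed:
  fixes x :: "nat \<Rightarrow> 'a::euclidean_space"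
  assumes W: "subspace W" "dim W + k = DIM('a)"
    and gp: "in_general_position k W {..n} x" and j: "j < n"
  shows "(\<Sum>\<pi> | \<pi> permutes {1..n}. \<Sum>I | I \<subseteq> {..n} \<and> card I = Suc j. (of_bool (\<not> absorbed W (x \<circ> \<pi>) n I) :: nat))
       = 2 * fact j * stirling_tail n k 0 (Suc j)"
proof -
  let ?J = "{I. I \<subseteq> {..n} \<and> card I = Suc j}"
  have "(\<Sum>\<pi> | \<pi> permutes {1..n}. \<Sum>I\<in>?J. (of_bool (\<not> absorbed W (x \<circ> \<pi>) n I) :: nat))
      = (\<Sum>\<pi> | \<pi> permutes {1..n}. \<Sum>K\<in>?J.
          (of_bool (\<not> meets_cone W {..n} x (\<pi> \<circ> rotate_up n \<circ> inv \<pi>) ({..n} - K)) :: nat))"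
  proof (rule sum.cong[OF refl])
    fix \<pi> assume "\<pi> \<in> {\<pi>. \<pi> permutes {1..n}}"
    then have \<pi>: "\<pi> permutes {1..n}" by simp
    have inj: "inj \<pi>" by (rule permutes_inj[OF \<pi>])
    have bij: "bij_betw ((`) \<pi>) ?J ?J"
    proof (rule bij_betw_byWitness[where f' = "(`) (inv \<pi>)"])
      have maps: "(`) \<rho> ` ?J \<subseteq> ?J" if "\<rho> permutes {..n}" for \<rho>
      proof clarify
        fix I assume I: "I \<subseteq> {..n}" "card I = Suc j"
        have "\<rho> ` I \<subseteq> {..n}" using I(1) permutes_image[OF that] by blast
        moreover have "card (\<rho> ` I) = Suc j"
          using I(2) card_image[of \<rho> I] permutes_inj_on[OF that] by simp
        ultimately show "\<rho> ` I \<subseteq> {..n} \<and> card (\<rho> ` I) = Suc j" by simp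
      qed
      show "(`) \<pi> ` ?J \<subseteq> ?J" by (rule maps[OF permutes_1_atMost[OF \<pi>]])
      show "(`) (inv \<pi>) ` ?J \<subseteq> ?J" by (rule maps[OF permutes_1_atMost[OF permutes_inv[OF \<pi>]]])
      show "\<forall>I\<in>?J. inv \<pi> ` \<pi> ` I = I" by (simp add: image_image permutes_inverses[OF \<pi>])
      show "\<forall>I\<in>?J. \<pi> ` inv \<pi> ` I = I" by (simp add: image_image permutes_inverses[OF \<pi>])
    qed
    have "(\<Sum>I\<in>?J. (of_bool (\<not> absorbed W (x \<circ> \<pi>) n I) :: nat))
        = (\<Sum>I\<in>?J. of_bool (\<not> meets_cone W {..n} x (\<pi> \<circ> rotate_up n \<circ> inv \<pi>) ({..n} - \<pi> ` I)))"
      by (intro sum.cong refl) (simp add: absorbed_permuted_iff[OF \<pi>])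
    also have "\<dots> = (\<Sum>K\<in>?J. (of_bool (\<not> meets_cone W {..n} x (\<pi> \<circ> rotate_up n \<circ> inv \<pi>) ({..n} - K)) :: nat))"
      by (rule sum.reindex_bij_betw[OF bij, of "\<lambda>K. of_bool (\<not> meets_cone W {..n} x (\<pi> \<circ> rotate_up n \<circ> inv \<pi>) ({..n} - K))"])
    finally show "(\<Sum>I\<in>?J. (of_bool (\<not> absorbed W (x \<circ> \<pi>) n I) :: nat))
        = (\<Sum>K\<in>?J. of_bool (\<not> meets_cone W {..n} x (\<pi> \<circ> rotate_up n \<circ> inv \<pi>) ({..n} - K)))" .
  qed
  also have "\<dots> = unmet_cones W {..n} x n (Suc j)"
    unfolding unmet_cones_def
    by (rule sum.reindex_bij_betw[OF bij_betw_conj_rotate, of "\<lambda>\<sigma>. \<Sum>K\<in>?J. of_bool (\<not> meets_cone W {..n} x \<sigma> ({..n} - K))" n])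
  also have "\<dots> = 2 * fact j * stirling_tail n k 0 (Suc j)"
    using unmet_cones_eq[OF W _ _ gp j] by simp
  finally show ?thesis .
qed

text \<open>
  The series runs over l with m = k - 2 l; reindexing by m turns it into a sum over m of the same parity as k.
\<close>

lemma stirling_sum_eq_tail: "stirling_sum n k J = real (stirling_tail n k 0 J)"
proof -
  let ?h = "\<lambda>m. real (stirling (n + 1) m * Stirling m J)"
  have "stirling_sum n k J = (\<Sum>l | 2 * l \<le> k. ?h (k - 2 * l))"
    unfolding stirling_sum_def
  proof (rule suminf_finite)
    show "finite {l. 2 * l \<le> k}" by (rule finite_subset[of _ "{..k}"]) auto
    fix l assume "l \<notin> {l. 2 * l \<le> k}"
    then have "k - 2 * l = 0" by simp
    then show "?h (k - 2 * l) = 0" by simp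
  qed
  also have "\<dots> = (\<Sum>m | m \<le> k \<and> even (k + m). ?h m)"
  proof (rule sum.reindex_bij_witness[where i = "\<lambda>m. (k - m) div 2" and j = "\<lambda>l. k - 2 * l"])
    fix m assume m: "m \<in> {m. m \<le> k \<and> even (k + m)}"
    then have "even (k - m)" by auto
    with m show "k - 2 * ((k - m) div 2) = m" "(k - m) div 2 \<in> {l. 2 * l \<le> k}" by auto
  qed auto
  also have "\<dots> = (\<Sum>m\<le>k. if even (k + m) then ?h m else 0)"
    by (intro sum.mono_neutral_cong_left) auto
  also have "\<dots> = real (stirling_tail n k 0 J)"
    unfolding stirling_tail_def of_nat_sum by (intro sum.cong) auto
  finally show ?thesis .
qed

section \<open>Faces and tangent cones of the hull of a walk\<close>

lemma convex_hull_image_eq: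
  fixes S :: "'i \<Rightarrow> 'a::real_vector"
  assumes A: "finite A"
  shows "convex hull (S ` A) = {y. \<exists>u. (\<forall>i\<in>A. 0 \<le> u i) \<and> sum u A = 1 \<and> y = (\<Sum>i\<in>A. u i *\<^sub>R S i)}" (is "_ = ?C")
proof
  have "convex ?C"
  proof (rule convexI)
    fix y z :: 'a and s t :: real assume "y \<in> ?C" "z \<in> ?C" and st: "0 \<le> s" "0 \<le> t" "s + t = 1"
    then obtain u w where u: "\<forall>i\<in>A. 0 \<le> u i" "sum u A = 1" "y = (\<Sum>i\<in>A. u i *\<^sub>R S i)"
      and w: "\<forall>i\<in>A. 0 \<le> w i" "sum w A = 1" "z = (\<Sum>i\<in>A. w i *\<^sub>R S i)" by blast
    let ?v = "\<lambda>i. s * u i + t * w i"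
    have "\<forall>i\<in>A. 0 \<le> ?v i" using u(1) w(1) st by simp
    moreover have "sum ?v A = 1"
      using u(2) w(2) st by (simp add: sum.distrib sum_distrib_left[symmetric])
    moreover have "s *\<^sub>R y + t *\<^sub>R z = (\<Sum>i\<in>A. ?v i *\<^sub>R S i)"
      unfolding u(3) w(3) by (simp add: scaleR_sum_right scaleR_add_left sum.distrib)
    ultimately show "s *\<^sub>R y + t *\<^sub>R z \<in> ?C"
      by (intro CollectI exI[of _ ?v] conjI)
  qed
  moreover have "S ` A \<subseteq> ?C"
  proof
    fix y assume "y \<in> S ` A"
    then obtain a where a: "a \<in> A" "y = S a" by blast
    let ?u = "\<lambda>i. if i = a then 1 else 0 :: real"
    have "(\<Sum>i\<in>A. ?u i *\<^sub>R S i) = (\<Sum>i\<in>A. if i = a then S i else 0)" by (intro sum.cong) auto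
    then have "sum ?u A = 1" "y = (\<Sum>i\<in>A. ?u i *\<^sub>R S i)" using a A by simp_all
    moreover have "\<forall>i\<in>A. 0 \<le> ?u i" by simp
    ultimately show "y \<in> ?C" by (intro CollectI exI[of _ ?u] conjI)
  qed
  ultimately show "convex hull (S ` A) \<subseteq> ?C" by (rule hull_minimal[rotated])
  show "?C \<subseteq> convex hull (S ` A)"
  proof
    fix y assume "y \<in> ?C"
    then obtain u where u: "\<forall>i\<in>A. 0 \<le> u i" "sum u A = 1" "y = (\<Sum>i\<in>A. u i *\<^sub>R S i)" by blast
    show "y \<in> convex hull (S ` A)"
      unfolding u(3) by (rule convex_sum[OF A convex_convex_hull u(2)]) (use u(1) in \<open>auto intro: hull_inc\<close>)
  qed
qed

lemma affine_independent_family: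
  fixes S :: "'i \<Rightarrow> 'a::euclidean_space"
  assumes J: "finite J"
    and indep: "\<And>l i. sum l J = 0 \<Longrightarrow> (\<Sum>i\<in>J. l i *\<^sub>R S i) = 0 \<Longrightarrow> i \<in> J \<Longrightarrow> l i = 0"
  shows "inj_on S J" and "\<not> affine_dependent (S ` J)"
    and "aff_dim (convex hull (S ` J)) = int (card J) - 1"
proof -
  show inj: "inj_on S J"
  proof (rule inj_onI, rule ccontr)
    fix p q assume pq: "p \<in> J" "q \<in> J" "S p = S q" "p \<noteq> q"
    define c where "c r = (if r = p then 1 else if r = q then -1 else 0 :: real)" for r
    have "sum c J = sum c {p, q}"
      using pq J by (intro sum.mono_neutral_right) (auto simp: c_def)
    then have 1: "sum c J = 0" using pq by (simp add: c_def)
    have "(\<Sum>r\<in>J. c r *\<^sub>R S r) = (\<Sum>r\<in>{p, q}. c r *\<^sub>R S r)"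
      using pq J by (intro sum.mono_neutral_right) (auto simp: c_def)
    then have "(\<Sum>r\<in>J. c r *\<^sub>R S r) = 0" using pq by (simp add: c_def)
    from indep[OF 1 this pq(1)] show False by (simp add: c_def)
  qed
  show ad: "\<not> affine_dependent (S ` J)"
  proof
    assume "affine_dependent (S ` J)"
    then obtain u where u: "sum u (S ` J) = 0" "\<exists>v\<in>S ` J. u v \<noteq> 0" "(\<Sum>v\<in>S ` J. u v *\<^sub>R v) = 0"
      using affine_dependent_explicit_finite[of "S ` J"] J by auto
    have 1: "sum (u \<circ> S) J = 0" using u(1) by (simp add: sum.reindex[OF inj])
    have 2: "(\<Sum>i\<in>J. (u \<circ> S) i *\<^sub>R S i) = 0" using u(3) by (simp add: sum.reindex[OF inj])
    from u(2) obtain i where "i \<in> J" "u (S i) \<noteq> 0" by blast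
    with indep[OF 1 2] show False by simp
  qed
  show "aff_dim (convex hull (S ` J)) = int (card J) - 1"
    using aff_dim_affine_independent[OF ad] card_image[OF inj] by (simp add: aff_dim_convex_hull)
qed

text \<open>
  Weights supported on J with sum zero have tail sums that change only at J. Followed around the
  cycle, they take at most card J different values, so general position of the increments applies.
\<close>

lemma general_position_affine_independent:
  fixes x :: "nat \<Rightarrow> 'a::euclidean_space"
  assumes gp: "in_general_position d {0} {..n} x"
    and J: "J \<subseteq> {..n}" "card J \<le> Suc d" and l: "sum l J = 0" "(\<Sum>i\<in>J. l i *\<^sub>R partial_sum x i) = 0" "i \<in> J"
  shows "l i = 0"
proof -
  have finJ: "finite J" using J(1) finite_subset by blast
  \<comment> \<open>The tail sums of the weights are the coefficients of the increments.\<close>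
  define b where "b i = (if i \<in> J then l i else 0)" for i
  define c where "c r = (\<Sum>p\<in>{r..n}. b p)" for r
  have b0: "(\<Sum>i\<le>n. b i) = 0"
    using l(1) J(1) by (simp add: b_def sum.If_cases Int_absorb1)
  have c0: "c 0 = 0" using b0 by (simp add: c_def atLeast0AtMost)
  have diff: "c r - c (rotate_up n r) = b r" if "r \<le> n" for r
    unfolding c_def by (rule tail_sum_diff[OF b0 that])
  have "(\<Sum>r\<in>{1..n}. c r *\<^sub>R x r) = walk_comb n x b"
    unfolding abel_summation_cyclic[of c, OF c0, symmetric] using diff by (intro sum.cong) auto
  also have "\<dots> = (\<Sum>i\<in>J. l i *\<^sub>R partial_sum x i)"
    using J(1) by (intro sum.mono_neutral_cong_right) (auto simp: b_def)
  finally have "(\<Sum>r\<in>{1..n}. c r *\<^sub>R x r) = 0" using l(2) by simp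
  moreover have "(\<Sum>r\<le>n. c r *\<^sub>R x r) = (\<Sum>r\<in>{1..n}. c r *\<^sub>R x r)"
    using c0 by (intro sum.mono_neutral_right) (auto simp: Suc_le_eq)
  ultimately have cW: "(\<Sum>r\<le>n. c r *\<^sub>R x r) \<in> {0}" by simp
  \<comment> \<open>The tail sum at r equals the one at the next index in J.\<close>
  have jump: "c r = c (Min (J \<inter> {r..}))" if "J \<inter> {r..} \<noteq> {}" for r
  proof -
    have m: "Min (J \<inter> {r..}) \<in> J \<inter> {r..}" using that finJ by (intro Min_in) auto
    have "b p = 0" if p: "p \<in> {r..n} - {Min (J \<inter> {r..})..n}" for p
    proof (rule ccontr)
      assume "b p \<noteq> 0"
      then have "p \<in> J \<inter> {r..}" using p by (auto simp: b_def split: if_splits)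
      then have "Min (J \<inter> {r..}) \<le> p" using finJ by (intro Min_le) auto
      with p show False by auto
    qed
    then show ?thesis unfolding c_def using m by (intro sum.mono_neutral_right) auto
  qed
  have "J \<inter> {0..} \<noteq> {}" using l(3) by auto
  from jump[OF this] have "c (Min J) = 0" using c0 by simp
  moreover have "Min J \<in> J" using Min_in[OF finJ] l(3) by blast
  ultimately have cJ0: "0 \<in> c ` J" by (metis imageI)
  have "c ` {..n} \<subseteq> c ` J"
  proof clarify
    fix r assume "r \<le> n"
    show "c r \<in> c ` J"
    proof (cases "J \<inter> {r..} = {}")
      case True
      then have "c r = 0" unfolding c_def by (intro sum.neutral) (auto simp: b_def)
      with cJ0 show ?thesis by simp
    next
      case False
      then have "Min (J \<inter> {r..}) \<in> J" using Min_in[of "J \<inter> {r..}"] finJ by auto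
      with jump[OF False] show ?thesis by blast
    qed
  qed
  then have "card (c ` {..n}) \<le> card (c ` J)" using finJ by (intro card_mono) auto
  also have "\<dots> \<le> Suc d" using card_image_le[OF finJ, of c] J(2) by simp
  finally have card: "card (c ` {..n}) \<le> Suc d" .
  have z: "c r = 0" if "r \<le> n" for r
    using in_general_positionD[OF gp c0 card cW] that by simp
  have "i \<le> n" using l(3) J(1) by auto
  then have "b i = 0" using diff[of i] z[of i] z[of "rotate_up n i"] by (auto simp: rotate_up_def split: if_splits)
  then show ?thesis using l(3) by (simp add: b_def)
qed

text \<open>
  The set of indices of the points in a face: no point of the affine hull of the S_i with i in J is a
  convex combination of other S_i. This makes sense for degenerate walks as well, where a face may
  contain more points than its dimension requires.
\<close>

definition face_indices :: "nat \<Rightarrow> (nat \<Rightarrow> 'a::real_vector) \<Rightarrow> nat set \<Rightarrow> bool" where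
  "face_indices n x J \<longleftrightarrow>
     \<not> (\<exists>l :: nat \<Rightarrow> real. (\<Sum>i\<le>n. l i) = 0 \<and> (\<forall>i\<in>{..n} - J. 0 \<le> l i) \<and> (\<Sum>i\<in>{..n} - J. l i) = 1 \<and>
        walk_comb n x l = 0)"

text \<open>
  The tangent cone at the face with indices J consists of the combinations with weights of sum zero
  that are non-negative off J.
\<close>

definition meets_tangent :: "'a::real_vector set \<Rightarrow> nat \<Rightarrow> (nat \<Rightarrow> 'a) \<Rightarrow> nat set \<Rightarrow> bool" where
  "meets_tangent W n x J \<longleftrightarrow>
     (\<exists>l :: nat \<Rightarrow> real. (\<Sum>i\<le>n. l i) = 0 \<and> (\<forall>i\<in>{..n} - J. 0 \<le> l i) \<and>
        walk_comb n x l \<in> W - {0})"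

lemma face_indices_zero:
  fixes l :: "nat \<Rightarrow> real"
  assumes J: "face_indices n x J" and l: "(\<Sum>i\<le>n. l i) = 0" "\<forall>i\<in>{..n} - J. 0 \<le> l i"
    "walk_comb n x l = 0" and i: "i \<in> {..n} - J"
  shows "l i = 0"
proof (rule ccontr)
  assume "l i \<noteq> 0"
  define L where "L = (\<Sum>i\<in>{..n} - J. l i)"
  have "0 \<le> l i" using l(2) i by blast
  with \<open>l i \<noteq> 0\<close> have "0 < l i" by simp
  also have "l i \<le> L" unfolding L_def using l(2) i by (intro member_le_sum) auto
  finally have L: "0 < L" .
  define b where "b i = (1 / L) * l i" for i
  have "(\<Sum>i\<le>n. b i) = 0" unfolding b_def sum_distrib_left[symmetric] l(1) by simp
  moreover have "\<forall>i\<in>{..n} - J. 0 \<le> b i" using l(2) L by (simp add: b_def)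
  moreover have "(\<Sum>i\<in>{..n} - J. b i) = 1"
    unfolding b_def sum_distrib_left[symmetric] L_def[symmetric] using L by simp
  moreover have "walk_comb n x b = 0"
  proof -
    have "walk_comb n x b = (1 / L) *\<^sub>R walk_comb n x l"
      by (simp add: b_def scaleR_sum_right)
    then show ?thesis using l(3) by simp
  qed
  ultimately show False using J unfolding face_indices_def by blast
qed

lemma extend_combination:
  fixes S :: "nat \<Rightarrow> 'a::real_vector"
  assumes "I \<subseteq> {..n}"
  shows "(\<Sum>i\<in>I. u i *\<^sub>R S i) = (\<Sum>i\<le>n. (if i \<in> I then u i else 0) *\<^sub>R S i)"
    and "sum u I = (\<Sum>i\<le>n. if i \<in> I then u i else (0::real))"
  using assms by (auto intro!: sum.mono_neutral_cong_left)

text \<open>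
  If a point of the hull of J lies inside a segment of the whole hull, the difference of the two
  representations has weights of sum zero that are non-negative off J. They vanish off J, and
  therefore so do the weights of both end points.
\<close>

lemma face_if_face_indices:
  fixes x :: "nat \<Rightarrow> 'a::euclidean_space"
  assumes fi: "face_indices n x I" and I: "I \<subseteq> {..n}"
  shows "convex hull (partial_sum x ` I) face_of convex hull (partial_sum x ` {..n})"
proof -
  let ?S = "partial_sum x"
  have finI: "finite I" using I finite_subset by blast
  have inside: "a \<in> convex hull (?S ` I) \<and> b \<in> convex hull (?S ` I)"
    if a: "a \<in> convex hull (?S ` {..n})" and b: "b \<in> convex hull (?S ` {..n})"
      and p: "p \<in> convex hull (?S ` I)" "p \<in> open_segment a b" for a b p
  proof -
    obtain \<alpha> where \<alpha>: "\<forall>i\<in>{..n}. 0 \<le> \<alpha> i" "sum \<alpha> {..n} = 1" "a = (\<Sum>i\<le>n. \<alpha> i *\<^sub>R ?S i)"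
      using a unfolding convex_hull_image_eq[OF finite_atMost] by blast
    obtain \<beta> where \<beta>: "\<forall>i\<in>{..n}. 0 \<le> \<beta> i" "sum \<beta> {..n} = 1" "b = (\<Sum>i\<le>n. \<beta> i *\<^sub>R ?S i)"
      using b unfolding convex_hull_image_eq[OF finite_atMost] by blast
    obtain \<gamma> where \<gamma>: "\<forall>i\<in>I. 0 \<le> \<gamma> i" "sum \<gamma> I = 1" "p = (\<Sum>i\<in>I. \<gamma> i *\<^sub>R ?S i)"
      using p(1) unfolding convex_hull_image_eq[OF finI] by blast
    obtain t where t: "0 < t" "t < 1" "p = (1 - t) *\<^sub>R a + t *\<^sub>R b"
      using p(2) by (auto simp: in_segment)
    define g where "g i = (if i \<in> I then \<gamma> i else 0)" for i
    define l where "l i = (1 - t) * \<alpha> i + t * \<beta> i - g i" for i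
    have "(\<Sum>i\<le>n. l i) = 0"
      using \<alpha>(2) \<beta>(2) \<gamma>(2) extend_combination(2)[OF I, of \<gamma>]
      by (simp add: l_def g_def sum.distrib sum_subtractf sum_distrib_left[symmetric])
    moreover have "(\<Sum>i\<le>n. l i *\<^sub>R ?S i) = 0"
    proof -
      have "(\<Sum>i\<le>n. l i *\<^sub>R ?S i) = (1 - t) *\<^sub>R a + t *\<^sub>R b - (\<Sum>i\<le>n. g i *\<^sub>R ?S i)"
        unfolding \<alpha>(3) \<beta>(3)
        by (simp add: l_def scaleR_sum_right scaleR_add_left scaleR_diff_left sum.distrib sum_subtractf)
      also have "(\<Sum>i\<le>n. g i *\<^sub>R ?S i) = p"
        unfolding \<gamma>(3) g_def extend_combination(1)[OF I] ..
      finally show ?thesis using t(3) by simp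
    qed
    moreover have "\<forall>i\<in>{..n} - I. 0 \<le> l i" using \<alpha>(1) \<beta>(1) t by (simp add: l_def g_def)
    ultimately have l0: "l i = 0" if "i \<in> {..n} - I" for i
      using face_indices_zero[OF fi _ _ _ that] by blast
    have off: "\<alpha> i = 0 \<and> \<beta> i = 0" if i: "i \<in> {..n} - I" for i
    proof -
      have "(1 - t) * \<alpha> i + t * \<beta> i = 0" using l0[OF i] i by (simp add: l_def g_def)
      moreover have "0 \<le> (1 - t) * \<alpha> i" "0 \<le> t * \<beta> i" using \<alpha>(1) \<beta>(1) t i by auto
      ultimately have "(1 - t) * \<alpha> i = 0" "t * \<beta> i = 0" by linarith+
      then show ?thesis using t by simp
    qed
    have restrict: "(\<Sum>i\<le>n. v i *\<^sub>R ?S i) = (\<Sum>i\<in>I. v i *\<^sub>R ?S i)" "sum v {..n} = sum v I"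
      if "\<And>i. i \<in> {..n} - I \<Longrightarrow> v i = 0" for v :: "nat \<Rightarrow> real"
      using I that by (auto intro!: sum.mono_neutral_right)
    have ab: "a = (\<Sum>i\<in>I. \<alpha> i *\<^sub>R ?S i)" "sum \<alpha> I = 1" "b = (\<Sum>i\<in>I. \<beta> i *\<^sub>R ?S i)" "sum \<beta> I = 1"
      using \<alpha>(2,3) \<beta>(2,3) restrict[of \<alpha>] restrict[of \<beta>] off by simp_all
    have pos: "\<forall>i\<in>I. 0 \<le> \<alpha> i" "\<forall>i\<in>I. 0 \<le> \<beta> i" using \<alpha>(1) \<beta>(1) I by blast+
    have "a \<in> convex hull (?S ` I)"
      unfolding convex_hull_image_eq[OF finI] by (rule CollectI, rule exI[of _ \<alpha>]) (intro conjI pos ab)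
    moreover have "b \<in> convex hull (?S ` I)"
      unfolding convex_hull_image_eq[OF finI] by (rule CollectI, rule exI[of _ \<beta>]) (intro conjI pos ab)
    ultimately show ?thesis ..
  qed
  have "convex hull (?S ` I) \<subseteq> convex hull (?S ` {..n})"
    using I by (intro hull_mono) auto
  moreover have "convex (convex hull (?S ` I))" by simp
  ultimately show ?thesis unfolding face_of_def by (intro conjI ballI impI inside)
qed

lemma face_indices_hull_subset:
  fixes x :: "nat \<Rightarrow> 'a::euclidean_space"
  assumes fi: "face_indices n x I" and I: "I \<subseteq> {..n}" and J: "J \<subseteq> {..n}"
    and sub: "convex hull (partial_sum x ` J) \<subseteq> convex hull (partial_sum x ` I)"
  shows "J \<subseteq> I"
proof (rule ccontr)
  assume "\<not> J \<subseteq> I"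
  then obtain p where p: "p \<in> J" "p \<notin> I" by blast
  have finI: "finite I" using I finite_subset by blast
  have "partial_sum x p \<in> convex hull (partial_sum x ` I)"
    using sub p(1) hull_subset by fastforce
  then obtain \<gamma> where \<gamma>: "\<forall>i\<in>I. 0 \<le> \<gamma> i" "sum \<gamma> I = 1" "partial_sum x p = (\<Sum>i\<in>I. \<gamma> i *\<^sub>R partial_sum x i)"
    unfolding convex_hull_image_eq[OF finI] by blast
  have pn: "p \<le> n" using p(1) J by auto
  define e where "e i = (if i = p then 1 else 0 :: real)" for i
  define l where "l i = e i - (if i \<in> I then \<gamma> i else 0)" for i
  have "(\<Sum>i\<le>n. l i) = 0"
    using extend_combination(2)[OF I, of \<gamma>] \<gamma>(2) pn by (simp add: l_def e_def sum_subtractf)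
  moreover have "walk_comb n x l = 0"
  proof -
    have "walk_comb n x e = (\<Sum>i\<le>n. if i = p then partial_sum x i else 0)"
      by (intro sum.cong) (auto simp: e_def)
    then have "walk_comb n x e = partial_sum x p" using pn by simp
    then show ?thesis
      using \<gamma>(3) extend_combination(1)[OF I, of \<gamma> "partial_sum x"]
      by (simp add: l_def scaleR_diff_left sum_subtractf)
  qed
  moreover have "\<forall>i\<in>{..n} - I. 0 \<le> l i" by (simp add: l_def e_def)
  ultimately have "l p = 0" using face_indices_zero[OF fi] pn p(2) by blast
  then show False using p(2) by (simp add: l_def e_def)
qed

text \<open>
  A functional that exposes the face is strictly smaller off J. Applied to a combination excluded by
  face_indices, it leaves no room for positive weights off J.
\<close>

lemma face_has_face_indices:
  fixes x :: "nat \<Rightarrow> 'a::euclidean_space"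
  assumes F: "F face_of convex hull (partial_sum x ` {..n})"
  shows "\<exists>J. J \<subseteq> {..n} \<and> face_indices n x J \<and> F = convex hull (partial_sum x ` J)"
proof -
  let ?S = "partial_sum x"
  define J where "J = {i. i \<le> n \<and> ?S i \<in> F}"
  have J: "J \<subseteq> {..n}" "finite J" by (auto simp: J_def)
  obtain T where T: "T \<subseteq> ?S ` {..n}" "F = convex hull T"
    using face_of_convex_hull_subset[OF _ F] by (metis finite_atMost finite_imageI finite_imp_compact)
  have "T \<subseteq> ?S ` J"
  proof
    fix y assume y: "y \<in> T"
    then obtain i where "i \<le> n" "y = ?S i" using T(1) by auto
    moreover have "y \<in> F" using y T(2) hull_inc by metis
    ultimately show "y \<in> ?S ` J" by (auto simp: J_def)
  qed
  moreover have "?S ` J \<subseteq> F" by (auto simp: J_def)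
  moreover have "convex F" using T(2) by simp
  ultimately have FJ: "F = convex hull (?S ` J)"
    unfolding T(2) by (metis T(2) hull_minimal hull_mono subset_antisym)
  have "face_indices n x J"
    unfolding face_indices_def
  proof
    assume "\<exists>l :: nat \<Rightarrow> real. (\<Sum>i\<le>n. l i) = 0 \<and> (\<forall>i\<in>{..n} - J. 0 \<le> l i) \<and> (\<Sum>i\<in>{..n} - J. l i) = 1 \<and>
        (\<Sum>i\<le>n. l i *\<^sub>R ?S i) = 0"
    then obtain l :: "nat \<Rightarrow> real" where l: "(\<Sum>i\<in>{..n} - J. l i) = 1" "(\<Sum>i\<le>n. l i) = 0" "\<forall>i\<in>{..n} - J. 0 \<le> l i"
      "(\<Sum>i\<le>n. l i *\<^sub>R ?S i) = 0" by blast
    have "polyhedron (convex hull (?S ` {..n}))"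
      by (intro polytope_imp_polyhedron polytope_convex_hull) simp
    then have "F exposed_face_of convex hull (?S ` {..n})"
      using F by (simp add: exposed_face_of_polyhedron)
    \<comment> \<open>The face is exposed since the hull is a polyhedron.\<close>
    then obtain a b where ab: "convex hull (?S ` {..n}) \<subseteq> {y. a \<bullet> y \<le> b}" "F = convex hull (?S ` {..n}) \<inter> {y. a \<bullet> y = b}"
      unfolding exposed_face_of_def by blast
    have Sin: "?S i \<in> convex hull (?S ` {..n})" if "i \<le> n" for i
      using that by (intro hull_inc) auto
    have le: "a \<bullet> ?S i \<le> b" if "i \<le> n" for i using ab(1) Sin[OF that] by blast
    have lt: "a \<bullet> ?S i < b" if "i \<in> {..n} - J" for i
    proof -
      have "?S i \<notin> F" using that by (auto simp: J_def)
      then have "a \<bullet> ?S i \<noteq> b" using ab(2) Sin[of i] that by auto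
      then show ?thesis using le[of i] that by auto
    qed
    have eq: "a \<bullet> ?S i = b" if "i \<in> J" for i using that ab(2) by (auto simp: J_def)
    have "(\<Sum>i\<le>n. l i * (b - a \<bullet> ?S i)) = (\<Sum>i\<le>n. l i) * b - a \<bullet> (\<Sum>i\<le>n. l i *\<^sub>R ?S i)"
      by (simp add: sum_distrib_right right_diff_distrib sum_subtractf inner_sum_right)
    then have "(\<Sum>i\<le>n. l i * (b - a \<bullet> ?S i)) = 0" using l(2,4) by simp
    moreover have "0 \<le> l i * (b - a \<bullet> ?S i)" if "i \<in> {..n}" for i
    proof (cases "i \<in> J")
      case True
      then show ?thesis using eq by simp
    next
      case False
      then show ?thesis using lt[of i] l(3) that by simp
    qed
    ultimately have z: "l i * (b - a \<bullet> ?S i) = 0" if "i \<in> {..n}" for i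
      using that sum_nonneg_eq_0_iff[of "{..n}" "\<lambda>i. l i * (b - a \<bullet> ?S i)"] by blast
    have off: "l i = 0" if "i \<in> {..n} - J" for i using z[of i] lt[of i] that by auto
    then have "(\<Sum>i\<in>{..n} - J. l i) = 0" by (intro sum.neutral ballI)
    with l(1) show False by simp
  qed
  with FJ J(1) show ?thesis by blast
qed

lemma bij_betw_faces:
  fixes x :: "nat \<Rightarrow> real^'d"
  shows "bij_betw (\<lambda>J. convex hull (partial_sum x ` J))
     {J. J \<subseteq> {..n} \<and> face_indices n x J \<and> aff_dim (partial_sum x ` J) = int j} (faces j (convex hull (partial_sum x ` {..n})))"
proof (rule bij_betw_imageI)
  let ?J = "{J. J \<subseteq> {..n} \<and> face_indices n x J \<and> aff_dim (partial_sum x ` J) = int j}"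
  show "inj_on (\<lambda>J. convex hull (partial_sum x ` J)) ?J"
  proof (rule inj_onI)
    fix I J assume I: "I \<in> ?J" and J: "J \<in> ?J"
      and eq: "convex hull (partial_sum x ` I) = convex hull (partial_sum x ` J)"
    have IJ: "face_indices n x I" "I \<subseteq> {..n}" "face_indices n x J" "J \<subseteq> {..n}"
      using I J by simp_all
    have "J \<subseteq> I" by (rule face_indices_hull_subset[OF IJ(1,2,4)]) (simp only: eq order_refl)
    moreover have "I \<subseteq> J" by (rule face_indices_hull_subset[OF IJ(3,4,2)]) (simp only: eq order_refl)
    ultimately show "I = J" by blast
  qed
  show "(\<lambda>J. convex hull (partial_sum x ` J)) ` ?J = faces j (convex hull (partial_sum x ` {..n}))"
  proof
    show "(\<lambda>J. convex hull (partial_sum x ` J)) ` ?J \<subseteq> faces j (convex hull (partial_sum x ` {..n}))"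
    proof (rule image_subsetI)
      fix J assume "J \<in> ?J"
      then have J: "J \<subseteq> {..n}" "face_indices n x J" "aff_dim (partial_sum x ` J) = int j" by simp_all
      then show "convex hull (partial_sum x ` J) \<in> faces j (convex hull (partial_sum x ` {..n}))"
        using face_if_face_indices[OF J(2,1)] by (simp add: faces_def aff_dim_convex_hull)
    qed
    show "faces j (convex hull (partial_sum x ` {..n})) \<subseteq> (\<lambda>J. convex hull (partial_sum x ` J)) ` ?J"
    proof
      fix F assume "F \<in> faces j (convex hull (partial_sum x ` {..n}))"
      then have F: "F face_of convex hull (partial_sum x ` {..n})" "aff_dim F = int j" by (auto simp: faces_def)
      from face_has_face_indices[OF F(1)] obtain J
        where J: "J \<subseteq> {..n}" "face_indices n x J" "F = convex hull (partial_sum x ` J)" by blast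
      have "J \<in> ?J" using J F(2) by (simp add: aff_dim_convex_hull)
      with J(3) show "F \<in> (\<lambda>J. convex hull (partial_sum x ` J)) ` ?J" by (rule image_eqI)
    qed
  qed
qed

text \<open>
  In general position every face of dimension below d is a simplex.
\<close>

lemma face_indices_iff_not_absorbed:
  fixes x :: "nat \<Rightarrow> 'a::euclidean_space"
  assumes gp: "in_general_position d {0} {..n} x" and j: "j < d" and J: "J \<subseteq> {..n}"
  shows "face_indices n x J \<and> aff_dim (partial_sum x ` J) = int j \<longleftrightarrow> card J = Suc j \<and> \<not> absorbed {0} x n J"
proof -
  let ?S = "partial_sum x"
  have small: "aff_dim (?S ` K) = int (card K) - 1" if K: "K \<subseteq> {..n}" "card K \<le> Suc d" for K
    unfolding aff_dim_convex_hull[symmetric, of "?S ` K"]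
  proof (rule affine_independent_family(3))
    show "finite K" using K(1) finite_subset by blast
  qed (rule general_position_affine_independent[OF gp K])
  have dim: "aff_dim (?S ` J) = int j \<longleftrightarrow> card J = Suc j"
  proof
    assume a: "aff_dim (?S ` J) = int j"
    have "card J \<le> d"
    proof (rule ccontr)
      assume "\<not> card J \<le> d"
      then have "Suc d \<le> card J" by simp
      then obtain K where K: "K \<subseteq> J" "card K = Suc d" by (meson obtain_subset_with_card_n)
      have "K \<subseteq> {..n}" using K(1) J by (rule subset_trans)
      then have "aff_dim (?S ` K) = int d" using small[of K] K(2) by simp
      moreover have "aff_dim (?S ` K) \<le> aff_dim (?S ` J)" using K(1) by (intro aff_dim_subset image_mono)
      ultimately show False using a j by simp
    qed
    then show "card J = Suc j" using small[OF J] a by simp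
  next
    assume "card J = Suc j"
    then show "aff_dim (?S ` J) = int j" using small[OF J] j by simp
  qed
  have "face_indices n x J \<longleftrightarrow> \<not> absorbed {0} x n J" if card: "card J = Suc j"
  proof
    assume fi: "face_indices n x J"
    show "\<not> absorbed {0} x n J"
    proof
      assume "absorbed {0} x n J"
      then obtain l :: "nat \<Rightarrow> real" where l: "\<exists>i\<le>n. l i \<noteq> 0" "(\<Sum>i\<le>n. l i) = 0" "\<forall>i\<in>{..n} - J. 0 \<le> l i"
        "(\<Sum>i\<le>n. l i *\<^sub>R ?S i) = 0" unfolding absorbed_def by blast
      have off: "l i = 0" if "i \<in> {..n} - J" for i by (rule face_indices_zero[OF fi l(2-4) that])
      have 1: "sum l J = 0" unfolding l(2)[symmetric] using J off by (intro sum.mono_neutral_left) auto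
      have 2: "(\<Sum>i\<in>J. l i *\<^sub>R ?S i) = 0" unfolding l(4)[symmetric] using J off by (intro sum.mono_neutral_left) auto
      have "card J \<le> Suc d" using card j by simp
      from general_position_affine_independent[OF gp J this 1 2] off l(1) show False by auto
    qed
  next
    assume na: "\<not> absorbed {0} x n J"
    show "face_indices n x J" unfolding face_indices_def
    proof
      assume "\<exists>l :: nat \<Rightarrow> real. (\<Sum>i\<le>n. l i) = 0 \<and> (\<forall>i\<in>{..n} - J. 0 \<le> l i) \<and> (\<Sum>i\<in>{..n} - J. l i) = 1 \<and>
        (\<Sum>i\<le>n. l i *\<^sub>R ?S i) = 0"
      then obtain l :: "nat \<Rightarrow> real" where l: "(\<Sum>i\<in>{..n} - J. l i) = 1" "(\<Sum>i\<le>n. l i) = 0" "\<forall>i\<in>{..n} - J. 0 \<le> l i"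
        "(\<Sum>i\<le>n. l i *\<^sub>R ?S i) = 0" by blast
      have "\<exists>i\<le>n. l i \<noteq> 0"
      proof (rule ccontr)
        assume "\<not> (\<exists>i\<le>n. l i \<noteq> 0)"
        then have "(\<Sum>i\<in>{..n} - J. l i) = 0" by (intro sum.neutral) auto
        with l(1) show False by simp
      qed
      with l(2-4) na show False unfolding absorbed_def by blast
    qed
  qed
  with dim show ?thesis by blast
qed

lemma meets_tangent_iff_absorbed:
  assumes "\<not> absorbed {0} x n J"
  shows "meets_tangent W n x J \<longleftrightarrow> absorbed W x n J"
proof
  assume "meets_tangent W n x J"
  then obtain l :: "nat \<Rightarrow> real" where l: "(\<Sum>i\<le>n. l i) = 0" "\<forall>i\<in>{..n} - J. 0 \<le> l i"
    "walk_comb n x l \<in> W" "walk_comb n x l \<noteq> 0"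
    unfolding meets_tangent_def by blast
  have "\<exists>i\<le>n. l i \<noteq> 0"
  proof (rule ccontr)
    assume "\<not> (\<exists>i\<le>n. l i \<noteq> 0)"
    then have "walk_comb n x l = 0" by (intro sum.neutral) auto
    with l(4) show False by contradiction
  qed
  with l(1-3) show "absorbed W x n J" unfolding absorbed_def by blast
next
  assume "absorbed W x n J"
  then obtain l :: "nat \<Rightarrow> real" where l: "\<exists>i\<le>n. l i \<noteq> 0" "(\<Sum>i\<le>n. l i) = 0" "\<forall>i\<in>{..n} - J. 0 \<le> l i"
    "walk_comb n x l \<in> W" unfolding absorbed_def by blast
  with assms have "walk_comb n x l \<noteq> 0" unfolding absorbed_def by blast
  with l(2-4) show "meets_tangent W n x J" unfolding meets_tangent_def by blast
qed

text \<open>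
  A point of the relative interior can be moved slightly beyond itself, away from the barycentre, so
  it is a mixture of the barycentre, all of whose weights are positive, and another point of the hull.
\<close>

lemma rel_interior_positive_weights:
  fixes S :: "'i \<Rightarrow> 'a::euclidean_space"
  assumes I: "finite I" "I \<noteq> {}" and f: "f \<in> rel_interior (convex hull (S ` I))"
  obtains m where "\<forall>i\<in>I. 0 < m i" "sum m I = 1" "f = (\<Sum>i\<in>I. m i *\<^sub>R S i)"
proof -
  let ?N = "real (card I)"
  have N: "0 < ?N" using I by (simp add: card_gt_0_iff)
  define a where "a = (\<Sum>i\<in>I. (1 / ?N) *\<^sub>R S i)"
  have "a \<in> convex hull (S ` I)"
    unfolding a_def using N I(1) by (intro convex_sum convex_convex_hull) (auto intro: hull_inc)
  moreover have "convex hull (S ` I) \<noteq> {}" using I(2) by simp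
  ultimately obtain e where e: "1 < e" "(1 - e) *\<^sub>R a + e *\<^sub>R f \<in> convex hull (S ` I)"
    using convex_rel_interior_iff[OF convex_convex_hull, of "S ` I" f] f by blast
  then obtain u where u: "\<forall>i\<in>I. 0 \<le> u i" "sum u I = 1" "(1 - e) *\<^sub>R a + e *\<^sub>R f = (\<Sum>i\<in>I. u i *\<^sub>R S i)"
    unfolding convex_hull_image_eq[OF I(1)] by blast
  define m where "m i = (u i + (e - 1) / ?N) / e" for i
  show thesis
  proof (rule that)
    show "\<forall>i\<in>I. 0 < m i"
      using u(1) e(1) N by (simp add: m_def add_nonneg_pos)
    have "sum m I = (sum u I + (\<Sum>i\<in>I. (e - 1) / ?N)) / e"
      by (simp add: m_def sum_divide_distrib[symmetric] sum.distrib)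
    also have "\<dots> = 1" using u(2) e(1) N by simp
    finally show "sum m I = 1" .
    have "e *\<^sub>R f = (\<Sum>i\<in>I. u i *\<^sub>R S i) + (e - 1) *\<^sub>R a"
      using u(3) by (simp add: algebra_simps)
    also have "\<dots> = (\<Sum>i\<in>I. (u i + (e - 1) / ?N) *\<^sub>R S i)"
      by (simp add: a_def scaleR_sum_right scaleR_add_left sum.distrib)
    finally have "(1 / e) *\<^sub>R (e *\<^sub>R f) = (1 / e) *\<^sub>R (\<Sum>i\<in>I. (u i + (e - 1) / ?N) *\<^sub>R S i)" by simp
    then show "f = (\<Sum>i\<in>I. m i *\<^sub>R S i)"
      using e(1) by (simp add: m_def scaleR_sum_right)
  qed
qed

text \<open>
  A base point with positive weights on I can absorb small negative weights on I, so that exactly the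
  signs off I matter, whichever base point in the relative interior is used.
\<close>

lemma tangent_cone_meets_iff:
  fixes x :: "nat \<Rightarrow> real^'d"
  assumes I: "I \<subseteq> {..n}" "I \<noteq> {}" and W: "subspace W"
  shows "W \<inter> tangent_cone (convex hull (partial_sum x ` I)) (convex hull (partial_sum x ` {..n})) \<noteq> {0}
     \<longleftrightarrow> meets_tangent W n x I"
proof -
  let ?S = "partial_sum x"
  have finI: "finite I" using I finite_subset by blast
  define f where "f = (SOME y. y \<in> rel_interior (convex hull (?S ` I)))"
  have "rel_interior (convex hull (?S ` I)) \<noteq> {}"
    using I(2) by (simp add: rel_interior_eq_empty)
  then have f: "f \<in> rel_interior (convex hull (?S ` I))" unfolding f_def by (simp add: some_in_eq)
  obtain u where u: "\<forall>i\<in>I. 0 < u i" "sum u I = 1" "f = (\<Sum>i\<in>I. u i *\<^sub>R ?S i)"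
    by (rule rel_interior_positive_weights[OF finI I(2) f])
  define m where "m i = (if i \<in> I then u i else 0)" for i
  have m1: "(\<Sum>i\<le>n. m i) = 1"
    using u(2) extend_combination(2)[OF I(1), of u] by (simp add: m_def)
  have mf: "(\<Sum>i\<le>n. m i *\<^sub>R ?S i) = f"
    using u(3) extend_combination(1)[OF I(1), of u ?S] by (simp add: m_def)
  have mpos: "0 < m i" if "i \<in> I" for i using u(1) that by (simp add: m_def)
  have mnn: "0 \<le> m i" for i using mpos[of i] by (cases "i \<in> I") (auto simp: m_def)
  have T: "tangent_cone (convex hull (?S ` I)) (convex hull (?S ` {..n}))
      = {v. \<exists>\<epsilon>>0. f + \<epsilon> *\<^sub>R v \<in> convex hull (?S ` {..n})}"
    unfolding tangent_cone_def f_def by simp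
  have "f \<in> convex hull (?S ` {..n})"
    unfolding convex_hull_image_eq[OF finite_atMost]
    using m1 mf mnn by (intro CollectI exI[of _ m] conjI ballI) simp_all
  then have "0 \<in> tangent_cone (convex hull (?S ` I)) (convex hull (?S ` {..n}))"
    unfolding T by (auto intro: exI[of _ 1])
  then have "W \<inter> tangent_cone (convex hull (?S ` I)) (convex hull (?S ` {..n})) \<noteq> {0} \<longleftrightarrow>
     (\<exists>v\<in>W. v \<noteq> 0 \<and> (\<exists>\<epsilon>>0. f + \<epsilon> *\<^sub>R v \<in> convex hull (?S ` {..n})))"
    using subspace_0[OF W] unfolding T by blast
  also have "\<dots> \<longleftrightarrow> meets_tangent W n x I"
  proof
    assume "\<exists>v\<in>W. v \<noteq> 0 \<and> (\<exists>\<epsilon>>0. f + \<epsilon> *\<^sub>R v \<in> convex hull (?S ` {..n}))"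
    then obtain v \<epsilon> where v: "v \<in> W" "v \<noteq> 0" "0 < \<epsilon>" "f + \<epsilon> *\<^sub>R v \<in> convex hull (?S ` {..n})" by blast
    from v(4) obtain \<alpha> where \<alpha>: "\<forall>i\<in>{..n}. 0 \<le> \<alpha> i" "sum \<alpha> {..n} = 1" "f + \<epsilon> *\<^sub>R v = (\<Sum>i\<le>n. \<alpha> i *\<^sub>R ?S i)"
      unfolding convex_hull_image_eq[OF finite_atMost] by blast
    have comb: "(\<Sum>i\<le>n. (\<alpha> i - m i) *\<^sub>R ?S i) = \<epsilon> *\<^sub>R v"
      using \<alpha>(3)[symmetric] mf by (simp add: scaleR_diff_left sum_subtractf)
    have "(\<Sum>i\<le>n. \<alpha> i - m i) = 0" using \<alpha>(2) m1 by (simp add: sum_subtractf)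
    moreover have "\<forall>i\<in>{..n} - I. 0 \<le> \<alpha> i - m i" using \<alpha>(1) by (simp add: m_def)
    moreover have "(\<Sum>i\<le>n. (\<alpha> i - m i) *\<^sub>R ?S i) \<in> W - {0}"
      unfolding comb using v(1-3) W by (simp add: subspace_scale)
    ultimately show "meets_tangent W n x I"
      unfolding meets_tangent_def by (intro exI[of _ "\<lambda>i. \<alpha> i - m i"] conjI)
  next
    assume "meets_tangent W n x I"
    then obtain l :: "nat \<Rightarrow> real" where l: "(\<Sum>i\<le>n. l i *\<^sub>R ?S i) \<noteq> 0" "(\<Sum>i\<le>n. l i) = 0" "\<forall>i\<in>{..n} - I. 0 \<le> l i"
      "(\<Sum>i\<le>n. l i *\<^sub>R ?S i) \<in> W" unfolding meets_tangent_def by blast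
    define v where "v = (\<Sum>i\<le>n. l i *\<^sub>R ?S i)"
    have "v \<noteq> 0" using l(1) unfolding v_def .
    have "\<forall>\<^sub>F \<epsilon> in at_right 0. \<forall>i\<in>I. 0 + \<epsilon> * 0 < m i + \<epsilon> * l i"
      using mpos finI by (intro eventually_ball_finite ballI eventually_perturbed_less) auto
    moreover have "\<forall>\<^sub>F \<epsilon> in at_right (0::real). 0 < \<epsilon>" by (simp add: eventually_at_right_less)
    ultimately have "\<forall>\<^sub>F \<epsilon> in at_right 0. 0 < \<epsilon> \<and> (\<forall>i\<in>I. 0 < m i + \<epsilon> * l i)"
      by eventually_elim simp
    from eventually_happens'[OF trivial_limit_at_right_real this]
    obtain \<epsilon> :: real where \<epsilon>: "0 < \<epsilon>" "\<And>i. i \<in> I \<Longrightarrow> 0 < m i + \<epsilon> * l i" by blast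
    have "0 \<le> m i + \<epsilon> * l i" if "i \<in> {..n}" for i
      using \<epsilon>(2)[of i] \<epsilon>(1) l(3) that by (cases "i \<in> I") (auto simp: m_def)
    moreover have "(\<Sum>i\<le>n. m i + \<epsilon> * l i) = 1"
      using m1 l(2) by (simp add: sum.distrib sum_distrib_left[symmetric])
    moreover have "f + \<epsilon> *\<^sub>R v = (\<Sum>i\<le>n. (m i + \<epsilon> * l i) *\<^sub>R ?S i)"
      by (simp add: mf[symmetric] v_def scaleR_sum_right scaleR_add_left sum.distrib)
    ultimately have "f + \<epsilon> *\<^sub>R v \<in> convex hull (?S ` {..n})"
      unfolding convex_hull_image_eq[OF finite_atMost]
      by (intro CollectI exI[of _ "\<lambda>i. m i + \<epsilon> * l i"] conjI ballI)
    with \<open>v \<noteq> 0\<close> \<epsilon>(1) l(4) show "\<exists>v\<in>W. v \<noteq> 0 \<and> (\<exists>\<epsilon>>0. f + \<epsilon> *\<^sub>R v \<in> convex hull (?S ` {..n}))"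
      unfolding v_def by blast
  qed
  finally show ?thesis .
qed

theorem sum_grassmann_angles:
  fixes x :: "nat \<Rightarrow> real^'d"
  shows "(\<Sum>F\<in>faces j (convex hull (partial_sum x ` {..n})).
            grassmann_angle k (tangent_cone F (convex hull (partial_sum x ` {..n}))))
       = (\<Sum>J\<in>Pow {..n}. of_bool (face_indices n x J \<and> aff_dim (partial_sum x ` J) = int j) *
            measure (uniform_grassmannian (CARD('d) - k)) {W \<in> grassmannian (CARD('d) - k). meets_tangent W n x J})"
proof -
  let ?Q = "convex hull (partial_sum x ` {..n})"
  let ?J = "{J. J \<subseteq> {..n} \<and> face_indices n x J \<and> aff_dim (partial_sum x ` J) = int j}"
  let ?m = "\<lambda>J. measure (uniform_grassmannian (CARD('d) - k)) {W \<in> grassmannian (CARD('d) - k). meets_tangent W n x J}"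
  have "(\<Sum>F\<in>faces j ?Q. grassmann_angle k (tangent_cone F ?Q))
      = (\<Sum>J\<in>?J. grassmann_angle k (tangent_cone (convex hull (partial_sum x ` J)) ?Q))"
    by (rule sum.reindex_bij_betw[OF bij_betw_faces, symmetric])
  also have "\<dots> = (\<Sum>J\<in>?J. ?m J)"
  proof (rule sum.cong[OF refl])
    fix J assume J: "J \<in> ?J"
    then have "J \<noteq> {}" by auto
    with J have "{W \<in> grassmannian (CARD('d) - k). W \<inter> tangent_cone (convex hull (partial_sum x ` J)) ?Q \<noteq> {0}}
        = {W \<in> grassmannian (CARD('d) - k). meets_tangent W n x J}"
      using tangent_cone_meets_iff[of J n _ x] unfolding grassmannian_def by blast
    then show "grassmann_angle k (tangent_cone (convex hull (partial_sum x ` J)) ?Q) = ?m J"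
      unfolding grassmann_angle_def by simp
  qed
  also have "\<dots> = (\<Sum>J\<in>Pow {..n}. of_bool (face_indices n x J \<and> aff_dim (partial_sum x ` J) = int j) * ?m J)"
    by (intro sum.mono_neutral_cong_left) auto
  finally show ?thesis .
qed

theorem sum_grassmann_angles_general_position:
  fixes x :: "nat \<Rightarrow> real^'d"
  assumes gp: "in_general_position d {0} {..n} x" and j: "j < d"
  shows "(\<Sum>J\<in>Pow {..n}. of_bool (face_indices n x J \<and> aff_dim (partial_sum x ` J) = int j) *
            measure \<mu> {W \<in> grassmannian m. meets_tangent W n x J})
       = (\<Sum>I | I \<subseteq> {..n} \<and> card I = Suc j. of_bool (\<not> absorbed {0} x n I) *
            measure \<mu> {W \<in> grassmannian m. absorbed W x n I})"
proof (rule sum.mono_neutral_cong_right)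
  show "{I. I \<subseteq> {..n} \<and> card I = Suc j} \<subseteq> Pow {..n}" by blast
  show "\<forall>J\<in>Pow {..n} - {I. I \<subseteq> {..n} \<and> card I = Suc j}.
      of_bool (face_indices n x J \<and> aff_dim (partial_sum x ` J) = int j) * measure \<mu> {W \<in> grassmannian m. meets_tangent W n x J} = 0"
    using face_indices_iff_not_absorbed[OF gp j] by auto
  fix I assume "I \<in> {I. I \<subseteq> {..n} \<and> card I = Suc j}"
  then have I: "I \<subseteq> {..n}" "card I = Suc j" by simp_all
  have "(face_indices n x I \<and> aff_dim (partial_sum x ` I) = int j) \<longleftrightarrow> \<not> absorbed {0} x n I"
    using face_indices_iff_not_absorbed[OF gp j I(1)] I(2) by blast
  then show "of_bool (face_indices n x I \<and> aff_dim (partial_sum x ` I) = int j) * measure \<mu> {W \<in> grassmannian m. meets_tangent W n x I}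
      = of_bool (\<not> absorbed {0} x n I) * measure \<mu> {W \<in> grassmannian m. absorbed W x n I}"
    by (cases "absorbed {0} x n I") (simp_all add: meets_tangent_iff_absorbed)
qed simp

section \<open>Orthogonal projections and rotation invariance\<close>

lemma nn_integral_lborel_translate:
  fixes f :: "'a::euclidean_space \<Rightarrow> ennreal"
  assumes "f \<in> borel_measurable borel"
  shows "(\<integral>\<^sup>+ y. f (c + y) \<partial>lborel) = (\<integral>\<^sup>+ y. f y \<partial>lborel)"
proof -
  have "(\<integral>\<^sup>+ y. f y \<partial>lborel) = (\<integral>\<^sup>+ y. f y \<partial>distr lborel borel ((+) c))"
    by (simp only: lborel_distr_plus)
  also have "\<dots> = (\<integral>\<^sup>+ y. f (c + y) \<partial>lborel)"
    using assms by (subst nn_integral_distr) auto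
  finally show ?thesis ..
qed

text \<open>
  The image of Lebesgue measure under an isometry is translation invariant, and two such measures
  are proportional: with A the unit ball, integrate the indicator of A at x times that of B at x + T y
  over x and y in both orders. Since T maps A onto itself, the factor of proportionality is 1.
\<close>

lemma emeasure_lborel_orthogonal_vimage:
  fixes T :: "'a::euclidean_space \<Rightarrow> 'a"
  assumes T: "orthogonal_transformation T" and B: "B \<in> sets borel"
  shows "emeasure lborel (T -` B) = emeasure lborel B"
proof -
  have lin: "linear T" by (rule orthogonal_transformation_linear[OF T])
  have [measurable]: "T \<in> borel_measurable borel"
    by (intro borel_measurable_continuous_onI linear_continuous_on) (use lin in \<open>simp add: linear_conv_bounded_linear\<close>)
  have Tinv: "T (inv T x) = x" for x
    by (rule surj_f_inv_f[OF orthogonal_transformation_surj[OF T]])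
  have norm: "norm (x - T y) = norm (inv T x - y)" for x y
  proof -
    have "norm (inv T x - y) = norm (T (inv T x - y))" by (rule orthogonal_transformation_norm[OF T, symmetric])
    then show ?thesis by (simp add: linear_diff[OF lin] Tinv)
  qed
  have norm': "norm (T y - x) = norm (inv T x - y)" for x y
    using norm[of x y] by (simp add: norm_minus_commute)
  let ?A = "ball (0::'a) 1"
  define fA fB :: "'a \<Rightarrow> ennreal" where "fA = indicator ?A" and "fB = indicator B"
  have [measurable]: "fA \<in> borel_measurable borel" "fB \<in> borel_measurable borel"
    unfolding fA_def fB_def using B by (auto intro!: borel_measurable_indicator)
  have intA: "(\<integral>\<^sup>+x. fA x \<partial>lborel) = emeasure lborel ?A" and intB: "(\<integral>\<^sup>+x. fB x \<partial>lborel) = emeasure lborel B"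
    unfolding fA_def fB_def using B by simp_all
  have TB: "T -` B \<in> sets borel" using measurable_sets_borel[OF _ B, of T] by simp
  have "emeasure lborel ?A * emeasure lborel (T -` B) = (\<integral>\<^sup>+x. fA x * emeasure lborel (T -` B) \<partial>lborel)"
    by (simp add: nn_integral_multc intA)
  also have "\<dots> = (\<integral>\<^sup>+x. (\<integral>\<^sup>+y. fA x * fB (x + T y) \<partial>lborel) \<partial>lborel)"
  proof (rule nn_integral_cong)
    fix x :: 'a
    have "emeasure lborel (T -` B) = (\<integral>\<^sup>+y. fB (T y) \<partial>lborel)"
    proof -
      have "(\<integral>\<^sup>+y. fB (T y) \<partial>lborel) = (\<integral>\<^sup>+y. indicator (T -` B) y \<partial>lborel)"
        by (intro nn_integral_cong) (simp add: fB_def indicator_def)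
      also have "\<dots> = emeasure lborel (T -` B)" by (rule nn_integral_indicator) (simp add: TB)
      finally show ?thesis ..
    qed
    also have "\<dots> = (\<integral>\<^sup>+y. fB (T (inv T x + y)) \<partial>lborel)"
      by (rule nn_integral_lborel_translate[symmetric]) measurable
    also have "\<dots> = (\<integral>\<^sup>+y. fB (x + T y) \<partial>lborel)"
      by (simp add: linear_add[OF lin] Tinv)
    finally show "fA x * emeasure lborel (T -` B) = (\<integral>\<^sup>+y. fA x * fB (x + T y) \<partial>lborel)"
      by (simp add: nn_integral_cmult intB)
  qed
  also have "\<dots> = (\<integral>\<^sup>+y. (\<integral>\<^sup>+x. fA x * fB (x + T y) \<partial>lborel) \<partial>lborel)"
    by (rule lborel_pair.Fubini'[symmetric]) measurable
  also have "\<dots> = (\<integral>\<^sup>+y. (\<integral>\<^sup>+x. fA (x - T y) * fB x \<partial>lborel) \<partial>lborel)"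
  proof (rule nn_integral_cong)
    fix y :: 'a
    have "(\<integral>\<^sup>+x. fA x * fB (x + T y) \<partial>lborel) = (\<integral>\<^sup>+x. fA (- T y + x) * fB (- T y + x + T y) \<partial>lborel)"
      using nn_integral_lborel_translate[of "\<lambda>x. fA x * fB (x + T y)" "- T y"] by simp
    then show "(\<integral>\<^sup>+x. fA x * fB (x + T y) \<partial>lborel) = (\<integral>\<^sup>+x. fA (x - T y) * fB x \<partial>lborel)"
      by simp
  qed
  also have "\<dots> = (\<integral>\<^sup>+x. (\<integral>\<^sup>+y. fA (x - T y) * fB x \<partial>lborel) \<partial>lborel)"
    by (rule lborel_pair.Fubini') measurable
  also have "\<dots> = (\<integral>\<^sup>+x. emeasure lborel ?A * fB x \<partial>lborel)"
  proof (rule nn_integral_cong)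
    fix x :: 'a
    have "(\<integral>\<^sup>+y. fA (x - T y) \<partial>lborel) = (\<integral>\<^sup>+y. indicator (ball (inv T x) 1) y \<partial>lborel)"
      by (intro nn_integral_cong) (simp add: fA_def indicator_def norm' dist_norm)
    also have "\<dots> = (\<integral>\<^sup>+y. indicator (ball (inv T x) 1) (inv T x + y) \<partial>lborel)"
      by (rule nn_integral_lborel_translate[symmetric]) (auto intro!: borel_measurable_indicator)
    also have "\<dots> = (\<integral>\<^sup>+y. fA y \<partial>lborel)"
      by (intro nn_integral_cong) (simp add: fA_def indicator_def dist_norm)
    finally have "(\<integral>\<^sup>+y. fA (x - T y) \<partial>lborel) = emeasure lborel ?A" by (simp add: intA)
    then show "(\<integral>\<^sup>+y. fA (x - T y) * fB x \<partial>lborel) = emeasure lborel ?A * fB x"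
      by (simp add: nn_integral_multc)
  qed
  also have "\<dots> = emeasure lborel ?A * emeasure lborel B"
    by (simp add: nn_integral_cmult intB)
  finally have "emeasure lborel ?A * emeasure lborel (T -` B) = emeasure lborel ?A * emeasure lborel B" .
  moreover have "emeasure lborel ?A \<noteq> top" using emeasure_lborel_ball_finite[of "0::'a" 1] by simp
  moreover have "emeasure lborel ?A \<noteq> 0"
    using open_not_negligible[of ?A] by (auto simp: negligible_iff_null_sets null_sets_def emeasure_completion)
  ultimately show ?thesis by (simp add: ennreal_mult_cancel_left)
qed

lemma closest_point_subspace_eqI:
  fixes W :: "'a::euclidean_space set"
  assumes W: "subspace W" and w: "w \<in> W" and orth: "\<And>y. y \<in> W \<Longrightarrow> (x - w) \<bullet> y = 0"
  shows "closest_point W x = w"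
proof (rule closest_point_unique[symmetric])
  show "convex W" "closed W" using W by (simp_all add: subspace_imp_convex closed_subspace)
  show "\<forall>z\<in>W. dist x w \<le> dist x z"
  proof
    fix z assume z: "z \<in> W"
    have "w - z \<in> W" using W w z by (rule subspace_diff)
    then have "(x - w) \<bullet> (w - z) = 0" by (rule orth)
    then have "(norm (x - z))\<^sup>2 = (norm (x - w))\<^sup>2 + (norm (w - z))\<^sup>2"
      using norm_add_Pythagorean[of "x - w" "w - z"] by (simp add: orthogonal_def)
    then have "(norm (x - w))\<^sup>2 \<le> (norm (x - z))\<^sup>2" by simp
    then show "dist x w \<le> dist x z" unfolding dist_norm by (rule power2_le_imp_le) simp
  qed
qed fact

lemma closest_point_subspace:
  fixes W :: "'a::euclidean_space set"
  assumes W: "subspace W"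
  shows "closest_point W x \<in> W" and "y \<in> W \<Longrightarrow> (x - closest_point W x) \<bullet> y = 0"
proof -
  obtain p q where pq: "p \<in> span W" "\<And>w. w \<in> span W \<Longrightarrow> orthogonal q w" "x = p + q"
    using orthogonal_subspace_decomp_exists[of W x] by blast
  have sp: "span W = W" using W by (simp add: span_eq_iff)
  have cp: "closest_point W x = p"
  proof (rule closest_point_subspace_eqI[OF W])
    show "p \<in> W" using pq(1) sp by simp
    show "(x - p) \<bullet> y = 0" if "y \<in> W" for y
      using pq(2)[of y] pq(3) that sp by (simp add: orthogonal_def)
  qed
  show "closest_point W x \<in> W" using cp pq(1) sp by simp
  show "y \<in> W \<Longrightarrow> (x - closest_point W x) \<bullet> y = 0"
    using cp pq(2)[of y] pq(3) sp by (simp add: orthogonal_def)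
qed

lemma linear_closest_point_subspace:
  fixes W :: "'a::euclidean_space set"
  assumes W: "subspace W"
  shows "linear (closest_point W)"
proof (rule linearI)
  note cp = closest_point_subspace[OF W]
  fix x y :: 'a and c :: real
  show "closest_point W (x + y) = closest_point W x + closest_point W y"
  proof (rule closest_point_subspace_eqI[OF W])
    show "closest_point W x + closest_point W y \<in> W" by (intro subspace_add W cp)
    show "(x + y - (closest_point W x + closest_point W y)) \<bullet> z = 0" if "z \<in> W" for z
      using cp(2)[OF that, of x] cp(2)[OF that, of y] by (simp add: algebra_simps inner_diff_left inner_add_left)
  qed
  show "closest_point W (c *\<^sub>R x) = c *\<^sub>R closest_point W x"
  proof (rule closest_point_subspace_eqI[OF W])
    show "c *\<^sub>R closest_point W x \<in> W" by (intro subspace_scale W cp)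
    show "(c *\<^sub>R x - c *\<^sub>R closest_point W x) \<bullet> z = 0" if "z \<in> W" for z
      using cp(2)[OF that, of x] by (simp add: scaleR_diff_right[symmetric])
  qed
qed

abbreviation proj_matrix :: "(real^'d) set \<Rightarrow> real^'d^'d" where
  "proj_matrix W \<equiv> matrix (closest_point W)"

lemma proj_matrix_works: "subspace W \<Longrightarrow> proj_matrix W *v x = closest_point W x"
  using matrix_vector_mul(2)[OF linear_closest_point_subspace] by metis

lemma mem_subspace_iff_proj:
  assumes "subspace W"
  shows "x \<in> W \<longleftrightarrow> proj_matrix W *v x = x"
  using closest_point_subspace(1)[OF assms, of x] closest_point_subspace_eqI[OF assms, of x x]
  by (auto simp: proj_matrix_works[OF assms])

lemma closest_point_orthogonal_image:
  fixes W :: "'a::euclidean_space set"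
  assumes W: "subspace W" and g: "orthogonal_transformation (g :: 'a \<Rightarrow> 'a)"
  shows "closest_point (g ` W) x = g (closest_point W (inv g x))"
proof (rule closest_point_subspace_eqI)
  have lin: "linear g" by (rule orthogonal_transformation_linear[OF g])
  show "subspace (g ` W)" by (rule linear_subspace_image[OF lin W])
  show "g (closest_point W (inv g x)) \<in> g ` W" using closest_point_subspace(1)[OF W] by blast
  fix y assume "y \<in> g ` W"
  then obtain w where w: "w \<in> W" "y = g w" by blast
  have "g (inv g x) = x" by (rule surj_f_inv_f[OF orthogonal_transformation_surj[OF g]])
  then have "x - g (closest_point W (inv g x)) = g (inv g x - closest_point W (inv g x))"
    by (simp add: linear_diff[OF lin])
  then show "(x - g (closest_point W (inv g x))) \<bullet> y = 0"
    using g closest_point_subspace(2)[OF W w(1), of "inv g x"] by (simp add: w(2) orthogonal_transformation_def)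
qed

lemma proj_matrix_orthogonal_image:
  assumes W: "subspace W" and g: "orthogonal_transformation (g :: real^'d \<Rightarrow> real^'d)"
  shows "proj_matrix (g ` W) = matrix g ** proj_matrix W ** matrix (inv g)"
proof -
  have "linear g" "linear (inv g)"
    using orthogonal_transformation_linear orthogonal_transformation_inv g by blast+
  moreover have "closest_point (g ` W) = g \<circ> closest_point W \<circ> inv g"
    using closest_point_orthogonal_image[OF W g] by (simp add: fun_eq_iff)
  ultimately show ?thesis
    using linear_closest_point_subspace[OF W] by (simp add: matrix_compose linear_compose)
qed

lemma borel_measurable_matrixI:
  fixes f :: "'a \<Rightarrow> real^'n^'m"
  assumes "\<And>i j. (\<lambda>x. f x $ i $ j) \<in> borel_measurable M"
  shows "f \<in> borel_measurable M"
proof (rule borel_measurable_euclidean_space[THEN iffD2], rule ballI)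
  fix b :: "real^'n^'m" assume "b \<in> Basis"
  then obtain i j where "b = axis i (axis j 1)" by (auto simp: Basis_vec_def)
  then have "(\<lambda>x. f x \<bullet> b) = (\<lambda>x. f x $ i $ j)" by (simp add: fun_eq_iff inner_axis)
  with assms show "(\<lambda>x. f x \<bullet> b) \<in> borel_measurable M" by simp
qed

lemma borel_measurable_matrix_entry [measurable]:
  "(\<lambda>A :: real^'n^'m. A $ i $ j) \<in> borel_measurable borel"
  by (intro borel_measurable_continuous_onI continuous_intros)

text \<open>
  One step of Gram-Schmidt. If v lies in the span of S, then w v = 0 and the added term is 0, since
  division by zero gives zero.
\<close>

lemma closest_point_span_insert:
  fixes S :: "'a::euclidean_space set"
  defines "w v \<equiv> v - closest_point (span S) v"
  shows "closest_point (span (insert v S)) x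
       = closest_point (span S) x + ((w v \<bullet> x) / (w v \<bullet> w v)) *\<^sub>R w v"
proof (rule closest_point_subspace_eqI)
  let ?c = "closest_point (span S)"
  note cp = closest_point_subspace[OF subspace_span[of S]]
  have sub: "span S \<subseteq> span (insert v S)" by (rule span_mono) auto
  have wv: "w v \<in> span (insert v S)"
    unfolding w_def by (intro span_diff) (use sub cp(1)[of v] span_base[of v "insert v S"] in auto)
  have worth: "w v \<bullet> y = 0" if "y \<in> span S" for y unfolding w_def by (rule cp(2)[OF that])
  show "?c x + ((w v \<bullet> x) / (w v \<bullet> w v)) *\<^sub>R w v \<in> span (insert v S)"
    using sub cp(1)[of x] wv by (intro span_add span_scale) auto
  show "subspace (span (insert v S))" by (rule subspace_span)
  define r where "r = x - (?c x + ((w v \<bullet> x) / (w v \<bullet> w v)) *\<^sub>R w v)"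
  have rS: "r \<bullet> y = 0" if "y \<in> span S" for y
    using cp(2)[OF that, of x] worth[OF that]
    by (simp add: r_def inner_diff_left inner_add_left)
  have "r \<bullet> w v = 0"
  proof (cases "w v = 0")
    case False
    have "?c x \<bullet> w v = 0" using worth[OF cp(1)] by (simp add: inner_commute)
    with False show ?thesis by (simp add: r_def inner_diff_left inner_add_left inner_commute[of x])
  qed simp
  moreover have "v = w v + ?c v" by (simp add: w_def)
  ultimately have rv: "r \<bullet> v = 0" using rS[OF cp(1), of v] by (metis inner_add_right add_0)
  fix y assume "y \<in> span (insert v S)"
  then obtain k where k: "y - k *\<^sub>R v \<in> span S" by (auto simp: span_insert)
  have "r \<bullet> y = r \<bullet> (y - k *\<^sub>R v) + k * (r \<bullet> v)" by (simp add: inner_diff_right)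
  then show "(x - (?c x + ((w v \<bullet> x) / (w v \<bullet> w v)) *\<^sub>R w v)) \<bullet> y = 0"
    using rS[OF k] rv by (simp add: r_def[symmetric])
qed

text \<open>
  Gram-Schmidt expresses the projection by arithmetic operations, which are Borel measurable also
  where rows become dependent and continuity fails.
\<close>

lemma measurable_proj_matrix_span_rows:
  assumes "finite R"
  shows "(\<lambda>A :: real^'d^'d. proj_matrix (span ((\<lambda>i. A $ i) ` R))) \<in> borel_measurable borel"
  using assms
proof (induction R rule: finite_induct)
  case empty
  show ?case by simp
next
  case (insert r R)
  define P where "P A = proj_matrix (span ((\<lambda>i. A $ i) ` R))" for A :: "real^'d^'d"
  have [measurable]: "P \<in> borel_measurable borel" using insert.IH by (simp add: P_def[abs_def])
  have Pij [measurable]: "(\<lambda>A. P A $ i $ j) \<in> borel_measurable borel" for i j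
    by measurable
  define w where "w A = A $ r - P A *v (A $ r)" for A :: "real^'d^'d"
  have wi [measurable]: "(\<lambda>A. w A $ i) \<in> borel_measurable borel" for i
    unfolding w_def matrix_vector_mult_def by simp
  have eq: "proj_matrix (span ((\<lambda>i. A $ i) ` insert r R)) $ i $ j
      = P A $ i $ j + w A $ j / (\<Sum>l\<in>UNIV. w A $ l * w A $ l) * w A $ i" for A i j
  proof -
    have w: "w A = A $ r - closest_point (span ((\<lambda>i. A $ i) ` R)) (A $ r)"
      unfolding w_def P_def by (simp add: proj_matrix_works[OF subspace_span])
    have "proj_matrix (span ((\<lambda>i. A $ i) ` insert r R)) $ i $ j
        = closest_point (span (insert (A $ r) ((\<lambda>i. A $ i) ` R))) (axis j 1) $ i"
      by (simp add: matrix_def)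
    also have "\<dots> = (closest_point (span ((\<lambda>i. A $ i) ` R)) (axis j 1)
        + ((w A \<bullet> axis j 1) / (w A \<bullet> w A)) *\<^sub>R w A) $ i"
      by (simp only: w closest_point_span_insert)
    also have "\<dots> = P A $ i $ j + w A $ j / (\<Sum>l\<in>UNIV. w A $ l * w A $ l) * w A $ i"
      by (simp add: P_def matrix_def inner_axis inner_vec_def[of "w A" "w A"])
    finally show ?thesis .
  qed
  show ?case
  proof (rule borel_measurable_matrixI)
    fix i j :: 'd
    have "(\<lambda>A. proj_matrix (span ((\<lambda>i. A $ i) ` insert r R)) $ i $ j)
        = (\<lambda>A. P A $ i $ j + w A $ j / (\<Sum>l\<in>UNIV. w A $ l * w A $ l) * w A $ i)"
      by (rule ext) (rule eq)
    moreover have "(\<lambda>A. P A $ i $ j + w A $ j / (\<Sum>l\<in>UNIV. w A $ l * w A $ l) * w A $ i) \<in> borel_measurable borel"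
      by measurable
    ultimately show "(\<lambda>A. proj_matrix (span ((\<lambda>i. A $ i) ` insert r R)) $ i $ j) \<in> borel_measurable borel"
      by simp
  qed
qed

lemma space_borel_grassmannian: "space (borel_grassmannian m) = grassmannian m"
  by (simp add: borel_grassmannian_def)

lemma measurable_proj_matrix: "proj_matrix \<in> borel_measurable (borel_grassmannian m)"
  unfolding borel_grassmannian_def by (rule measurable_vimage_algebra1) simp

lemma measurable_into_borel_grassmannian:
  assumes "\<And>x. x \<in> space N \<Longrightarrow> f x \<in> grassmannian m" "(\<lambda>x. proj_matrix (f x)) \<in> borel_measurable N"
  shows "f \<in> measurable N (borel_grassmannian m)"
  unfolding borel_grassmannian_def using assms by (intro measurable_vimage_algebra2) auto

lemma measurable_orthogonal_image_grassmannian: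
  assumes g: "orthogonal_transformation (g :: real^'d \<Rightarrow> real^'d)"
  shows "(\<lambda>W. g ` W) \<in> measurable (borel_grassmannian m) (borel_grassmannian m)"
proof (rule measurable_into_borel_grassmannian)
  have lin: "linear g" by (rule orthogonal_transformation_linear[OF g])
  fix W :: "(real^'d) set" assume "W \<in> space (borel_grassmannian m)"
  then have "subspace W" "dim W = m" by (simp_all add: space_borel_grassmannian grassmannian_def)
  then show "g ` W \<in> grassmannian m"
    using linear_subspace_image[OF lin] dim_image_eq[OF lin, of W] orthogonal_transformation_inj[OF g]
    by (auto simp: grassmannian_def inj_on_def)
next
  note [measurable] = measurable_proj_matrix
  have "(\<lambda>W. proj_matrix (g ` W)) \<in> borel_measurable (borel_grassmannian m) \<longleftrightarrow>
     (\<lambda>W. matrix g ** proj_matrix W ** matrix (inv g)) \<in> borel_measurable (borel_grassmannian m)"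
    by (intro measurable_cong proj_matrix_orthogonal_image g)
      (simp add: space_borel_grassmannian grassmannian_def)
  moreover have "(\<lambda>W. matrix g ** proj_matrix W ** matrix (inv g)) \<in> borel_measurable (borel_grassmannian m)"
  proof (rule borel_measurable_matrixI)
    fix i j
    have [measurable]: "(\<lambda>W. proj_matrix W $ p $ q) \<in> borel_measurable (borel_grassmannian m)" for p q :: 'd
      by (rule measurable_compose[OF measurable_proj_matrix borel_measurable_matrix_entry])
    show "(\<lambda>W. (matrix g ** proj_matrix W ** matrix (inv g)) $ i $ j) \<in> borel_measurable (borel_grassmannian m)"
      unfolding matrix_matrix_mult_def by simp
  qed
  ultimately show "(\<lambda>W. proj_matrix (g ` W)) \<in> borel_measurable (borel_grassmannian m)" by simp
qed

section \<open>The uniform distribution on the Grassmannian\<close>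

text \<open>
  Rotating all rows is itself an orthogonal transformation of the space of matrices, so it preserves
  Lebesgue measure there.
\<close>

definition apply_to_rows :: "(real^'d \<Rightarrow> real^'d) \<Rightarrow> real^'d^'d \<Rightarrow> real^'d^'d" where
  "apply_to_rows g A = (\<chi> i. g (A $ i))"

lemma orthogonal_apply_to_rows:
  assumes g: "orthogonal_transformation g"
  shows "orthogonal_transformation (apply_to_rows g)"
proof -
  have lin: "linear g" by (rule orthogonal_transformation_linear[OF g])
  have "linear (apply_to_rows g)"
    by (rule linearI) (simp_all add: apply_to_rows_def vec_eq_iff linear_add[OF lin] linear_cmul[OF lin])
  moreover have "apply_to_rows g A \<bullet> apply_to_rows g B = A \<bullet> B" for A B
    using g by (simp add: apply_to_rows_def inner_vec_def[of "_ :: real^'d^'d"] orthogonal_transformation_def)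
  ultimately show ?thesis by (simp add: orthogonal_transformation_def)
qed

lemma det_apply_to_rows_eq_0_iff:
  assumes g: "orthogonal_transformation g"
  shows "det (apply_to_rows g A) = 0 \<longleftrightarrow> det A = 0"
proof -
  have lin: "linear g" by (rule orthogonal_transformation_linear[OF g])
  have "apply_to_rows g A = A ** transpose (matrix g)"
  proof -
    have "g (A $ i) $ j = (\<Sum>k\<in>UNIV. A $ i $ k * matrix g $ j $ k)" for i j
    proof -
      have "g (A $ i) = matrix g *v (A $ i)" using matrix_vector_mul(2)[OF lin] by metis
      then show ?thesis by (simp add: matrix_vector_mult_def mult.commute)
    qed
    then show ?thesis by (simp add: vec_eq_iff apply_to_rows_def matrix_matrix_mult_def transpose_def)
  qed
  moreover have "det (matrix g) \<noteq> 0"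
    using g det_orthogonal_matrix[of "matrix g"] by (auto simp: orthogonal_transformation_matrix)
  ultimately show ?thesis by (simp add: det_mul)
qed

lemma span_rows_in_grassmannian:
  fixes A :: "real^'d^'d"
  assumes "det A \<noteq> 0"
  shows "span ((\<lambda>i. A $ i) ` R) \<in> grassmannian (card R)"
proof -
  have row: "row i A = A $ i" for i by (simp add: row_def vec_eq_iff)
  have inj: "inj_on (\<lambda>i. A $ i) R"
    using det_identical_rows[of _ _ A] assms by (auto simp: inj_on_def row)
  have "independent (rows A)"
    using det_dependent_rows[of A] assms by (auto simp: dependent_vec_eq)
  moreover have "(\<lambda>i. A $ i) ` R \<subseteq> rows A" by (auto simp: rows_def row)
  ultimately have "independent ((\<lambda>i. A $ i) ` R)" by (rule independent_mono)
  then show ?thesis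
    using card_image[OF inj] by (simp add: grassmannian_def dim_eq_card_independent)
qed

text \<open>
  Choose a matrix uniformly from the unit ball, conditioned on being invertible, and take the span
  of m of its rows. The law of the matrix is invariant under rotation of all rows, and this rotates the span.
\<close>

lemma exists_uniform_grassmannian:
  assumes m: "m \<le> CARD('d)"
  shows "\<exists>\<mu> :: (real^'d) set measure. is_uniform_grassmannian m \<mu>"
proof -
  obtain R :: "'d set" where R: "card R = m"
    using obtain_subset_with_card_n[of m "UNIV :: 'd set"] m by auto
  define Gl :: "(real^'d^'d) set" where "Gl = {A. norm A < 1 \<and> det A \<noteq> 0}"
  have "continuous_on UNIV (det :: real^'d^'d \<Rightarrow> real)"
    unfolding det_def by (intro continuous_intros)
  then have "open (det -` (- {0}) :: (real^'d^'d) set)"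
    by (intro open_vimage) auto
  then have "open (ball 0 1 \<inter> (det -` (- {0}) :: (real^'d^'d) set))" by (intro open_Int) auto
  also have "ball 0 1 \<inter> det -` (- {0}) = Gl" by (auto simp: Gl_def)
  finally have openGl: "open Gl" .
  have Gl_sets: "Gl \<in> sets lborel" using openGl by simp
  define c where "c = 1 / (1 + norm (mat 1 :: real^'d^'d))"
  have c: "0 < c" by (simp add: c_def add_pos_nonneg)
  have "matrix ((*\<^sub>R) c) = c *\<^sub>R (mat 1 :: real^'d^'d)"
    by (simp add: matrix_def mat_def vec_eq_iff axis_def)
  then have "det (c *\<^sub>R (mat 1 :: real^'d^'d)) = c ^ CARD('d)"
    using det_matrix_scaleR[of c, where 'n='d] by simp
  moreover have "norm (c *\<^sub>R (mat 1 :: real^'d^'d)) < 1"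
    by (simp add: c_def divide_less_eq add_pos_nonneg)
  ultimately have "c *\<^sub>R mat 1 \<in> Gl" unfolding Gl_def using c by simp
  then have ne: "Gl \<noteq> {}" by blast
  have fin: "emeasure lborel Gl \<noteq> \<infinity>"
  proof -
    have "emeasure lborel Gl \<le> emeasure lborel (ball 0 1 :: (real^'d^'d) set)"
      by (rule emeasure_mono) (auto simp: Gl_def)
    with emeasure_lborel_ball_finite[of "0 :: real^'d^'d" 1] show ?thesis by (auto simp: top_unique)
  qed
  have pos: "emeasure lborel Gl \<noteq> 0"
    using open_not_negligible[OF openGl ne] Gl_sets
    by (auto simp: negligible_iff_null_sets null_sets_def emeasure_completion)
  define N where "N = uniform_measure lborel Gl"
  have N: "prob_space N" unfolding N_def by (rule prob_space_uniform_measure[OF pos fin])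
  have setsN [measurable_cong]: "sets N = sets borel" by (simp add: N_def)
  have spaceN: "space N = UNIV" by (simp add: N_def)
  \<comment> \<open>The value for singular matrices is arbitrary, as the law gives them no mass.\<close>
  define V where "V A = (if det A \<noteq> 0 then span ((\<lambda>i. A $ i) ` R) else span ((\<lambda>i. (mat 1 :: real^'d^'d) $ i) ` R))"
    for A :: "real^'d^'d"
  have Vgr: "V A \<in> grassmannian m" for A
    using span_rows_in_grassmannian[of A R] span_rows_in_grassmannian[of "mat 1 :: real^'d^'d" R] R by (auto simp: V_def)
  have detm [measurable]: "(det :: real^'d^'d \<Rightarrow> real) \<in> borel_measurable borel"
    using \<open>continuous_on UNIV det\<close> by (rule borel_measurable_continuous_onI)
  have Vm: "V \<in> measurable N (borel_grassmannian m)"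
  proof (rule measurable_into_borel_grassmannian[OF Vgr])
    have "(\<lambda>A. proj_matrix (V A)) = (\<lambda>A. if det A \<noteq> 0 then proj_matrix (span ((\<lambda>i. A $ i) ` R))
        else proj_matrix (span ((\<lambda>i. (mat 1 :: real^'d^'d) $ i) ` R)))"
      by (auto simp: V_def fun_eq_iff)
    also have "\<dots> \<in> borel_measurable borel"
      using measurable_proj_matrix_span_rows[OF finite[of R]] by measurable
    finally show "(\<lambda>A. proj_matrix (V A)) \<in> borel_measurable N"
      by (subst measurable_cong_sets[OF setsN refl])
  qed
  define \<mu> where "\<mu> = distr N (borel_grassmannian m) V"
  have sets\<mu>: "sets \<mu> = sets (borel_grassmannian m)" by (simp add: \<mu>_def)
  have "distr \<mu> \<mu> (\<lambda>W. g ` W) = \<mu>" if g: "orthogonal_transformation g" for g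
  proof -
    let ?T = "apply_to_rows g"
    note T = orthogonal_apply_to_rows[OF g]
    have Tm: "?T \<in> measurable borel borel"
      using orthogonal_transformation_linear[OF T]
      by (intro borel_measurable_continuous_onI linear_continuous_on) (simp add: linear_conv_bounded_linear)
    have TN: "?T \<in> measurable N N" using Tm by (simp add: measurable_cong_sets[OF setsN setsN])
    have TGl: "?T -` Gl = Gl"
      by (auto simp: Gl_def orthogonal_transformation_norm[OF T] det_apply_to_rows_eq_0_iff[OF g])
    have inv: "distr N N ?T = N"
    proof (rule measure_eqI)
      fix X assume "X \<in> sets (distr N N ?T)"
      then have X: "X \<in> sets borel" using setsN by simp
      have TX: "?T -` X \<in> sets borel" using measurable_sets_borel[OF Tm X] by simp
      have "emeasure (distr N N ?T) X = emeasure N (?T -` X)"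
        using X setsN TN by (subst emeasure_distr) (auto simp: spaceN)
      also have "\<dots> = emeasure lborel (Gl \<inter> ?T -` X) / emeasure lborel Gl"
        unfolding N_def using Gl_sets TX by (intro emeasure_uniform_measure) auto
      also have "Gl \<inter> ?T -` X = ?T -` (Gl \<inter> X)" using TGl by blast
      also have "emeasure lborel (?T -` (Gl \<inter> X)) = emeasure lborel (Gl \<inter> X)"
        using Gl_sets X by (intro emeasure_lborel_orthogonal_vimage[OF T]) auto
      also have "emeasure lborel (Gl \<inter> X) / emeasure lborel Gl = emeasure N X"
        unfolding N_def using Gl_sets X by (intro emeasure_uniform_measure[symmetric]) auto
      finally show "emeasure (distr N N ?T) X = emeasure N X" .
    qed simp
    have gm: "(\<lambda>W. g ` W) \<in> measurable (borel_grassmannian m) (borel_grassmannian m)"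
      by (rule measurable_orthogonal_image_grassmannian[OF g])
    have "distr \<mu> \<mu> (\<lambda>W. g ` W) = distr \<mu> (borel_grassmannian m) (\<lambda>W. g ` W)"
      by (rule distr_cong) (simp_all add: sets\<mu>)
    also have "\<dots> = distr N (borel_grassmannian m) ((\<lambda>W. g ` W) \<circ> V)"
      unfolding \<mu>_def by (rule distr_distr[OF gm Vm])
    also have "\<dots> = distr N (borel_grassmannian m) (V \<circ> ?T)"
    proof (rule distr_cong_AE)
      have "AE A in N. A \<in> Gl"
        unfolding N_def by (rule AE_uniform_measureI[OF Gl_sets]) simp
      then show "AE A in N. ((\<lambda>W. g ` W) \<circ> V) A = (V \<circ> ?T) A"
      proof eventually_elim
        case (elim A)
        have "g ` span ((\<lambda>i. A $ i) ` R) = span (g ` (\<lambda>i. A $ i) ` R)"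
          by (rule linear_span_image[OF orthogonal_transformation_linear[OF g], symmetric])
        with elim show ?case
          by (simp add: V_def Gl_def det_apply_to_rows_eq_0_iff[OF g] image_image) (simp add: apply_to_rows_def)
      qed
    qed (use gm Vm TN in \<open>auto intro: measurable_comp\<close>)
    also have "\<dots> = distr (distr N N ?T) (borel_grassmannian m) V"
      by (rule distr_distr[OF Vm TN, symmetric])
    also have "\<dots> = \<mu>" by (simp add: inv \<mu>_def)
    finally show ?thesis .
  qed
  moreover have "prob_space \<mu>" unfolding \<mu>_def by (rule prob_space.prob_space_distr[OF N Vm])
  ultimately show ?thesis using sets\<mu> by (auto simp: is_uniform_grassmannian_def)
qed

lemma uniform_grassmannian_is_uniform:
  "m \<le> CARD('d) \<Longrightarrow> is_uniform_grassmannian m (uniform_grassmannian m :: (real^'d) set measure)"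
  unfolding uniform_grassmannian_def by (rule someI_ex[OF exists_uniform_grassmannian])

lemma
  assumes "m \<le> CARD('d)"
  shows prob_space_uniform_grassmannian: "prob_space (uniform_grassmannian m :: (real^'d) set measure)"
    and sets_uniform_grassmannian: "sets (uniform_grassmannian m :: (real^'d) set measure) = sets (borel_grassmannian m)"
    and space_uniform_grassmannian: "space (uniform_grassmannian m :: (real^'d) set measure) = grassmannian m"
  using uniform_grassmannian_is_uniform[OF assms] sets_eq_imp_space_eq space_borel_grassmannian
  unfolding is_uniform_grassmannian_def by blast+

text \<open>
  The subspaces that meet U are those whose projection matrix fixes a unit vector of U, and by
  compactness this is a closed condition on the matrix.
\<close>

lemma sets_meets_subspace:
  fixes U :: "(real^'d) set"
  assumes U: "subspace U"
  shows "{W \<in> grassmannian m. W \<inter> U \<noteq> {0}} \<in> sets (borel_grassmannian m)"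
proof -
  let ?K = "U \<inter> sphere 0 1"
  let ?T = "{p :: (real^'d) \<times> (real^'d^'d). snd p *v fst p = fst p}"
  have "compact ?K" using U by (simp add: closed_subspace closed_Int_compact)
  moreover have "closed ?T"
    unfolding matrix_vector_mult_def by (intro closed_Collect_eq continuous_intros)
  ultimately have "closed {A. \<exists>u. u \<in> ?K \<and> (u, A) \<in> ?T}" by (rule closed_compact_projection)
  then have cl: "{A :: real^'d^'d. \<exists>u\<in>?K. A *v u = u} \<in> sets borel" by (intro borel_closed) (simp add: Bex_def)
  have "W \<inter> U \<noteq> {0} \<longleftrightarrow> (\<exists>u\<in>?K. proj_matrix W *v u = u)" if "W \<in> grassmannian m" for W
  proof -
    have W: "subspace W" using that by (simp add: grassmannian_def)
    have "W \<inter> U \<noteq> {0} \<longleftrightarrow> (\<exists>u\<in>?K. u \<in> W)"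
    proof
      assume "W \<inter> U \<noteq> {0}"
      then obtain u where u: "u \<in> W" "u \<in> U" "u \<noteq> 0"
        using subspace_0[OF W] subspace_0[OF U] by blast
      then show "\<exists>u\<in>?K. u \<in> W"
        by (intro bexI[of _ "(1 / norm u) *\<^sub>R u"]) (auto intro!: subspace_scale W U)
    next
      assume "\<exists>u\<in>?K. u \<in> W"
      then obtain u where "u \<in> W \<inter> U" "norm u = 1" by auto
      moreover from this(2) have "u \<noteq> 0" by auto
      ultimately show "W \<inter> U \<noteq> {0}" by blast
    qed
    then show ?thesis by (simp add: mem_subspace_iff_proj[OF W])
  qed
  then have "{W \<in> grassmannian m. W \<inter> U \<noteq> {0}}
      = proj_matrix -` {A. \<exists>u\<in>?K. A *v u = u} \<inter> space (borel_grassmannian m)"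
    by (auto simp: space_borel_grassmannian)
  also have "\<dots> \<in> sets (borel_grassmannian m)" by (rule measurable_sets[OF measurable_proj_matrix cl])
  finally show ?thesis .
qed

section \<open>A random subspace is generic\<close>

text \<open>
  Combine an isometry between the subspaces with one between their orthogonal complements.
\<close>

lemma orthogonal_transformation_between_subspaces:
  fixes U U' :: "'a::euclidean_space set"
  assumes U: "subspace U" and U': "subspace U'" and dim: "dim U = dim U'"
  obtains g :: "'a \<Rightarrow> 'a" where "orthogonal_transformation g" "g ` U = U'"
proof -
  define C where "C S = {y. \<forall>x\<in>S. orthogonal x y}" for S :: "'a set"
  have C: "subspace (C S)" for S by (simp add: C_def subspace_orthogonal_to_vectors)
  have dimC: "dim (C S) + dim S = DIM('a)" if "subspace S" for S
    using dim_subspace_orthogonal_to_vectors[OF that subspace_UNIV] by (simp add: C_def)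
  obtain f f' where f: "linear f" "f ` U = U'" "\<And>x. x \<in> U \<Longrightarrow> norm (f x) = norm x"
    using isometries_subspaces[OF U U' dim] by metis
  have "dim (C U) = dim (C U')" using dimC[OF U] dimC[OF U'] dim by simp
  then obtain h h' where h: "linear h" "h ` C U = C U'" "\<And>x. x \<in> C U \<Longrightarrow> norm (h x) = norm x"
    using isometries_subspaces[OF C C] by metis
  let ?p = "closest_point U"
  note cp = closest_point_subspace[OF U]
  have lp: "linear ?p" by (rule linear_closest_point_subspace[OF U])
  have rest: "x - ?p x \<in> C U" for x
    using cp(2)[of _ x] by (auto simp: C_def orthogonal_def inner_commute)
  define g where "g x = f (?p x) + h (x - ?p x)" for x
  have "linear g"
    unfolding g_def[abs_def]
    by (intro linear_compose_add linear_compose[unfolded o_def, OF lp f(1)]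
        linear_compose[unfolded o_def, OF linear_compose_sub[OF linear_ident lp] h(1)])
  moreover have "norm (g x) = norm x" for x
  proof -
    have "f (?p x) \<in> U'" "h (x - ?p x) \<in> C U'" using f(2) h(2) cp(1)[of x] rest[of x] by blast+
    then have "orthogonal (f (?p x)) (h (x - ?p x))" by (auto simp: C_def)
    then have "(norm (g x))\<^sup>2 = (norm (?p x))\<^sup>2 + (norm (x - ?p x))\<^sup>2"
      unfolding g_def by (simp add: norm_add_Pythagorean f(3)[OF cp(1)] h(3)[OF rest])
    also have "\<dots> = (norm (?p x + (x - ?p x)))\<^sup>2"
      using rest[of x] cp(1)[of x] by (intro norm_add_Pythagorean[symmetric]) (auto simp: C_def)
    finally have "(norm (g x))\<^sup>2 = (norm x)\<^sup>2" by simp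
    then show ?thesis by (simp add: power2_eq_iff_nonneg)
  qed
  ultimately have orth: "orthogonal_transformation g" by (simp add: orthogonal_transformation)
  have "?p x = x" if "x \<in> U" for x
    using that by (intro closest_point_subspace_eqI[OF U]) auto
  then have "g x = f x" if "x \<in> U" for x
    using that linear_0[OF h(1)] by (simp add: g_def)
  then have "g ` U = U'" using f(2) by (auto simp: image_iff)
  with orth show thesis by (rule that)
qed

lemma measure_meets_subspace_cong:
  fixes U U' :: "(real^'d) set"
  assumes m: "m \<le> CARD('d)" and U: "subspace U" and U': "subspace U'" and dim: "dim U = dim U'"
  shows "measure (uniform_grassmannian m) {W \<in> grassmannian m. W \<inter> U \<noteq> {0}}
       = measure (uniform_grassmannian m) {W \<in> grassmannian m. W \<inter> U' \<noteq> {0}}"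
proof -
  let ?\<mu> = "uniform_grassmannian m :: (real^'d) set measure"
  let ?E = "\<lambda>U :: (real^'d) set. {W \<in> grassmannian m. W \<inter> U \<noteq> {0}}"
  obtain g where g: "orthogonal_transformation g" "g ` U = U'"
    using orthogonal_transformation_between_subspaces[OF U U' dim] .
  have lin: "linear g" by (rule orthogonal_transformation_linear[OF g(1)])
  have gm: "(\<lambda>W. g ` W) \<in> measurable ?\<mu> ?\<mu>"
    using measurable_orthogonal_image_grassmannian[OF g(1)] sets_uniform_grassmannian[OF m]
    by (simp add: measurable_cong_sets[OF sets_uniform_grassmannian[OF m] sets_uniform_grassmannian[OF m]])
  have "distr ?\<mu> ?\<mu> (\<lambda>W. g ` W) = ?\<mu>"
    using uniform_grassmannian_is_uniform[OF m] g(1) by (simp add: is_uniform_grassmannian_def)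
  then have "measure ?\<mu> (?E U') = measure (distr ?\<mu> ?\<mu> (\<lambda>W. g ` W)) (?E U')" by simp
  also have "\<dots> = measure ?\<mu> ((\<lambda>W. g ` W) -` ?E U' \<inter> space ?\<mu>)"
    using sets_meets_subspace[OF U', of m] sets_uniform_grassmannian[OF m]
    by (intro measure_distr gm) simp
  also have "(\<lambda>W. g ` W) -` ?E U' \<inter> space ?\<mu> = ?E U"
  proof -
    have "(g ` W \<in> ?E U') \<longleftrightarrow> W \<inter> U \<noteq> {0}" if W: "W \<in> grassmannian m" for W
    proof -
      have "g ` W \<in> grassmannian m"
        using measurable_space[OF gm, of W] W by (simp add: space_uniform_grassmannian[OF m])
      moreover have "g ` W \<inter> U' = g ` (W \<inter> U)"
        unfolding g(2)[symmetric] by (rule image_Int[OF orthogonal_transformation_inj[OF g(1)], symmetric])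
      moreover have "g ` (W \<inter> U) = {0} \<longleftrightarrow> W \<inter> U = {0}"
      proof -
        have "g ` {0} = {0}" using linear_0[OF lin] by simp
        then show ?thesis using inj_image_eq_iff[OF orthogonal_transformation_inj[OF g(1)], of "W \<inter> U" "{0}"] by simp
      qed
      ultimately show ?thesis by simp
    qed
    then show ?thesis by (auto simp: space_uniform_grassmannian[OF m])
  qed
  finally show ?thesis by simp
qed

text \<open>
  Restricted to the moment curve, a linear functional is a polynomial and has few zeros.
\<close>

lemma moment_curve:
  "\<exists>v :: nat \<Rightarrow> 'a::euclidean_space. \<forall>H. subspace H \<longrightarrow> dim H < DIM('a) \<longrightarrow>
      finite {i. v i \<in> H} \<and> card {i. v i \<in> H} \<le> DIM('a)"
proof -
  obtain f where f: "bij_betw f (Basis :: 'a set) {0..<DIM('a)}"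
    using ex_bij_betw_finite_nat[OF finite_Basis] by blast
  define v :: "nat \<Rightarrow> 'a" where "v i = (\<Sum>b\<in>Basis. (real i ^ f b) *\<^sub>R b)" for i
  have "finite {i. v i \<in> H} \<and> card {i. v i \<in> H} \<le> DIM('a)" if H: "subspace H" "dim H < DIM('a)" for H
  proof -
    obtain a where a: "a \<noteq> 0" "\<And>x. x \<in> span H \<Longrightarrow> orthogonal a x"
      using orthogonal_to_subspace_exists[OF H(2)] by (auto simp: orthogonal_commute)
    define p where "p = (\<Sum>b\<in>Basis. monom (a \<bullet> b) (f b))"
    have poly: "poly p (real i) = a \<bullet> v i" for i
      by (simp add: p_def v_def poly_sum poly_monom inner_sum_right mult.commute)
    have "degree (monom (a \<bullet> b) (f b)) \<le> DIM('a)" if "b \<in> Basis" for b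
      using degree_monom_le[of "a \<bullet> b" "f b"] bij_betwE[OF f] that by fastforce
    then have deg: "degree p \<le> DIM('a)"
      unfolding p_def by (intro degree_sum_le) auto
    obtain b where b: "b \<in> Basis" "a \<bullet> b \<noteq> 0"
      using a(1) euclidean_all_zero_iff[of a] by auto
    have "coeff p (f b) = (\<Sum>b'\<in>Basis. if b' = b then a \<bullet> b' else 0)"
      unfolding p_def coeff_sum using b f by (intro sum.cong) (auto simp: bij_betw_def inj_on_def)
    also have "\<dots> = a \<bullet> b" using b by simp
    finally have "p \<noteq> 0" using b(2) by auto
    have sub: "real ` {i. v i \<in> H} \<subseteq> {t. poly p t = 0}"
      using a(2) by (auto simp: poly orthogonal_def span_base)
    have fin: "finite (real ` {i. v i \<in> H})"
      using sub poly_roots_finite[OF \<open>p \<noteq> 0\<close>] by (rule finite_subset)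
    have "card (real ` {i. v i \<in> H}) \<le> card {t. poly p t = 0}"
      by (rule card_mono[OF poly_roots_finite[OF \<open>p \<noteq> 0\<close>] sub])
    also have "\<dots> \<le> DIM('a)" using card_poly_roots_bound[OF \<open>p \<noteq> 0\<close>] deg by simp
    finally show ?thesis using fin by (simp add: card_image inj_on_def finite_image_iff)
  qed
  then show ?thesis by blast
qed

text \<open>
  By rotation invariance the probability q of meeting U depends only on the dimension of U. Fix a
  subspace U0 of one dimension less, which is almost surely avoided by induction, and enlarge it by
  N points of the moment curve, one at a time. A subspace W that avoids U0 meets such an
  enlargement only if the point lies in the proper subspace W + U0, which contains at most d of
  the points. Hence N q is at most d for every N.
\<close>

lemma measure_meets_subspace_eq_0:
  fixes U :: "(real^'d) set"
  assumes m: "m \<le> CARD('d)" and U: "subspace U" "dim U + m \<le> CARD('d)"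
  shows "measure (uniform_grassmannian m) {W \<in> grassmannian m. W \<inter> U \<noteq> {0}} = 0"
  using U
proof (induction "dim U" arbitrary: U)
  case 0
  then have "U = {0}" using subspace_0[of U] by auto
  then have "{W \<in> grassmannian m. W \<inter> U \<noteq> {0}} = {}"
    using subspace_0 by (auto simp: grassmannian_def)
  then show ?case by (simp only: measure_empty)
next
  case (Suc k)
  let ?\<mu> = "uniform_grassmannian m :: (real^'d) set measure"
  let ?E = "\<lambda>U :: (real^'d) set. {W \<in> grassmannian m. W \<inter> U \<noteq> {0}}"
  let ?D = "CARD('d)"
  interpret prob_space ?\<mu> by (rule prob_space_uniform_grassmannian[OF m])
  have Esets: "?E S \<in> sets ?\<mu>" if "subspace S" for S
    using sets_meets_subspace[OF that] sets_uniform_grassmannian[OF m] by simp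
  have "k \<le> dim U" using Suc.hyps(2) by simp
  then obtain U0 where U0: "subspace U0" "U0 \<subseteq> span U" "dim U0 = k"
    by (rule choose_subspace_of_subspace)
  have "measure ?\<mu> (?E U0) = 0"
    using Suc.hyps(1)[of U0] U0 Suc.hyps(2) Suc.prems by simp
  then have AE0: "AE W in ?\<mu>. W \<in> grassmannian m \<and> W \<inter> U0 = {0}"
  proof -
    have "?E U0 \<in> null_sets ?\<mu>"
      using Esets[OF U0(1)] \<open>measure ?\<mu> (?E U0) = 0\<close> by (simp add: null_sets_def emeasure_eq_measure)
    then have "AE W in ?\<mu>. W \<notin> ?E U0" by (rule AE_not_in)
    moreover have "AE W in ?\<mu>. W \<in> grassmannian m"
      using AE_space[of ?\<mu>] by (simp only: space_uniform_grassmannian[OF m])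
    ultimately show ?thesis by eventually_elim blast
  qed
  obtain v :: "nat \<Rightarrow> real^'d" where
    v: "\<And>H. subspace H \<Longrightarrow> dim H < ?D \<Longrightarrow> finite {i. v i \<in> H} \<and> card {i. v i \<in> H} \<le> ?D"
    using moment_curve[where 'a = "real^'d"] by auto
  define q where "q = measure ?\<mu> (?E U)"
  have bound: "real N * q \<le> real ?D" for N
  proof -
    have "k < ?D" using Suc.prems(2) Suc.hyps(2) by simp
    then have "finite {i. v i \<in> U0}" using v[OF U0(1)] U0(3) by simp
    then have "infinite (- {i. v i \<in> U0})" by (simp add: Compl_eq_Diff_UNIV)
    from infinite_arbitrarily_large[OF this, of N]
    obtain I where I: "finite I" "card I = N" "I \<subseteq> - {i. v i \<in> U0}" by blast
    define S where "S i = span (insert (v i) U0)" for i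
    have S: "subspace (S i)" for i by (simp add: S_def)
    have sp: "span U0 = U0" using U0(1) by (simp add: span_eq_iff)
    have "dim (S i) = dim U" if "i \<in> I" for i
    proof -
      have "v i \<notin> U0" using I(3) that by blast
      then have "v i \<notin> span U0" by (simp only: sp not_False_eq_True)
      then show ?thesis using U0(3) Suc.hyps(2) by (simp add: S_def dim_insert)
    qed
    then have "measure ?\<mu> (?E (S i)) = q" if "i \<in> I" for i
      unfolding q_def using that by (intro measure_meets_subspace_cong m S Suc.prems(1)) auto
    then have "real N * q = (\<Sum>i\<in>I. measure ?\<mu> (?E (S i)))" by (simp add: I(2))
    also have "\<dots> = expectation (\<lambda>W. \<Sum>i\<in>I. indicator (?E (S i)) W)"
      using Esets[OF S] by (subst Bochner_Integration.integral_sum) (auto simp: emeasure_eq_measure)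
    also have "\<dots> \<le> real ?D"
    proof (rule integral_le_const)
      show "integrable ?\<mu> (\<lambda>W. \<Sum>i\<in>I. indicator (?E (S i)) W :: real)"
        using Esets[OF S] by (intro Bochner_Integration.integrable_sum) (auto simp: emeasure_eq_measure)
      show "AE W in ?\<mu>. (\<Sum>i\<in>I. indicator (?E (S i)) W) \<le> real ?D"
        using AE0
      proof eventually_elim
        case (elim W)
        then have W: "subspace W" "dim W = m" by (auto simp: grassmannian_def)
        let ?H = "{x + y |x y. x \<in> W \<and> y \<in> U0}"
        have H: "subspace ?H" by (rule subspace_sums[OF W(1) U0(1)])
        have "dim ?H \<le> m + k"
          using dim_sums_Int[OF W(1) U0(1)] W(2) U0(3) by simp
        then have dimH: "dim ?H < ?D" using Suc.prems(2) Suc.hyps(2) by simp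
        have "{i \<in> I. W \<inter> S i \<noteq> {0}} \<subseteq> {i. v i \<in> ?H}"
        proof clarify
          fix i assume "i \<in> I" "W \<inter> S i \<noteq> {0}"
          then obtain w where w: "w \<in> W" "w \<in> S i" "w \<noteq> 0"
            using subspace_0[OF W(1)] subspace_0[OF S[of i]] by blast
          then obtain t where t: "w - t *\<^sub>R v i \<in> U0" by (auto simp: S_def span_insert sp)
          have "t \<noteq> 0"
          proof
            assume "t = 0"
            with t w elim show False by auto
          qed
          have "(1 / t) *\<^sub>R w \<in> W" using W(1) w(1) by (rule subspace_scale)
          moreover have "(- 1 / t) *\<^sub>R (w - t *\<^sub>R v i) \<in> U0" using U0(1) t by (rule subspace_scale)
          moreover have "v i = (1 / t) *\<^sub>R w + (- 1 / t) *\<^sub>R (w - t *\<^sub>R v i)"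
            using \<open>t \<noteq> 0\<close> by (simp add: scaleR_diff_right)
          ultimately show "\<exists>x y. v i = x + y \<and> x \<in> W \<and> y \<in> U0" by blast
        qed
        then have "card {i \<in> I. W \<inter> S i \<noteq> {0}} \<le> card {i. v i \<in> ?H}"
          using v[OF H dimH] by (intro card_mono) auto
        also have "\<dots> \<le> ?D" using v[OF H dimH] by simp
        finally have le: "card {i \<in> I. W \<inter> S i \<noteq> {0}} \<le> ?D" .
        have "(\<Sum>i\<in>I. indicator (?E (S i)) W) = (\<Sum>i\<in>I. if W \<inter> S i \<noteq> {0} then 1 else 0 :: real)"
          using elim by (intro sum.cong) (auto simp: indicator_def)
        also have "\<dots> = real (card {i \<in> I. W \<inter> S i \<noteq> {0}})"
          using I(1) by (simp add: sum.If_cases Int_def)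
        finally show ?case using le by simp
      qed
    qed
    finally show ?thesis .
  qed
  have "0 \<le> q" by (simp add: q_def)
  moreover have "\<not> 0 < q"
  proof
    assume "0 < q"
    then obtain N where "real ?D < real N * q" using reals_Archimedean3 by blast
    with bound[of N] show False by simp
  qed
  ultimately have "q = 0" by simp
  then show ?case by (simp add: q_def)
qed

text \<open>
  A coefficient family with at most k non-zero values is determined by the partition into its level
  sets and by the values. For each of the finitely many partitions, the block sums span a subspace
  of dimension at most k, which almost every W avoids.
\<close>

lemma AE_in_general_position:
  fixes x :: "nat \<Rightarrow> real^'d"
  assumes gp: "in_general_position CARD('d) {0} {..n} x" and k: "k \<le> CARD('d)"
  shows "AE W in uniform_grassmannian (CARD('d) - k). in_general_position k W {..n} x"
proof -
  let ?\<mu> = "uniform_grassmannian (CARD('d) - k) :: (real^'d) set measure"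
  have m: "CARD('d) - k \<le> CARD('d)" by simp
  interpret prob_space ?\<mu> by (rule prob_space_uniform_grassmannian[OF m])
  \<comment> \<open>p assigns to every index its level set, with 0 for the value 0.\<close>
  define B where "B p i = (\<Sum>r | r \<le> n \<and> p r = i. x r)" for p :: "nat \<Rightarrow> nat" and i
  define U where "U p = span (B p ` {1..k})" for p
  have U: "subspace (U p)" for p by (simp add: U_def)
  have dimU: "dim (U p) + (CARD('d) - k) \<le> CARD('d)" for p
  proof -
    have "dim (U p) \<le> card (B p ` {1..k})" unfolding U_def dim_span by (rule dim_le_card') simp
    also have "\<dots> \<le> k" using card_image_le[of "{1..k}" "B p"] by simp
    finally show ?thesis using k by simp
  qed
  have "AE W in ?\<mu>. W \<inter> U p = {0}" for p
  proof -
    let ?E = "{W \<in> grassmannian (CARD('d) - k). W \<inter> U p \<noteq> {0}}"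
    have "?E \<in> null_sets ?\<mu>"
      using sets_meets_subspace[OF U] sets_uniform_grassmannian[OF m] measure_meets_subspace_eq_0[OF m U dimU]
      by (simp add: null_sets_def emeasure_eq_measure)
    then have "AE W in ?\<mu>. W \<notin> ?E" by (rule AE_not_in)
    moreover have "AE W in ?\<mu>. W \<in> grassmannian (CARD('d) - k)"
      using AE_space[of ?\<mu>] by (simp only: space_uniform_grassmannian[OF m])
    ultimately show ?thesis by eventually_elim blast
  qed
  then have "AE W in ?\<mu>. \<forall>p\<in>{..n} \<rightarrow>\<^sub>E {..k}. W \<inter> U p = {0}"
    by (intro AE_finite_allI finite_PiE) auto
  then show ?thesis
  proof eventually_elim
    case (elim W)
    show ?case unfolding in_general_position_def
    proof (intro allI impI)
      fix c :: "nat \<Rightarrow> real"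
      assume c: "c 0 = 0" "card (c ` {..n}) \<le> Suc k" "(\<Sum>r\<le>n. c r *\<^sub>R x r) \<in> W"
      define T where "T = c ` {..n} - {0}"
      have finT: "finite T" by (simp add: T_def)
      have "0 \<in> c ` {..n}" using c(1) by (intro image_eqI[of _ _ 0]) auto
      then have "card T \<le> card {1..k}" using c(2) by (simp add: T_def)
      then obtain h where h: "inj_on h T" "h ` T \<subseteq> {1..k}"
        using card_le_inj[OF finT, of "{1..k}"] by auto
      define p where "p = (\<lambda>r\<in>{..n}. if c r = 0 then 0 else h (c r))"
      have hT: "h (c r) \<in> {1..k}" if "r \<le> n" "c r \<noteq> 0" for r
      proof -
        have "c r \<in> T" using that by (simp add: T_def)
        then show ?thesis using h(2) by blast
      qed
      have "p \<in> {..n} \<rightarrow>\<^sub>E {..k}" using hT by (auto simp: p_def)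
      with elim have WU: "W \<inter> U p = {0}" by blast
      have "(\<Sum>r\<le>n. c r *\<^sub>R x r) = (\<Sum>r | r \<le> n \<and> c r \<noteq> 0. c r *\<^sub>R x r)"
        by (intro sum.mono_neutral_right) auto
      also have "\<dots> = (\<Sum>t\<in>T. \<Sum>r | r \<in> {r. r \<le> n \<and> c r \<noteq> 0} \<and> c r = t. c r *\<^sub>R x r)"
        using finT by (intro sum.group[symmetric]) (auto simp: T_def)
      also have "\<dots> = (\<Sum>t\<in>T. t *\<^sub>R B p (h t))"
      proof (rule sum.cong[OF refl])
        fix t assume t: "t \<in> T"
        have "{r. r \<in> {r. r \<le> n \<and> c r \<noteq> 0} \<and> c r = t} = {r. r \<le> n \<and> p r = h t}"
        proof -
          have "1 \<le> h t" using h(2) t by auto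
          have "p r = h t \<longleftrightarrow> c r = t" if r: "r \<le> n" for r
          proof (cases "c r = 0")
            case True
            then show ?thesis using t r \<open>1 \<le> h t\<close> by (auto simp: p_def T_def)
          next
            case False
            then have "c r \<in> T" using r by (simp add: T_def)
            then have "h (c r) = h t \<longleftrightarrow> c r = t" using h(1) t by (simp add: inj_on_eq_iff)
            then show ?thesis using False r by (simp add: p_def)
          qed
          moreover have "t \<noteq> 0" using t by (simp add: T_def)
          ultimately show ?thesis by auto
        qed
        moreover have "(\<Sum>r | r \<in> {r. r \<le> n \<and> c r \<noteq> 0} \<and> c r = t. c r *\<^sub>R x r)
            = (\<Sum>r | r \<in> {r. r \<le> n \<and> c r \<noteq> 0} \<and> c r = t. t *\<^sub>R x r)"
          by (intro sum.cong) auto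
        ultimately show "(\<Sum>r | r \<in> {r. r \<le> n \<and> c r \<noteq> 0} \<and> c r = t. c r *\<^sub>R x r) = t *\<^sub>R B p (h t)"
          by (simp add: B_def scaleR_sum_right)
      qed
      also have "\<dots> \<in> U p"
        unfolding U_def using h(2) by (intro span_sum span_scale span_base) auto
      finally have "(\<Sum>r\<le>n. c r *\<^sub>R x r) \<in> {0}" using c(3) WU by blast
      moreover have "card (c ` {..n}) \<le> Suc CARD('d)" using c(2) k by simp
      ultimately show "\<forall>r\<in>{..n}. c r = 0"
        using in_general_positionD[where c = c, OF gp c(1)] by blast
    qed
  qed
qed

section \<open>Measurability for degenerate walks\<close>

lemma compact_weight_box: "compact {l :: nat \<Rightarrow> real. \<forall>i. \<bar>l i\<bar> \<le> m}"
proof -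
  have "compactin (product_topology (\<lambda>i::nat. euclidean :: real topology) UNIV) (PiE UNIV (\<lambda>i. {-m..m}))"
    by (subst compactin_PiE) simp
  then have "compact (PiE UNIV (\<lambda>i::nat. {-m..m}))"
    by (simp add: euclidean_product_topology)
  also have "PiE UNIV (\<lambda>i::nat. {-m..m}) = {l. \<forall>i. \<bar>l i\<bar> \<le> m}"
    by (auto simp: PiE_def Pi_def abs_le_iff minus_le_iff)
  finally show ?thesis .
qed

text \<open>
  The projection along a compact factor is closed, by the tube lemma.
\<close>

lemma closed_exists_compact:
  assumes K: "compact K" and T: "closed T"
  shows "closed {y. \<exists>k\<in>K. (y, k) \<in> T}"
proof -
  have "open {y. \<forall>k\<in>K. (y, k) \<in> - T}"
  proof (rule open_subopen[THEN iffD2], rule ballI)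
    fix y assume "y \<in> {y. \<forall>k\<in>K. (y, k) \<in> - T}"
    then have "{y} \<times> K \<subseteq> - T" by auto
    from Elementary_Topology.tube_lemma[OF K open_Compl[OF T] this]
    obtain X where "y \<in> X" "open X" "X \<times> K \<subseteq> - T" by blast
    have "X \<subseteq> {y. \<forall>k\<in>K. (y, k) \<in> - T}"
    proof (intro subsetI CollectI ballI)
      fix z k assume "z \<in> X" "k \<in> K"
      then have "(z, k) \<in> X \<times> K" by (rule SigmaI)
      then show "(z, k) \<in> - T" using \<open>X \<times> K \<subseteq> - T\<close> by (rule rev_subsetD)
    qed
    with \<open>y \<in> X\<close> \<open>open X\<close> show "\<exists>S. open S \<and> y \<in> S \<and> S \<subseteq> {y. \<forall>k\<in>K. (y, k) \<in> - T}"
      by (intro exI[of _ X] conjI)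
  qed
  moreover have "{y. \<forall>k\<in>K. (y, k) \<in> - T} = - {y. \<exists>k\<in>K. (y, k) \<in> T}"
    by (rule set_eqI) (simp only: Compl_iff mem_Collect_eq, blast)
  ultimately show ?thesis unfolding closed_def by (simp only:)
qed

text \<open>
  Truncated at n, since the product space determines only the increments with index from 1 to n.
\<close>

definition walk_points :: "nat \<Rightarrow> (nat \<Rightarrow> 'a::comm_monoid_add) \<Rightarrow> nat \<Rightarrow> 'a" where
  "walk_points n x i = (if i \<le> n then partial_sum x i else 0)"

lemma measurable_walk_points:
  "walk_points n \<in> measurable (PiM {1..n} (\<lambda>_. borel :: 'a::euclidean_space measure)) borel"
proof -
  have "walk_points n \<in> measurable (PiM {1..n} (\<lambda>_. borel :: 'a measure)) (PiM UNIV (\<lambda>_. borel))"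
  proof (rule measurable_PiM_single')
    fix i :: nat
    show "(\<lambda>x. walk_points n x i) \<in> measurable (PiM {1..n} (\<lambda>_. borel :: 'a measure)) borel"
      unfolding walk_points_def partial_sum_def
      by (cases "i \<le> n") (auto intro!: borel_measurable_sum measurable_component_singleton)
  qed (auto simp: space_PiM)
  then show ?thesis by (simp add: measurable_cong_sets[OF refl sets_PiM_equal_borel])
qed

lemma combination_walk_points: "(\<Sum>i\<le>n. l i *\<^sub>R walk_points n x i) = walk_comb n x l"
  by (intro sum.cong) (auto simp: walk_points_def)

text \<open>
  The conditions on weights are closed, but the weights range over an unbounded set. Weights bounded by
  a fixed m form a compact set, so the event is a countable union of preimages of closed sets.
\<close>

lemma measurable_exists_weights:
  fixes T :: "(((nat \<Rightarrow> real^'d) \<times> (real^'d^'d)) \<times> (nat \<Rightarrow> real)) set"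
  assumes T: "closed T" and P: "P \<in> borel_measurable N"
    and x: "x \<in> measurable N (PiM {1..n} (\<lambda>_. borel :: (real^'d) measure))"
  shows "{\<omega> \<in> space N. \<exists>l. (\<forall>i>n. l i = 0) \<and> ((walk_points n (x \<omega>), P \<omega>), l) \<in> T} \<in> sets N"
proof -
  let ?Z = "{l :: nat \<Rightarrow> real. \<forall>i>n. l i = 0}"
  let ?B = "\<lambda>m :: nat. {l :: nat \<Rightarrow> real. \<forall>i. \<bar>l i\<bar> \<le> real m}"
  have "?Z = (\<Inter>i\<in>{n<..}. {l. l i = 0})" by auto
  also have "closed \<dots>"
    by (intro closed_INT ballI closed_Collect_eq continuous_intros continuous_on_product_coordinates)
  finally have "compact (?B m \<inter> ?Z)" for m by (intro compact_Int_closed compact_weight_box)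
  then have cl: "closed {p. \<exists>l\<in>?B m \<inter> ?Z. (p, l) \<in> T}" for m by (rule closed_exists_compact[OF _ T])
  have "(\<lambda>\<omega>. (walk_points n (x \<omega>), P \<omega>)) \<in> measurable N (borel \<Otimes>\<^sub>M borel)"
    by (intro measurable_Pair P measurable_compose[OF x measurable_walk_points])
  then have meas: "(\<lambda>\<omega>. (walk_points n (x \<omega>), P \<omega>)) \<in> borel_measurable N" by (simp add: borel_prod)
  have bounded: "\<exists>m :: nat. l \<in> ?B m" if l: "l \<in> ?Z" for l
  proof -
    obtain m :: nat where m: "(\<Sum>i\<le>n. \<bar>l i\<bar>) \<le> real m" using real_arch_simple by blast
    have "\<bar>l i\<bar> \<le> real m" for i
    proof (cases "i \<le> n")
      case True
      then have "\<bar>l i\<bar> \<le> (\<Sum>i\<le>n. \<bar>l i\<bar>)" by (intro member_le_sum) auto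
      with m show ?thesis by simp
    next
      case False
      then show ?thesis using l by simp
    qed
    then show ?thesis by blast
  qed
  have "{\<omega> \<in> space N. \<exists>l. (\<forall>i>n. l i = 0) \<and> ((walk_points n (x \<omega>), P \<omega>), l) \<in> T}
      = (\<Union>m. (\<lambda>\<omega>. (walk_points n (x \<omega>), P \<omega>)) -` {p. \<exists>l\<in>?B m \<inter> ?Z. (p, l) \<in> T} \<inter> space N)"
    (is "?L = ?R")
  proof (intro set_eqI iffI)
    fix \<omega> assume "\<omega> \<in> ?L"
    then obtain l where \<omega>: "\<omega> \<in> space N" and l: "l \<in> ?Z" "((walk_points n (x \<omega>), P \<omega>), l) \<in> T" by auto
    obtain m :: nat where "l \<in> ?B m" using bounded[OF l(1)] ..
    with l have "(walk_points n (x \<omega>), P \<omega>) \<in> {p. \<exists>l\<in>?B m \<inter> ?Z. (p, l) \<in> T}" by blast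
    with \<omega> show "\<omega> \<in> ?R" by (intro UN_I[of m]) simp_all
  next
    fix \<omega> assume "\<omega> \<in> ?R"
    then show "\<omega> \<in> ?L" by auto
  qed
  also have "?R \<in> sets N"
    by (rule sets.countable_UN) (rule image_subsetI, rule measurable_sets[OF meas borel_closed[OF cl]])
  finally show ?thesis .
qed

lemma walk_points_cut:
  "(\<Sum>i\<le>n. (if i \<le> n then l i else 0) *\<^sub>R walk_points n x i) = walk_comb n x l"
  by (intro sum.cong) (auto simp: walk_points_def)

lemma continuous_weight:
  "continuous_on UNIV (\<lambda>q :: ((nat \<Rightarrow> real^'d) \<times> (real^'d^'d)) \<times> (nat \<Rightarrow> real). snd q i)"
  by (rule continuous_on_product_then_coordinatewise[OF continuous_on_snd[OF continuous_on_id]])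

lemma continuous_combination:
  "continuous_on UNIV (\<lambda>q :: ((nat \<Rightarrow> real^'d) \<times> (real^'d^'d)) \<times> (nat \<Rightarrow> real). \<Sum>i\<le>n. snd q i *\<^sub>R fst (fst q) i)"
proof -
  have "continuous_on UNIV (\<lambda>q :: ((nat \<Rightarrow> real^'d) \<times> (real^'d^'d)) \<times> (nat \<Rightarrow> real). fst (fst q) i)" for i
    by (rule continuous_on_product_then_coordinatewise[OF continuous_on_fst[OF continuous_on_fst[OF continuous_on_id]]])
  then show ?thesis by (intro continuous_on_sum continuous_on_scaleR continuous_weight)
qed

lemma continuous_matrix_combination:
  "continuous_on UNIV (\<lambda>q :: ((nat \<Rightarrow> real^'d) \<times> (real^'d^'d)) \<times> (nat \<Rightarrow> real).
     snd (fst q) *v (\<Sum>i\<le>n. snd q i *\<^sub>R fst (fst q) i))"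
proof -
  have "continuous_on UNIV (\<lambda>q :: ((nat \<Rightarrow> real^'d) \<times> (real^'d^'d)) \<times> (nat \<Rightarrow> real). snd (fst q) $ i $ j)" for i j
    by (intro continuous_on_component continuous_on_snd continuous_on_fst continuous_on_id)
  moreover have "continuous_on UNIV (\<lambda>q :: ((nat \<Rightarrow> real^'d) \<times> (real^'d^'d)) \<times> (nat \<Rightarrow> real).
      (\<Sum>i\<le>n. snd q i *\<^sub>R fst (fst q) i) $ j)" for j
    by (intro continuous_on_component continuous_combination)
  ultimately show ?thesis
    unfolding matrix_vector_mult_def by (intro continuous_on_vec_lambda continuous_on_sum continuous_on_mult)
qed

lemma sets_face_indices:
  assumes x: "x \<in> measurable N (PiM {1..n} (\<lambda>_. borel :: (real^'d) measure))"
  shows "{\<omega> \<in> space N. face_indices n (x \<omega>) J} \<in> sets N"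
proof -
  let ?T = "{q :: ((nat \<Rightarrow> real^'d) \<times> (real^'d^'d)) \<times> (nat \<Rightarrow> real). (\<Sum>i\<le>n. snd q i) = 0}
     \<inter> (\<Inter>i\<in>{..n} - J. {q. 0 \<le> snd q i}) \<inter> {q. (\<Sum>i\<in>{..n} - J. snd q i) = 1}
     \<inter> {q. (\<Sum>i\<le>n. snd q i *\<^sub>R fst (fst q) i) = 0}"
  have T: "closed ?T"
    by (intro closed_Int closed_INT ballI closed_Collect_eq closed_Collect_le continuous_on_sum
        continuous_on_const continuous_weight continuous_combination)
  have "{\<omega> \<in> space N. face_indices n (x \<omega>) J} = space N -
      {\<omega> \<in> space N. \<exists>l. (\<forall>i>n. l i = 0) \<and> ((walk_points n (x \<omega>), 0 :: real^'d^'d), l) \<in> ?T}"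
  proof -
    have "face_indices n (x \<omega>) J \<longleftrightarrow> \<not> (\<exists>l. (\<forall>i>n. l i = 0) \<and> ((walk_points n (x \<omega>), 0 :: real^'d^'d), l) \<in> ?T)" for \<omega>
    proof -
      have "(\<exists>l :: nat \<Rightarrow> real. (\<Sum>i\<le>n. l i) = 0 \<and> (\<forall>i\<in>{..n} - J. 0 \<le> l i) \<and> (\<Sum>i\<in>{..n} - J. l i) = 1 \<and>
          walk_comb n (x \<omega>) l = 0)
        \<longleftrightarrow> (\<exists>l. (\<forall>i>n. l i = 0) \<and> ((walk_points n (x \<omega>), 0 :: real^'d^'d), l) \<in> ?T)" (is "?A \<longleftrightarrow> ?B")
      proof
        assume ?A
        then obtain l :: "nat \<Rightarrow> real" where l: "(\<Sum>i\<le>n. l i) = 0" "\<forall>i\<in>{..n} - J. 0 \<le> l i" "(\<Sum>i\<in>{..n} - J. l i) = 1"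
          "walk_comb n (x \<omega>) l = 0" by blast
        show ?B
          using l by (intro exI[of _ "\<lambda>i. if i \<le> n then l i else 0"]) (simp add: combination_walk_points)
      next
        assume ?B
        then show ?A by (auto simp: combination_walk_points)
      qed
      then show ?thesis unfolding face_indices_def by simp
    qed
    then show ?thesis by blast
  qed
  also have "\<dots> \<in> sets N" by (intro sets.compl_sets measurable_exists_weights[OF T _ x]) simp
  finally show ?thesis .
qed

text \<open>
  The combination has to be a non-zero vector of W. Rescaled to norm 1, this becomes a closed condition.
\<close>

lemma sets_meets_tangent:
  assumes x: "x \<in> measurable N (PiM {1..n} (\<lambda>_. borel :: (real^'d) measure))"
    and P: "(\<lambda>\<omega>. proj_matrix (V \<omega>)) \<in> borel_measurable N" and V: "\<And>\<omega>. \<omega> \<in> space N \<Longrightarrow> subspace (V \<omega>)"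
  shows "{\<omega> \<in> space N. meets_tangent (V \<omega>) n (x \<omega>) J} \<in> sets N"
proof -
  let ?T = "{q :: ((nat \<Rightarrow> real^'d) \<times> (real^'d^'d)) \<times> (nat \<Rightarrow> real). (\<Sum>i\<le>n. snd q i) = 0}
     \<inter> (\<Inter>i\<in>{..n} - J. {q. 0 \<le> snd q i}) \<inter> {q. norm (\<Sum>i\<le>n. snd q i *\<^sub>R fst (fst q) i) = 1}
     \<inter> {q. snd (fst q) *v (\<Sum>i\<le>n. snd q i *\<^sub>R fst (fst q) i) = (\<Sum>i\<le>n. snd q i *\<^sub>R fst (fst q) i)}"
  have T: "closed ?T"
    by (intro closed_Int closed_INT ballI closed_Collect_eq closed_Collect_le continuous_on_sum continuous_on_norm
        continuous_on_const continuous_weight continuous_combination continuous_matrix_combination)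
  have "meets_tangent (V \<omega>) n (x \<omega>) J \<longleftrightarrow> (\<exists>l. (\<forall>i>n. l i = 0) \<and> ((walk_points n (x \<omega>), proj_matrix (V \<omega>)), l) \<in> ?T)"
    if \<omega>: "\<omega> \<in> space N" for \<omega>
  proof
    assume "meets_tangent (V \<omega>) n (x \<omega>) J"
    then obtain l :: "nat \<Rightarrow> real" where l: "(\<Sum>i\<le>n. l i) = 0" "\<forall>i\<in>{..n} - J. 0 \<le> l i"
      "walk_comb n (x \<omega>) l \<in> V \<omega>" "walk_comb n (x \<omega>) l \<noteq> 0"
      unfolding meets_tangent_def by blast
    define v where "v = walk_comb n (x \<omega>) l"
    have nv: "0 < norm v" using l(4) by (simp add: v_def)
    define b where "b i = (if i \<le> n then 1 / norm v * l i else 0)" for i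
    have comb: "(\<Sum>i\<le>n. b i *\<^sub>R walk_points n (x \<omega>) i) = (1 / norm v) *\<^sub>R v"
      unfolding b_def walk_points_cut v_def by (simp add: scaleR_sum_right)
    have "(\<Sum>i\<le>n. b i) = 1 / norm v * (\<Sum>i\<le>n. l i)"
      unfolding sum_distrib_left by (intro sum.cong) (auto simp: b_def)
    then have "(\<Sum>i\<le>n. b i) = 0" using l(1) by simp
    moreover have "\<forall>i\<in>{..n} - J. 0 \<le> b i" using l(2) nv by (simp add: b_def)
    moreover have "norm ((1 / norm v) *\<^sub>R v) = 1" using nv by simp
    moreover have "proj_matrix (V \<omega>) *v ((1 / norm v) *\<^sub>R v) = (1 / norm v) *\<^sub>R v"
      using subspace_scale[OF V[OF \<omega>] l(3), of "1 / norm v"] mem_subspace_iff_proj[OF V[OF \<omega>]] by (simp add: v_def)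
    ultimately have "((walk_points n (x \<omega>), proj_matrix (V \<omega>)), b) \<in> ?T" by (simp add: comb)
    moreover have "\<forall>i>n. b i = 0" by (simp add: b_def)
    ultimately show "\<exists>l. (\<forall>i>n. l i = 0) \<and> ((walk_points n (x \<omega>), proj_matrix (V \<omega>)), l) \<in> ?T" by blast
  next
    assume "\<exists>l. (\<forall>i>n. l i = 0) \<and> ((walk_points n (x \<omega>), proj_matrix (V \<omega>)), l) \<in> ?T"
    then obtain l where l: "(\<Sum>i\<le>n. l i) = 0" "\<forall>i\<in>{..n} - J. 0 \<le> l i"
      "norm (walk_comb n (x \<omega>) l) = 1"
      "proj_matrix (V \<omega>) *v walk_comb n (x \<omega>) l = walk_comb n (x \<omega>) l"
      by (auto simp: combination_walk_points)
    have "walk_comb n (x \<omega>) l \<in> V \<omega>" using l(4) mem_subspace_iff_proj[OF V[OF \<omega>]] by blast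
    moreover have "walk_comb n (x \<omega>) l \<noteq> 0" using l(3) by auto
    ultimately show "meets_tangent (V \<omega>) n (x \<omega>) J" unfolding meets_tangent_def using l(1,2) by blast
  qed
  then have "{\<omega> \<in> space N. meets_tangent (V \<omega>) n (x \<omega>) J}
      = {\<omega> \<in> space N. \<exists>l. (\<forall>i>n. l i = 0) \<and> ((walk_points n (x \<omega>), proj_matrix (V \<omega>)), l) \<in> ?T}" by blast
  also have "\<dots> \<in> sets N" by (rule measurable_exists_weights[OF T P x])
  finally show ?thesis .
qed

text \<open>
  C = UNIV expresses linear and C = {0} affine dependence.
\<close>

lemma sets_weighted_dependence:
  assumes x: "x \<in> measurable N (PiM {1..n} (\<lambda>_. borel :: (real^'d) measure))"
    and I: "I \<subseteq> {..n}" and C: "C = {0} \<or> C = (UNIV :: real set)"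
  shows "{\<omega> \<in> space N. \<exists>l. (\<exists>i\<in>I. l i \<noteq> 0) \<and> sum l I \<in> C \<and> (\<Sum>i\<in>I. l i *\<^sub>R partial_sum (x \<omega>) i) = 0} \<in> sets N"
proof -
  have finI: "finite I" using I finite_subset by blast
  let ?T = "{q :: ((nat \<Rightarrow> real^'d) \<times> (real^'d^'d)) \<times> (nat \<Rightarrow> real). (\<Sum>i\<le>n. snd q i) \<in> C}
     \<inter> (\<Inter>i\<in>- I. {q. snd q i = 0}) \<inter> {q. (\<Sum>i\<le>n. \<bar>snd q i\<bar>) = 1}
     \<inter> {q. (\<Sum>i\<le>n. snd q i *\<^sub>R fst (fst q) i) = 0}"
  have "closed {q :: ((nat \<Rightarrow> real^'d) \<times> (real^'d^'d)) \<times> (nat \<Rightarrow> real). (\<Sum>i\<le>n. snd q i) \<in> C}"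
    using C
  proof
    assume "C = {0}"
    then show ?thesis by (simp only: singleton_iff) (intro closed_Collect_eq continuous_on_sum continuous_weight continuous_on_const)
  qed simp
  then have T: "closed ?T"
    by (intro closed_Int closed_INT ballI closed_Collect_eq continuous_on_sum continuous_on_rabs
        continuous_on_const continuous_weight continuous_combination)
  have "(\<exists>l. (\<exists>i\<in>I. l i \<noteq> 0) \<and> sum l I \<in> C \<and> (\<Sum>i\<in>I. l i *\<^sub>R partial_sum (x \<omega>) i) = 0)
      \<longleftrightarrow> (\<exists>l. (\<forall>i>n. l i = 0) \<and> ((walk_points n (x \<omega>), 0 :: real^'d^'d), l) \<in> ?T)" (is "?A \<longleftrightarrow> ?B") for \<omega>
  proof
    assume ?A
    then obtain l where l: "\<exists>i\<in>I. l i \<noteq> 0" "sum l I \<in> C" "(\<Sum>i\<in>I. l i *\<^sub>R partial_sum (x \<omega>) i) = 0" by blast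
    define t where "t = (\<Sum>i\<in>I. \<bar>l i\<bar>)"
    have "t \<noteq> 0" using l(1) finI by (auto simp: t_def sum_nonneg_eq_0_iff)
    moreover have "0 \<le> t" unfolding t_def by (intro sum_nonneg) simp
    ultimately have t: "0 < t" by simp
    define b where "b i = (if i \<in> I then 1 / t * l i else 0)" for i
    have "(\<Sum>i\<le>n. b i) = (\<Sum>i\<in>I. 1 / t * l i)"
      using I by (intro sum.mono_neutral_cong_right) (auto simp: b_def)
    also have "\<dots> = 1 / t * sum l I" by (simp only: sum_distrib_left)
    finally have "(\<Sum>i\<le>n. b i) \<in> C" using l(2) C by auto
    moreover have "(\<Sum>i\<le>n. \<bar>b i\<bar>) = 1"
    proof -
      have "(\<Sum>i\<le>n. \<bar>b i\<bar>) = (\<Sum>i\<in>I. \<bar>l i\<bar> / t)"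
        using I t by (intro sum.mono_neutral_cong_right) (auto simp: b_def)
      also have "\<dots> = 1" using t by (simp add: sum_divide_distrib[symmetric] t_def)
      finally show ?thesis .
    qed
    moreover have "(\<Sum>i\<le>n. b i *\<^sub>R walk_points n (x \<omega>) i) = 0"
    proof -
      have "(\<Sum>i\<le>n. b i *\<^sub>R walk_points n (x \<omega>) i) = (\<Sum>i\<in>I. (1 / t) *\<^sub>R (l i *\<^sub>R partial_sum (x \<omega>) i))"
        unfolding combination_walk_points using I by (intro sum.mono_neutral_cong_right) (auto simp: b_def)
      then show ?thesis using l(3) by (simp only: scaleR_sum_right[symmetric] scaleR_zero_right)
    qed
    moreover have "b i = 0" if "i \<in> - I" for i using that by (simp add: b_def)
    ultimately have "((walk_points n (x \<omega>), 0 :: real^'d^'d), b) \<in> ?T" by simp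
    moreover have "\<forall>i>n. b i = 0" using I by (auto simp: b_def)
    ultimately show ?B by blast
  next
    assume ?B
    then obtain l where l: "(\<Sum>i\<le>n. l i) \<in> C" "\<And>i. i \<in> - I \<Longrightarrow> l i = 0" "(\<Sum>i\<le>n. \<bar>l i\<bar>) = 1"
      "walk_comb n (x \<omega>) l = 0"
      by (auto simp: combination_walk_points)
    have "sum l I = (\<Sum>i\<le>n. l i)" using I l(2) by (intro sum.mono_neutral_left) auto
    moreover have "(\<Sum>i\<in>I. l i *\<^sub>R partial_sum (x \<omega>) i) = walk_comb n (x \<omega>) l"
      using I l(2) by (intro sum.mono_neutral_left) auto
    moreover have "\<exists>i\<in>I. l i \<noteq> 0"
    proof (rule ccontr)
      assume "\<not> (\<exists>i\<in>I. l i \<noteq> 0)"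
      then have "l i = 0" for i using l(2)[of i] by (cases "i \<in> I") auto
      with l(3) show False by simp
    qed
    ultimately show ?A using l(1,4) by (intro exI[of _ l]) simp
  qed
  then have "{\<omega> \<in> space N. \<exists>l. (\<exists>i\<in>I. l i \<noteq> 0) \<and> sum l I \<in> C \<and> (\<Sum>i\<in>I. l i *\<^sub>R partial_sum (x \<omega>) i) = 0}
      = {\<omega> \<in> space N. \<exists>l. (\<forall>i>n. l i = 0) \<and> ((walk_points n (x \<omega>), 0 :: real^'d^'d), l) \<in> ?T}" by simp
  also have "\<dots> \<in> sets N" by (rule measurable_exists_weights[OF T _ x]) simp
  finally show ?thesis .
qed

lemma sets_dependent_partial_sums:
  assumes x: "x \<in> measurable N (PiM {1..n} (\<lambda>_. borel :: (real^'d) measure))" and I: "I \<subseteq> {1..n}"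
  shows "{\<omega> \<in> space N. dependent_family I (partial_sum (x \<omega>))} \<in> sets N"
proof -
  have "I \<subseteq> {..n}" using I by auto
  from sets_weighted_dependence[OF x this, of UNIV] show ?thesis by (simp add: dependent_family_def)
qed

text \<open>
  The dimension is at least i if and only if some i + 1 of the points are affinely independent. As
  these are open conditions, this gives measurability of the dimension.
\<close>

lemma aff_dim_ge_iff:
  fixes S :: "'i \<Rightarrow> 'a::euclidean_space"
  assumes J: "finite J"
  shows "int i \<le> aff_dim (S ` J) \<longleftrightarrow>
     (\<exists>K\<subseteq>J. card K = Suc i \<and> \<not> (\<exists>l. (\<exists>i\<in>K. l i \<noteq> 0) \<and> sum l K \<in> {0} \<and> (\<Sum>i\<in>K. l i *\<^sub>R S i) = 0))"
proof
  assume ge: "int i \<le> aff_dim (S ` J)"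
  obtain B where B: "B \<subseteq> S ` J" "\<not> affine_dependent B" "affine hull B = affine hull (S ` J)"
    using affine_basis_exists[of "S ` J"] by blast
  have finB: "finite B" using B(1) J finite_subset by blast
  have "aff_dim B = aff_dim (S ` J)" using B(3) by (metis aff_dim_affine_hull)
  then have "Suc i \<le> card B" using ge aff_dim_affine_independent[OF B(2)] by simp
  then obtain D where D: "D \<subseteq> B" "card D = Suc i" "finite D" by (meson obtain_subset_with_card_n)
  have indD: "\<not> affine_dependent D" using B(2) D(1) affine_independent_subset by blast
  have "D \<subseteq> S ` J" using D(1) B(1) by (rule subset_trans)
  then obtain K where K: "K \<subseteq> J" "inj_on S K" "D = S ` K" by (auto simp: subset_image_inj)
  have finK: "finite K" using K(1) J finite_subset by blast
  have "\<not> (\<exists>l. (\<exists>i\<in>K. l i \<noteq> 0) \<and> sum l K \<in> {0} \<and> (\<Sum>i\<in>K. l i *\<^sub>R S i) = 0)"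
  proof
    assume "\<exists>l. (\<exists>i\<in>K. l i \<noteq> 0) \<and> sum l K \<in> {0} \<and> (\<Sum>i\<in>K. l i *\<^sub>R S i) = 0"
    then obtain l i where l: "i \<in> K" "l i \<noteq> 0" "sum l K = 0" "(\<Sum>i\<in>K. l i *\<^sub>R S i) = 0" by auto
    define u where "u v = l (the_inv_into K S v)" for v
    have u: "u (S i) = l i" if "i \<in> K" for i using that K(2) by (simp add: u_def the_inv_into_f_f)
    have "sum u D = 0" using l(3) u by (simp add: K(3) sum.reindex[OF K(2)])
    moreover have "(\<Sum>v\<in>D. u v *\<^sub>R v) = 0" using l(4) u by (simp add: K(3) sum.reindex[OF K(2)])
    moreover have "\<exists>v\<in>D. u v \<noteq> 0" using l(1,2) u[OF l(1)] K(3) by (auto intro!: bexI[of _ i])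
    ultimately have "affine_dependent D" using affine_dependent_explicit_finite[OF D(3)] by blast
    with indD show False by contradiction
  qed
  moreover have "card K = Suc i" using D(2) K(3) card_image[OF K(2)] by simp
  ultimately show "\<exists>K\<subseteq>J. card K = Suc i \<and> \<not> (\<exists>l. (\<exists>i\<in>K. l i \<noteq> 0) \<and> sum l K \<in> {0} \<and> (\<Sum>i\<in>K. l i *\<^sub>R S i) = 0)"
    using K(1) by blast
next
  assume "\<exists>K\<subseteq>J. card K = Suc i \<and> \<not> (\<exists>l. (\<exists>i\<in>K. l i \<noteq> 0) \<and> sum l K \<in> {0} \<and> (\<Sum>i\<in>K. l i *\<^sub>R S i) = 0)"
  then obtain K where K: "K \<subseteq> J" "card K = Suc i"
    "\<not> (\<exists>l. (\<exists>i\<in>K. l i \<noteq> 0) \<and> sum l K \<in> {0} \<and> (\<Sum>i\<in>K. l i *\<^sub>R S i) = 0)" by blast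
  have finK: "finite K" using K(1) J finite_subset by blast
  have "aff_dim (convex hull (S ` K)) = int (card K) - 1"
    by (rule affine_independent_family(3)[OF finK]) (use K(3) in blast)
  then have "aff_dim (S ` K) = int i" using K(2) by (simp add: aff_dim_convex_hull)
  moreover have "aff_dim (S ` K) \<le> aff_dim (S ` J)" using K(1) by (intro aff_dim_subset image_mono)
  ultimately show "int i \<le> aff_dim (S ` J)" by simp
qed

lemma sets_aff_dim_partial_sums:
  assumes x: "x \<in> measurable N (PiM {1..n} (\<lambda>_. borel :: (real^'d) measure))" and J: "J \<subseteq> {..n}"
  shows "{\<omega> \<in> space N. aff_dim (partial_sum (x \<omega>) ` J) = int j} \<in> sets N"
proof -
  have finJ: "finite J" using J finite_subset by blast
  have ge: "{\<omega> \<in> space N. int i \<le> aff_dim (partial_sum (x \<omega>) ` J)} \<in> sets N" for i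
  proof -
    let ?D = "\<lambda>K. {\<omega> \<in> space N. \<exists>l. (\<exists>i\<in>K. l i \<noteq> 0) \<and> sum l K \<in> {0} \<and> (\<Sum>i\<in>K. l i *\<^sub>R partial_sum (x \<omega>) i) = 0}"
    have "{\<omega> \<in> space N. int i \<le> aff_dim (partial_sum (x \<omega>) ` J)}
        = (\<Union>K\<in>{K. K \<subseteq> J \<and> card K = Suc i}. space N - ?D K)"
      unfolding aff_dim_ge_iff[OF finJ] by blast
    also have "\<dots> \<in> sets N"
    proof (intro sets.finite_UN sets.compl_sets)
      show "finite {K. K \<subseteq> J \<and> card K = Suc i}" by (rule finite_subset[of _ "Pow J"]) (use finJ in auto)
      fix K assume "K \<in> {K. K \<subseteq> J \<and> card K = Suc i}"
      then have "K \<subseteq> {..n}" using J by auto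
      then show "?D K \<in> sets N" by (rule sets_weighted_dependence[OF x]) simp
    qed
    finally show ?thesis .
  qed
  have "{\<omega> \<in> space N. aff_dim (partial_sum (x \<omega>) ` J) = int j}
      = {\<omega> \<in> space N. int j \<le> aff_dim (partial_sum (x \<omega>) ` J)} - {\<omega> \<in> space N. int (Suc j) \<le> aff_dim (partial_sum (x \<omega>) ` J)}"
    by auto
  also have "\<dots> \<in> sets N" by (intro sets.Diff ge)
  finally show ?thesis .
qed

lemma exists_sorting_permutation:
  fixes f :: "nat \<Rightarrow> real"
  shows "\<exists>\<pi>. \<pi> permutes {1..n} \<and> (\<forall>i. 1 \<le> i \<longrightarrow> i < n \<longrightarrow> f (\<pi> i) \<le> f (\<pi> (Suc i)))"
proof (induction n arbitrary: f)
  case 0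
  then show ?case by (intro exI[of _ id]) (auto simp: permutes_id)
next
  case (Suc n)
  obtain p where p: "p \<in> {1..Suc n}" "\<And>q. q \<in> {1..Suc n} \<Longrightarrow> f q \<le> f p"
    using Max_in[of "f ` {1..Suc n}"] Max_ge[of "f ` {1..Suc n}"] by fastforce
  let ?t = "Transposition.transpose p (Suc n)"
  obtain \<rho> where \<rho>: "\<rho> permutes {1..n}" "\<And>i. 1 \<le> i \<Longrightarrow> i < n \<Longrightarrow> f (?t (\<rho> i)) \<le> f (?t (\<rho> (Suc i)))"
    using Suc.IH[of "f \<circ> ?t"] by auto
  have \<rho>': "\<rho> permutes {1..Suc n}" using \<rho>(1) by (rule permutes_subset) auto
  have t: "?t permutes {1..Suc n}" using p(1) by (intro permutes_swap_id) auto
  have \<pi>: "?t \<circ> \<rho> permutes {1..Suc n}" by (rule permutes_compose[OF \<rho>' t])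
  have "f ((?t \<circ> \<rho>) i) \<le> f ((?t \<circ> \<rho>) (Suc i))" if i: "1 \<le> i" "i < Suc n" for i
  proof (cases "i = n")
    case True
    have "\<rho> (Suc n) = Suc n" using permutes_not_in[OF \<rho>(1), of "Suc n"] by simp
    then have "(?t \<circ> \<rho>) (Suc i) = p" using True by simp
    moreover have "(?t \<circ> \<rho>) i \<in> {1..Suc n}" using permutes_in_image[OF \<pi>, of i] i by simp
    ultimately show ?thesis using p(2) by simp
  next
    case False
    then show ?thesis using \<rho>(2)[of i] i by simp
  qed
  with \<pi> show ?case by blast
qed

text \<open>
  List the increments in the order of their coefficients. Summation by parts then expresses the
  combination by the positions at which the coefficient changes, and there are at most as many of
  these as non-zero values. So general position of the increments follows from linear independence
  of d positions, required for all orders of the increments.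
\<close>

lemma general_position_if_all_orders_independent:
  fixes x :: "nat \<Rightarrow> real^'d"
  assumes n: "d \<le> n"
    and indep: "\<And>\<pi> I. \<pi> permutes {1..n} \<Longrightarrow> I \<subseteq> {1..n} \<Longrightarrow> card I = d \<Longrightarrow> \<not> dependent_family I (partial_sum (x \<circ> \<pi>))"
  shows "in_general_position d {0} {..n} x"
  unfolding in_general_position_def
proof (intro allI impI)
  fix c :: "nat \<Rightarrow> real"
  assume c: "c 0 = 0" "card (c ` {..n}) \<le> Suc d" "(\<Sum>r\<le>n. c r *\<^sub>R x r) \<in> {0}"
  define M where "M = Max (c ` {..n}) + 1"
  have M: "c r < M" if "r \<le> n" for r
  proof -
    have "c r \<le> Max (c ` {..n})" using that by (intro Max_ge) auto
    then show ?thesis by (simp add: M_def)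
  qed
  \<comment> \<open>Zero coefficients are sorted to the end, where the following coefficient is c_0 = 0 as well, so that they cause no change.\<close>
  define key where "key t = (if t = 0 then M else t)" for t
  obtain \<pi> where \<pi>: "\<pi> permutes {1..n}" "\<And>i. 1 \<le> i \<Longrightarrow> i < n \<Longrightarrow> key (c (\<pi> i)) \<le> key (c (\<pi> (Suc i)))"
    using exists_sorting_permutation[of n "\<lambda>i. key (c i)"] by blast
  have \<pi>0: "\<pi> 0 = 0" by (rule permutes_1_zero[OF \<pi>(1)])
  define b where "b i = c (\<pi> i)" for i
  have b0: "b 0 = 0" using c(1) \<pi>0 by (simp add: b_def)
  have ble: "b i < M" if "i \<le> n" for i
    using M[of "\<pi> i"] permutes_in_image[OF permutes_1_atMost[OF \<pi>(1)], of i] that by (simp add: b_def)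
  have mono: "key (b i) \<le> key (b i')" if "1 \<le> i" "i \<le> i'" "i' \<le> n" for i i'
    using that(2,3)
  proof (induction i' rule: dec_induct)
    case (step k)
    then show ?case using \<pi>(2)[of k] that(1) by (simp add: b_def)
  qed simp
  define J where "J = {i \<in> {1..n}. b i \<noteq> b (rotate_up n i)}"
  have J: "J \<subseteq> {1..n}" "finite J" by (auto simp: J_def)
  have bJ: "b i \<noteq> 0" if i: "i \<in> J" for i
  proof
    assume "b i = 0"
    have "b (rotate_up n i) = 0"
    proof (cases "i = n")
      case True
      then show ?thesis using b0 by (simp add: rotate_up_def)
    next
      case False
      then have "i < n" "1 \<le> i" using i by (auto simp: J_def)
      then have "M \<le> key (b (Suc i))" using mono[of i "Suc i"] \<open>b i = 0\<close> by (simp add: key_def)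
      then have "b (Suc i) = 0" using ble[of "Suc i"] \<open>i < n\<close> by (auto simp: key_def split: if_splits)
      then show ?thesis using \<open>i < n\<close> by (simp add: rotate_up_def)
    qed
    with \<open>b i = 0\<close> i show False by (simp add: J_def)
  qed
  have key_inj: "s = t" if "key s = key t" "s < M" "t < M" for s t
    using that by (auto simp: key_def split: if_splits)
  have "inj_on b J"
  proof (rule linorder_inj_onI)
    fix i i' assume ii: "i < i'" "i \<in> J" "i' \<in> J"
    then have r: "1 \<le> i" "i < n" "i' \<le> n" by (auto simp: J_def)
    show "b i \<noteq> b i'"
    proof
      assume "b i = b i'"
      moreover have "key (b i) \<le> key (b (Suc i))" "key (b (Suc i)) \<le> key (b i')"
        using mono[of i "Suc i"] mono[of "Suc i" i'] ii(1) r by auto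
      ultimately have "key (b (Suc i)) = key (b i)" by simp
      moreover have "b (Suc i) < M" "b i < M" using ble[of "Suc i"] ble[of i] r by simp_all
      ultimately have "b (Suc i) = b i" by (rule key_inj)
      then show False using ii(2) r by (simp add: J_def rotate_up_def)
    qed
  qed (auto simp: J_def)
  moreover have "b ` J \<subseteq> c ` {..n} - {0}"
  proof
    fix t assume "t \<in> b ` J"
    then obtain i where i: "i \<in> J" "t = b i" by blast
    have "\<pi> i \<in> {..n}" using permutes_in_image[OF permutes_1_atMost[OF \<pi>(1)], of i] i J(1) by auto
    then show "t \<in> c ` {..n} - {0}" using bJ[OF i(1)] i(2) by (auto simp: b_def)
  qed
  ultimately have "card J \<le> card (c ` {..n} - {0})"
    by (intro card_inj_on_le[of b]) auto
  moreover have "0 \<in> c ` {..n}" using c(1) by (intro image_eqI[of _ _ 0]) auto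
  ultimately have "card J \<le> d" using c(2) by simp
  then obtain I where I: "J \<subseteq> I" "I \<subseteq> {1..n}" "card I = d"
    using exists_subset_between[of J d "{1..n}"] J n by auto
  have "(\<Sum>r\<in>{1..n}. b r *\<^sub>R (x \<circ> \<pi>) r) = (\<Sum>r\<in>{1..n}. c r *\<^sub>R x r)"
    using sum.permute[OF \<pi>(1), of "\<lambda>r. c r *\<^sub>R x r"] by (simp add: o_def b_def)
  also have "\<dots> = (\<Sum>r\<le>n. c r *\<^sub>R x r)"
    using c(1) by (intro sum.mono_neutral_left) (auto simp: Suc_le_eq)
  finally have "(\<Sum>i\<le>n. (b i - b (rotate_up n i)) *\<^sub>R partial_sum (x \<circ> \<pi>) i) = 0"
    using c(3) abel_summation_cyclic[of b n "x \<circ> \<pi>", OF b0] by simp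
  moreover have "(\<Sum>i\<in>I. (b i - b (rotate_up n i)) *\<^sub>R partial_sum (x \<circ> \<pi>) i)
      = (\<Sum>i\<le>n. (b i - b (rotate_up n i)) *\<^sub>R partial_sum (x \<circ> \<pi>) i)"
  proof (rule sum.mono_neutral_left)
    show "\<forall>i\<in>{..n} - I. (b i - b (rotate_up n i)) *\<^sub>R partial_sum (x \<circ> \<pi>) i = 0"
    proof
      fix i assume i: "i \<in> {..n} - I"
      show "(b i - b (rotate_up n i)) *\<^sub>R partial_sum (x \<circ> \<pi>) i = 0"
      proof (cases "i = 0")
        case False
        then have "i \<in> {1..n}" "i \<notin> J" using i I(1) by auto
        then show ?thesis by (simp add: J_def)
      qed simp
    qed
  qed (use I(2) in auto)
  ultimately have comb: "(\<Sum>i\<in>I. (b i - b (rotate_up n i)) *\<^sub>R partial_sum (x \<circ> \<pi>) i) = 0" by simp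
  have "\<not> (\<exists>i\<in>I. b i - b (rotate_up n i) \<noteq> 0)"
  proof
    assume "\<exists>i\<in>I. b i - b (rotate_up n i) \<noteq> 0"
    with comb have "dependent_family I (partial_sum (x \<circ> \<pi>))"
      unfolding dependent_family_def by (intro exI[of _ "\<lambda>i. b i - b (rotate_up n i)"] conjI)
    with indep[OF \<pi>(1) I(2,3)] show False by contradiction
  qed
  then have "J = {}" using I(1) by (auto simp: J_def)
  then have flat: "b i - b (rotate_up n i) = 0" if "i \<in> {1..n}" for i using that by (auto simp: J_def)
  have bz: "b r = 0" if "r \<in> {1..n}" for r
  proof -
    have "b r = (\<Sum>i\<in>{r..n}. b i - b (rotate_up n i))"
      using sum_cyclic_differences[of b r n, OF b0] that by simp
    also have "\<dots> = 0" using that by (intro sum.neutral ballI flat) auto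
    finally show ?thesis .
  qed
  show "\<forall>r\<in>{..n}. c r = 0"
  proof
    fix r assume r: "r \<in> {..n}"
    show "c r = 0"
    proof (cases "r = 0")
      case False
      then have "inv \<pi> r \<in> {1..n}" using permutes_in_image[OF permutes_inv[OF \<pi>(1)], of r] r by simp
      from bz[OF this] show ?thesis by (simp add: b_def permutes_inverses[OF \<pi>(1)])
    qed (use c(1) in simp)
  qed
qed

section \<open>The expected angle sum\<close>

lemma partial_sum_cong:
  "(\<And>r. r \<in> {1..n} \<Longrightarrow> x r = y r) \<Longrightarrow> i \<le> n \<Longrightarrow> partial_sum x i = partial_sum y i"
  unfolding partial_sum_def by (intro sum.cong) auto

lemma absorbed_cong:
  assumes "\<And>r. r \<in> {1..n} \<Longrightarrow> x r = y r"
  shows "absorbed W x n I \<longleftrightarrow> absorbed W y n I"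
proof -
  have "walk_comb n x l = (\<Sum>i\<le>n. l i *\<^sub>R partial_sum y i)" for l :: "nat \<Rightarrow> real"
    using partial_sum_cong[OF assms] by (intro sum.cong) auto
  then show ?thesis unfolding absorbed_def by simp
qed

lemma dependent_family_cong:
  "(\<And>i. i \<in> I \<Longrightarrow> v i = w i) \<Longrightarrow> dependent_family I v \<longleftrightarrow> dependent_family I w"
  unfolding dependent_family_def by (intro ex_cong1 conj_cong refl arg_cong2[where f = "(=)"] sum.cong) auto

definition angle_sum :: "nat \<Rightarrow> nat \<Rightarrow> nat \<Rightarrow> (nat \<Rightarrow> real^'d) \<Rightarrow> real" where
  "angle_sum n j k x = (\<Sum>F\<in>faces j (convex hull (partial_sum x ` {..n})).
     grassmann_angle k (tangent_cone F (convex hull (partial_sum x ` {..n}))))"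

text \<open>
  The sum over faces is a sum over all index sets, including degenerate walks, in which
  the conditions of being a face and of dimension j are measurable, and the angle is the measure of a
  section of a measurable set of pairs.
\<close>

lemma borel_measurable_angle_sum:
  "angle_sum n j k \<in> borel_measurable (PiM {1..n} (\<lambda>_. borel :: (real^'d) measure))"
proof -
  let ?N = "PiM {1..n} (\<lambda>_. borel :: (real^'d) measure)"
  let ?m = "CARD('d) - k"
  let ?\<mu> = "uniform_grassmannian ?m :: (real^'d) set measure"
  have m: "?m \<le> CARD('d)" by simp
  interpret \<mu>: prob_space ?\<mu> by (rule prob_space_uniform_grassmannian[OF m])
  have meas: "(\<lambda>x. measure ?\<mu> {W \<in> grassmannian ?m. meets_tangent W n x J}) \<in> borel_measurable ?N" for J
  proof -
    let ?A = "{p \<in> space (?N \<Otimes>\<^sub>M ?\<mu>). meets_tangent (snd p) n (fst p) J}"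
    have "?A \<in> sets (?N \<Otimes>\<^sub>M ?\<mu>)"
    proof (rule sets_meets_tangent[OF measurable_fst])
      have "proj_matrix \<in> borel_measurable ?\<mu>"
        using measurable_proj_matrix by (simp only: measurable_cong_sets[OF sets_uniform_grassmannian[OF m] refl])
      then show "(\<lambda>p. proj_matrix (snd p)) \<in> borel_measurable (?N \<Otimes>\<^sub>M ?\<mu>)"
        by (rule measurable_compose[OF measurable_snd])
      show "subspace (snd p)" if "p \<in> space (?N \<Otimes>\<^sub>M ?\<mu>)" for p
        using that by (auto simp: space_pair_measure space_uniform_grassmannian[OF m] grassmannian_def)
    qed
    then have "(\<lambda>x. emeasure ?\<mu> (Pair x -` ?A)) \<in> borel_measurable ?N"
      by (rule \<mu>.measurable_emeasure_Pair)
    then have mA: "(\<lambda>x. measure ?\<mu> (Pair x -` ?A)) \<in> borel_measurable ?N"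
      unfolding measure_def by (rule borel_measurable_enn2real)
    have "Pair x -` ?A = {W \<in> grassmannian ?m. meets_tangent W n x J}" if "x \<in> space ?N" for x
      using that by (auto simp: space_pair_measure space_uniform_grassmannian[OF m])
    then have "measure ?\<mu> (Pair x -` ?A) = measure ?\<mu> {W \<in> grassmannian ?m. meets_tangent W n x J}"
      if "x \<in> space ?N" for x using that by (simp only:)
    from measurable_cong[THEN iffD1, OF this mA] show ?thesis .
  qed
  have ind: "(\<lambda>x. of_bool (face_indices n x J \<and> aff_dim (partial_sum x ` J) = int j) :: real) \<in> borel_measurable ?N"
    if J: "J \<subseteq> {..n}" for J
  proof -
    have id: "(\<lambda>x. x) \<in> measurable ?N ?N" by simp
    have "{x \<in> space ?N. face_indices n x J} \<inter> {x \<in> space ?N. aff_dim (partial_sum x ` J) = int j} \<in> sets ?N"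
      by (intro sets.Int sets_face_indices[OF id] sets_aff_dim_partial_sums[OF id J])
    then have "(indicator ({x \<in> space ?N. face_indices n x J} \<inter> {x \<in> space ?N. aff_dim (partial_sum x ` J) = int j}) :: _ \<Rightarrow> real)
        \<in> borel_measurable ?N" by (rule borel_measurable_indicator)
    then show ?thesis
      by (rule measurable_cong[THEN iffD1, rotated]) (simp add: indicator_def)
  qed
  have "angle_sum n j k = (\<lambda>x :: nat \<Rightarrow> real^'d. \<Sum>J\<in>Pow {..n}. of_bool (face_indices n x J \<and> aff_dim (partial_sum x ` J) = int j) *
            measure ?\<mu> {W \<in> grassmannian ?m. meets_tangent W n x J})"
    unfolding angle_sum_def by (rule ext) (rule sum_grassmann_angles)
  also have "\<dots> \<in> borel_measurable ?N"
    by (intro borel_measurable_sum borel_measurable_times meas ind) auto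
  finally show ?thesis .
qed

lemma angle_sum_general_position:
  fixes x :: "nat \<Rightarrow> real^'d"
  assumes gp: "in_general_position CARD('d) {0} {..n} x" and j: "j < CARD('d)"
  shows "angle_sum n j k x = (\<Sum>I | I \<subseteq> {..n} \<and> card I = Suc j. of_bool (\<not> absorbed {0} x n I) *
     measure (uniform_grassmannian (CARD('d) - k)) {W \<in> grassmannian (CARD('d) - k). absorbed W x n I})"
  unfolding angle_sum_def sum_grassmann_angles by (rule sum_grassmann_angles_general_position[OF gp j])

text \<open>
  If {0} absorbs I, so does every W. Hence the angle of an unabsorbed I is 1 minus the probability that
  W does not absorb I, and both parts are counted by sum_not_absorbed: once with the subspace {0} of
  codimension d, once under the integral with almost every W of codimension k.
\<close>

lemma sum_angle_sum_permutations:
  fixes x :: "nat \<Rightarrow> real^'d"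
  assumes gp: "in_general_position CARD('d) {0} {..n} x" and n: "CARD('d) \<le> n"
    and j: "j < CARD('d)" and k: "k \<le> CARD('d)"
  shows "(\<Sum>\<pi> | \<pi> permutes {1..n}. angle_sum n j k (x \<circ> \<pi>))
       = 2 * fact j * (real (stirling_tail n CARD('d) 0 (Suc j)) - real (stirling_tail n k 0 (Suc j)))"
proof -
  let ?m = "CARD('d) - k" and ?P = "{\<pi>. \<pi> permutes {1..n}}" and ?I = "{I. I \<subseteq> {..n} \<and> card I = Suc j}"
  let ?\<mu> = "uniform_grassmannian ?m :: (real^'d) set measure"
  have m: "?m \<le> CARD('d)" by simp
  interpret \<mu>: prob_space ?\<mu> by (rule prob_space_uniform_grassmannian[OF m])
  have finP: "finite ?P" by (rule finite_permutations) simp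
  have finI: "finite ?I" by (rule finite_subset[of _ "Pow {..n}"]) auto
  have gp\<pi>: "in_general_position CARD('d) {0} {..n} (x \<circ> \<pi>)" if \<pi>: "\<pi> permutes {1..n}" for \<pi>
  proof -
    note \<pi>' = permutes_1_atMost[OF \<pi>]
    show ?thesis unfolding in_general_position_def
    proof (intro allI impI ballI)
      fix c :: "nat \<Rightarrow> real" and r
      assume c: "c 0 = 0" "card (c ` {..n}) \<le> Suc CARD('d)" "(\<Sum>r\<le>n. c r *\<^sub>R (x \<circ> \<pi>) r) \<in> {0}" and r: "r \<in> {..n}"
      define b where "b = c \<circ> inv \<pi>"
      have b0: "b 0 = 0" using c(1) permutes_1_zero[OF permutes_inv[OF \<pi>]] by (simp add: b_def)
      have bim: "b ` {..n} = c ` {..n}"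
        unfolding b_def image_comp[symmetric] permutes_image[OF permutes_inv[OF \<pi>']] ..
      have "(\<Sum>r\<le>n. c r *\<^sub>R (x \<circ> \<pi>) r) = (\<Sum>r\<le>n. b r *\<^sub>R x r)"
        using sum.permute[OF \<pi>', of "\<lambda>r. b r *\<^sub>R x r"] by (simp add: b_def o_def permutes_inverses[OF \<pi>])
      then have bsum: "(\<Sum>r\<le>n. b r *\<^sub>R x r) \<in> {0}" using c(3) by simp
      have "\<pi> r \<in> {..n}" using permutes_in_image[OF \<pi>', of r] r by simp
      have "b (\<pi> r) = 0"
        by (rule in_general_positionD[OF gp b0 _ bsum \<open>\<pi> r \<in> {..n}\<close>]) (simp only: bim c(2))
      then show "c r = 0" by (simp add: b_def permutes_inverses[OF \<pi>])
    qed
  qed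
  have sets: "{W \<in> grassmannian ?m. absorbed W y n I} \<in> sets ?\<mu>"
    if na: "\<not> absorbed {0} y n I" for y :: "nat \<Rightarrow> real^'d" and I
  proof -
    have y: "(\<lambda>W. \<lambda>r\<in>{1..n}. y r) \<in> measurable ?\<mu> (PiM {1..n} (\<lambda>_. borel))"
      by (rule measurable_restrict) simp
    have na': "\<not> absorbed {0} (\<lambda>r\<in>{1..n}. y r) n I"
      using na absorbed_cong[of n "\<lambda>r\<in>{1..n}. y r" y "{0}" I] by simp
    have "{W \<in> space ?\<mu>. meets_tangent W n (\<lambda>r\<in>{1..n}. y r) I} \<in> sets ?\<mu>"
    proof (rule sets_meets_tangent[OF y, of "\<lambda>W. W"])
      show "(\<lambda>W. proj_matrix W) \<in> borel_measurable ?\<mu>"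
        using measurable_proj_matrix by (simp only: measurable_cong_sets[OF sets_uniform_grassmannian[OF m] refl])
      show "subspace W" if "W \<in> space ?\<mu>" for W
        using that by (simp add: space_uniform_grassmannian[OF m] grassmannian_def)
    qed
    moreover have "absorbed W (\<lambda>r\<in>{1..n}. y r) n I \<longleftrightarrow> absorbed W y n I" for W
      by (rule absorbed_cong) simp
    ultimately show ?thesis
      by (simp only: meets_tangent_iff_absorbed[OF na'] space_uniform_grassmannian[OF m])
  qed
  have sets': "{W \<in> grassmannian ?m. \<not> absorbed W y n I} \<in> sets ?\<mu>" for y :: "nat \<Rightarrow> real^'d" and I
  proof (cases "absorbed {0} y n I")
    case True
    have "{W \<in> grassmannian ?m. \<not> absorbed W y n I} = {}"
      using True subspace_0 unfolding absorbed_def grassmannian_def by fastforce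
    then show ?thesis by (simp only: sets.empty_sets)
  next
    case False
    have "{W \<in> grassmannian ?m. \<not> absorbed W y n I} = space ?\<mu> - {W \<in> grassmannian ?m. absorbed W y n I}"
      by (auto simp: space_uniform_grassmannian[OF m])
    then show ?thesis using sets.compl_sets[OF sets[OF False]] by simp
  qed
  have split: "of_bool (\<not> absorbed {0} y n I) * measure ?\<mu> {W \<in> grassmannian ?m. absorbed W y n I}
      = of_bool (\<not> absorbed {0} y n I) - measure ?\<mu> {W \<in> grassmannian ?m. \<not> absorbed W y n I}" for y :: "nat \<Rightarrow> real^'d" and I
  proof (cases "absorbed {0} y n I")
    case True
    have "{W \<in> grassmannian ?m. \<not> absorbed W y n I} = {}"
      using True subspace_0 unfolding absorbed_def grassmannian_def by fastforce
    with True show ?thesis by (simp only: measure_empty) simp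
  next
    case False
    have "{W \<in> grassmannian ?m. absorbed W y n I} = space ?\<mu> - {W \<in> grassmannian ?m. \<not> absorbed W y n I}"
      by (auto simp: space_uniform_grassmannian[OF m])
    then have "measure ?\<mu> {W \<in> grassmannian ?m. absorbed W y n I} = 1 - measure ?\<mu> {W \<in> grassmannian ?m. \<not> absorbed W y n I}"
      using \<mu>.prob_compl[OF sets'[of y I]] by (simp only:)
    with False show ?thesis by simp
  qed
  have zero: "(\<Sum>\<pi>\<in>?P. \<Sum>I\<in>?I. of_bool (\<not> absorbed {0} (x \<circ> \<pi>) n I)) = real (2 * fact j * stirling_tail n CARD('d) 0 (Suc j))"
  proof -
    have "(\<Sum>\<pi>\<in>?P. \<Sum>I\<in>?I. (of_bool (\<not> absorbed {0} (x \<circ> \<pi>) n I) :: nat)) = 2 * fact j * stirling_tail n CARD('d) 0 (Suc j)"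
      by (rule sum_not_absorbed[OF subspace_single_0 _ gp]) (use j n in simp_all)
    from arg_cong[OF this, of real] show ?thesis by (simp only: of_nat_sum of_nat_of_bool)
  qed
  have proj: "(\<Sum>\<pi>\<in>?P. \<Sum>I\<in>?I. measure ?\<mu> {W \<in> grassmannian ?m. \<not> absorbed W (x \<circ> \<pi>) n I})
      = real (2 * fact j * stirling_tail n k 0 (Suc j))"
  proof -
    have intg: "integrable ?\<mu> (indicator {W \<in> grassmannian ?m. \<not> absorbed W (x \<circ> \<pi>) n I} :: _ \<Rightarrow> real)" for \<pi> I
      by (rule integrable_real_indicator[OF sets']) (simp add: \<mu>.emeasure_eq_measure)
    have "(\<Sum>\<pi>\<in>?P. \<Sum>I\<in>?I. measure ?\<mu> {W \<in> grassmannian ?m. \<not> absorbed W (x \<circ> \<pi>) n I})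
        = (\<Sum>\<pi>\<in>?P. \<Sum>I\<in>?I. \<mu>.expectation (indicator {W \<in> grassmannian ?m. \<not> absorbed W (x \<circ> \<pi>) n I}))"
      by (intro sum.cong refl) (simp add: sets' sets.Int_space_eq2)
    also have "\<dots> = (\<Sum>\<pi>\<in>?P. \<mu>.expectation (\<lambda>W. \<Sum>I\<in>?I. indicator {W \<in> grassmannian ?m. \<not> absorbed W (x \<circ> \<pi>) n I} W))"
      by (rule sum.cong[OF refl]) (rule Bochner_Integration.integral_sum[OF intg, symmetric])
    also have "\<dots> = \<mu>.expectation (\<lambda>W. \<Sum>\<pi>\<in>?P. \<Sum>I\<in>?I. indicator {W \<in> grassmannian ?m. \<not> absorbed W (x \<circ> \<pi>) n I} W)"
      by (rule Bochner_Integration.integral_sum[symmetric]) (rule Bochner_Integration.integrable_sum[OF intg])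
    also have "\<dots> = \<mu>.expectation (\<lambda>W. real (2 * fact j * stirling_tail n k 0 (Suc j)))"
    proof (rule integral_cong_AE)
      show "(\<lambda>W. \<Sum>\<pi>\<in>?P. \<Sum>I\<in>?I. indicator {W \<in> grassmannian ?m. \<not> absorbed W (x \<circ> \<pi>) n I} W :: real) \<in> borel_measurable ?\<mu>"
        by (intro borel_measurable_sum borel_measurable_indicator sets')
      have "AE W in ?\<mu>. W \<in> grassmannian ?m"
        using AE_space[of ?\<mu>] by (simp only: space_uniform_grassmannian[OF m])
      with AE_in_general_position[OF gp k]
      show "AE W in ?\<mu>. (\<Sum>\<pi>\<in>?P. \<Sum>I\<in>?I. indicator {W \<in> grassmannian ?m. \<not> absorbed W (x \<circ> \<pi>) n I} W)
          = real (2 * fact j * stirling_tail n k 0 (Suc j))"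
      proof eventually_elim
        case (elim W)
        then have W: "subspace W" "dim W + k = DIM(real^'d)" using k by (simp_all add: grassmannian_def)
        have "j < n" using j n by simp
        from sum_not_absorbed[OF W elim(1) this]
        have "(\<Sum>\<pi>\<in>?P. \<Sum>I\<in>?I. (of_bool (\<not> absorbed W (x \<circ> \<pi>) n I) :: nat)) = 2 * fact j * stirling_tail n k 0 (Suc j)" .
        moreover have "(\<Sum>\<pi>\<in>?P. \<Sum>I\<in>?I. indicator {W \<in> grassmannian ?m. \<not> absorbed W (x \<circ> \<pi>) n I} W)
            = real (\<Sum>\<pi>\<in>?P. \<Sum>I\<in>?I. (of_bool (\<not> absorbed W (x \<circ> \<pi>) n I) :: nat))"
          using elim(2) by (simp only: of_nat_sum of_nat_of_bool indicator_def mem_Collect_eq simp_thms)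
        ultimately show ?case by (simp only:)
      qed
    qed simp
    also have "\<dots> = real (2 * fact j * stirling_tail n k 0 (Suc j))" by (simp add: \<mu>.prob_space)
    finally show ?thesis .
  qed
  have "(\<Sum>\<pi>\<in>?P. angle_sum n j k (x \<circ> \<pi>))
      = (\<Sum>\<pi>\<in>?P. \<Sum>I\<in>?I. of_bool (\<not> absorbed {0} (x \<circ> \<pi>) n I) - measure ?\<mu> {W \<in> grassmannian ?m. \<not> absorbed W (x \<circ> \<pi>) n I})"
  proof (rule sum.cong[OF refl])
    fix \<pi> assume "\<pi> \<in> ?P"
    then have "\<pi> permutes {1..n}" by simp
    from angle_sum_general_position[OF gp\<pi>[OF this] j]
    show "angle_sum n j k (x \<circ> \<pi>) = (\<Sum>I\<in>?I. of_bool (\<not> absorbed {0} (x \<circ> \<pi>) n I)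
        - measure ?\<mu> {W \<in> grassmannian ?m. \<not> absorbed W (x \<circ> \<pi>) n I})"
      by (simp only: split)
  qed
  also have "\<dots> = real (2 * fact j * stirling_tail n CARD('d) 0 (Suc j)) - real (2 * fact j * stirling_tail n k 0 (Suc j))"
    by (simp only: sum_subtractf zero proj)
  also have "\<dots> = 2 * fact j * (real (stirling_tail n CARD('d) 0 (Suc j)) - real (stirling_tail n k 0 (Suc j)))"
    by (simp add: right_diff_distrib)
  finally show ?thesis .
qed

text \<open>
  By exchangeability the assumption on the positions holds for every order of the increments.
\<close>

lemma AE_walk_in_general_position:
  fixes M :: "'w measure" and \<xi> :: "nat \<Rightarrow> 'w \<Rightarrow> real^'d"
  assumes M: "prob_space M" and n: "CARD('d) \<le> n"
    and meas: "\<And>i. i \<in> {1..n} \<Longrightarrow> \<xi> i \<in> borel_measurable M"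
    and ex: "exchangeable M n \<xi>" and gp: "general_position M n \<xi>"
  shows "AE \<omega> in M. in_general_position CARD('d) {0} {..n} (\<lambda>i. \<xi> i \<omega>)"
proof -
  interpret prob_space M by (rule M)
  let ?N = "PiM {1..n} (\<lambda>_. borel :: (real^'d) measure)"
  let ?X = "\<lambda>\<pi> \<omega>. \<lambda>i\<in>{1..n}. \<xi> (\<pi> i) \<omega>"
  have Xm: "?X \<pi> \<in> measurable M ?N" if "\<pi> permutes {1..n}" for \<pi>
    using permutes_in_image[OF that] by (intro measurable_restrict meas) auto
  have idm: "(\<lambda>x. x) \<in> measurable ?N ?N" by simp
  have indep: "AE \<omega> in M. \<not> dependent_family I (partial_sum ((\<lambda>i. \<xi> i \<omega>) \<circ> \<pi>))"
    if \<pi>: "\<pi> permutes {1..n}" and I: "I \<subseteq> {1..n}" "card I = CARD('d)" for \<pi> I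
  proof -
    let ?E = "{x \<in> space ?N. dependent_family I (partial_sum x)}"
    have E: "?E \<in> sets ?N" by (rule sets_dependent_partial_sums[OF idm I(1)])
    have pre: "?X \<rho> -` ?E \<inter> space M = {\<omega> \<in> space M. dependent_family I (partial_sum ((\<lambda>i. \<xi> i \<omega>) \<circ> \<rho>))}"
      if \<rho>: "\<rho> permutes {1..n}" for \<rho>
    proof -
      have "dependent_family I (partial_sum (?X \<rho> \<omega>)) \<longleftrightarrow> dependent_family I (partial_sum ((\<lambda>i. \<xi> i \<omega>) \<circ> \<rho>))" for \<omega>
      proof (rule dependent_family_cong)
        fix i assume "i \<in> I"
        then have "i \<le> n" using I(1) by auto
        then show "partial_sum (?X \<rho> \<omega>) i = partial_sum ((\<lambda>i. \<xi> i \<omega>) \<circ> \<rho>) i"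
          by (intro partial_sum_cong) auto
      qed
      then show ?thesis using measurable_space[OF Xm[OF \<rho>]] by blast
    qed
    have "measure M (?X \<pi> -` ?E \<inter> space M) = measure (distr M ?N (?X \<pi>)) ?E"
      by (rule measure_distr[OF Xm[OF \<pi>] E, symmetric])
    also have "distr M ?N (?X \<pi>) = distr M ?N (?X id)"
      using ex \<pi> unfolding exchangeable_def by simp
    also have "measure (distr M ?N (?X id)) ?E = measure M (?X id -` ?E \<inter> space M)"
      by (rule measure_distr[OF Xm[OF permutes_id] E])
    also have "?X id -` ?E \<inter> space M = {\<omega> \<in> space M. dependent_family I (\<lambda>i. walk \<xi> i \<omega>)}"
      unfolding pre[OF permutes_id] by (simp add: partial_sum_def[abs_def] walk_def)
    also have "measure M \<dots> = 0" using gp I unfolding general_position_def by blast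
    finally have "measure M (?X \<pi> -` ?E \<inter> space M) = 0" .
    moreover have "?X \<pi> -` ?E \<inter> space M \<in> sets M" by (rule measurable_sets[OF Xm[OF \<pi>] E])
    ultimately have "?X \<pi> -` ?E \<inter> space M \<in> null_sets M" by (simp add: null_sets_def emeasure_eq_measure)
    then have "AE \<omega> in M. \<omega> \<notin> {\<omega> \<in> space M. dependent_family I (partial_sum ((\<lambda>i. \<xi> i \<omega>) \<circ> \<pi>))}"
      unfolding pre[OF \<pi>] by (rule AE_not_in)
    with AE_space show ?thesis by eventually_elim simp
  qed
  have "AE \<omega> in M. \<forall>\<pi>\<in>{\<pi>. \<pi> permutes {1..n}}. \<forall>I\<in>{I. I \<subseteq> {1..n} \<and> card I = CARD('d)}.
      \<not> dependent_family I (partial_sum ((\<lambda>i. \<xi> i \<omega>) \<circ> \<pi>))"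
  proof (intro AE_finite_allI)
    show "finite {\<pi>. \<pi> permutes {1..n}}" by (rule finite_permutations) simp
    show "finite {I. I \<subseteq> {1..n} \<and> card I = CARD('d)}" by (rule finite_subset[of _ "Pow {1..n}"]) auto
  qed (use indep in auto)
  then show ?thesis
  proof eventually_elim
    case (elim \<omega>)
    show ?case by (rule general_position_if_all_orders_independent[OF n]) (use elim in blast)
  qed
qed

theorem theorem4p3:
  fixes M :: "'w measure" and \<xi> :: "nat \<Rightarrow> 'w \<Rightarrow> real^'d" and d n j k :: nat
  assumes "prob_space M"
    and "d = CARD('d)" and "n \<ge> d"
    and "\<And>i. i \<in> {1..n} \<Longrightarrow> \<xi> i \<in> borel_measurable M"
    and "exchangeable M n \<xi>"
    and "general_position M n \<xi>"
    and "j < d" and "k \<le> d"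
  shows "prob_space.expectation M
           (\<lambda>\<omega>. \<Sum>F\<in>faces j (walk_hull \<xi> n \<omega>). grassmann_angle k (tangent_cone F (walk_hull \<xi> n \<omega>)))
         = 2 * fact j / fact n * stirling_sum n d (j + 1)
           - 2 * fact j / fact n * stirling_sum n k (j + 1)"
proof -
  interpret prob_space M by fact
  let ?N = "PiM {1..n} (\<lambda>_. borel :: (real^'d) measure)" and ?P = "{\<pi>. \<pi> permutes {1..n}}"
  let ?X = "\<lambda>\<pi> \<omega>. \<lambda>i\<in>{1..n}. \<xi> (\<pi> i) \<omega>"
  let ?G = "angle_sum n j k :: (nat \<Rightarrow> real^'d) \<Rightarrow> real"
  define C where "C = 2 * fact j * (real (stirling_tail n d 0 (Suc j)) - real (stirling_tail n k 0 (Suc j)))"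
  have G: "?G \<in> borel_measurable ?N" by (rule borel_measurable_angle_sum)
  have Xm: "?X \<pi> \<in> measurable M ?N" if "\<pi> permutes {1..n}" for \<pi>
    using permutes_in_image[OF that] by (intro measurable_restrict assms(4)) auto
  have cong: "?G x = ?G y" if "\<And>r. r \<in> {1..n} \<Longrightarrow> x r = y r" for x y
  proof -
    have "partial_sum x ` {..n} = partial_sum y ` {..n}"
      using partial_sum_cong[OF that] by (intro image_cong) auto
    then show ?thesis by (simp only: angle_sum_def)
  qed
  have G_eq: "(\<Sum>F\<in>faces j (walk_hull \<xi> n \<omega>). grassmann_angle k (tangent_cone F (walk_hull \<xi> n \<omega>))) = ?G (?X id \<omega>)" for \<omega>
  proof -
    have "?G (?X id \<omega>) = ?G (\<lambda>i. \<xi> i \<omega>)" by (rule cong) simp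
    moreover have "walk_hull \<xi> n \<omega> = convex hull (partial_sum (\<lambda>i. \<xi> i \<omega>) ` {..n})"
      by (simp add: walk_hull_def walk_def partial_sum_def[abs_def] atLeast0AtMost)
    ultimately show ?thesis by (simp only: angle_sum_def)
  qed
  have same: "expectation (\<lambda>\<omega>. ?G (?X \<pi> \<omega>)) = expectation (\<lambda>\<omega>. ?G (?X id \<omega>))" if \<pi>: "\<pi> permutes {1..n}" for \<pi>
  proof -
    have "expectation (\<lambda>\<omega>. ?G (?X \<pi> \<omega>)) = integral\<^sup>L (distr M ?N (?X \<pi>)) ?G"
      by (rule integral_distr[OF Xm[OF \<pi>] G, symmetric])
    also have "distr M ?N (?X \<pi>) = distr M ?N (?X id)"
      using assms(5) \<pi> unfolding exchangeable_def by simp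
    also have "integral\<^sup>L (distr M ?N (?X id)) ?G = expectation (\<lambda>\<omega>. ?G (?X id \<omega>))"
      by (rule integral_distr[OF Xm[OF permutes_id] G])
    finally show ?thesis .
  qed
  have bounded: "\<bar>?G x\<bar> \<le> real (card (Pow {..n}))" for x
  proof -
    let ?\<mu> = "uniform_grassmannian (CARD('d) - k) :: (real^'d) set measure"
    interpret \<mu>: prob_space ?\<mu> by (rule prob_space_uniform_grassmannian) simp
    have "\<bar>?G x\<bar> \<le> (\<Sum>J\<in>Pow {..n}. \<bar>of_bool (face_indices n x J \<and> aff_dim (partial_sum x ` J) = int j) *
            measure ?\<mu> {W \<in> grassmannian (CARD('d) - k). meets_tangent W n x J}\<bar>)"
      unfolding angle_sum_def sum_grassmann_angles by (rule sum_abs)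
    also have "\<dots> \<le> (\<Sum>J\<in>Pow {..n}. 1)"
      by (intro sum_mono) (simp add: abs_mult)
    finally show ?thesis by simp
  qed
  have int: "integrable M (\<lambda>\<omega>. ?G (?X \<pi> \<omega>))" if "\<pi> permutes {1..n}" for \<pi>
    by (rule integrable_const_bound[where B = "real (card (Pow {..n}))"])
      (use bounded measurable_compose[OF Xm[OF that] G] in simp_all)
  have "AE \<omega> in M. (\<Sum>\<pi>\<in>?P. ?G (?X \<pi> \<omega>)) = C"
  proof -
    have "AE \<omega> in M. in_general_position CARD('d) {0} {..n} (\<lambda>i. \<xi> i \<omega>)"
      by (rule AE_walk_in_general_position[OF assms(1) _ assms(4,5,6)]) (use assms(2,3) in simp_all)
    then show ?thesis
    proof eventually_elim
      case (elim \<omega>)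
      have "(\<Sum>\<pi>\<in>?P. ?G (?X \<pi> \<omega>)) = (\<Sum>\<pi>\<in>?P. ?G ((\<lambda>i. \<xi> i \<omega>) \<circ> \<pi>))"
        by (intro sum.cong refl cong) simp
      also have "\<dots> = C"
        using sum_angle_sum_permutations[OF elim, of j k] assms(2,3,7,8) by (simp add: C_def)
      finally show ?case .
    qed
  qed
  moreover have "(\<lambda>\<omega>. \<Sum>\<pi>\<in>?P. ?G (?X \<pi> \<omega>)) \<in> borel_measurable M"
    by (rule borel_measurable_sum, rule measurable_compose[OF Xm G], simp)
  ultimately have "expectation (\<lambda>\<omega>. \<Sum>\<pi>\<in>?P. ?G (?X \<pi> \<omega>)) = expectation (\<lambda>\<omega>. C)"
    by (intro integral_cong_AE) simp_all
  also have "\<dots> = C" by (simp add: prob_space)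
  finally have "C = expectation (\<lambda>\<omega>. \<Sum>\<pi>\<in>?P. ?G (?X \<pi> \<omega>))" ..
  also have "\<dots> = (\<Sum>\<pi>\<in>?P. expectation (\<lambda>\<omega>. ?G (?X \<pi> \<omega>)))"
    by (rule Bochner_Integration.integral_sum) (use int in simp)
  also have "\<dots> = (\<Sum>\<pi>\<in>?P. expectation (\<lambda>\<omega>. ?G (?X id \<omega>)))"
    by (rule sum.cong[OF refl]) (use same in simp)
  also have "\<dots> = fact n * expectation (\<lambda>\<omega>. ?G (?X id \<omega>))"
    by (simp add: card_permutations)
  finally have "fact n * expectation (\<lambda>\<omega>. ?G (?X id \<omega>)) = C" ..
  then have "expectation (\<lambda>\<omega>. ?G (?X id \<omega>)) = C / fact n" by (simp add: field_simps)
  then show ?thesis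
    by (simp add: G_eq C_def stirling_sum_eq_tail diff_divide_distrib right_diff_distrib)
qed

end
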